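(* Let $\lambda>0$, $0<\alpha_1,\alpha_2\le1$ and $0<\beta\le1$. Let $\{N_{\alpha_1,\alpha_2}^\beta(t_1,t_2),\ (t_1,t_2)\in\mathbb{R}^2_+\}$ be the space-time fractional Poisson random field with parameter $\lambda$. For $i=1,2$ let $\{T_{2\alpha_i}(t),\ t\ge0\}$ be a nonnegative random process whose one-dimensional densities are the folded solutions of the Cauchy problem $$\frac{\partial^{2\alpha_i}}{\partial t^{2\alpha_i}}u_{2\alpha_i}(x,t)=\frac{\partial^2}{\partial x^2}u_{2\alpha_i}(x,t),\quad t>0,\ x\in\mathbb{R},$$ with initial condition $u_{2\alpha_i}(x,0)=\delta(x)$ for $0<\alpha_i\le1$, and additionally $\frac{\partial}{\partial t}u_{2\alpha_i}(x,t)|_{t=0}=0$ for $\frac12<\alpha_i\le1$. Let $\{H_\beta(t_1,t_2),\ (t_1,t_2)\in\mathbb{R}^2_+\}$ be a two parameter stable subordinator of index $\beta$, $\{N(t),\ t\ge0\}$ a Poisson process with rate $\lambda$, and $\{N_\beta(t_1,t_2),\ (t_1,t_2)\in\mathbb{R}^2_+\}$ the space fractional Poisson random field with parameter $\lambda$. Assume that the component processes appearing in each composition below are independent of each other. Then, for each $(t_1,t_2)\in\mathbb{R}^2_+$, $$N_{\alpha_1,\alpha_2}^\beta(t_1,t_2)\overset{d}{=}N_\beta(T_{2\alpha_1}(t_1),T_{2\alpha_2}(t_2))\overset{d}{=}N(H_\beta(T_{2\alpha_1}(t_1),T_{2\alpha_2}(t_2))),$$ where $\overset{d}{=}$ denotes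 equality in distribution.
   Context: $\mathbb{R}_+=[0,\infty)$. Space-time fractional Poisson random field (STFPRF): a nonnegative-integer-valued random field on $\mathbb{R}^2_+$, depending on a parameter $\lambda>0$, whose distribution $p_{\alpha_1,\alpha_2}^\beta(n,t_1,t_2)=\mathrm{Pr}\{N_{\alpha_1,\alpha_2}^\beta(t_1,t_2)=n\}$ (regarded also as a function of $\lambda\in(0,\infty)$) solves $$\frac{\partial^{\alpha_1+\alpha_2}}{\partial t_2^{\alpha_2}\partial t_1^{\alpha_1}}p_{\alpha_1,\alpha_2}^\beta(n,t_1,t_2)=-\bigg(\frac{\lambda^{\beta+1}}{\beta}\frac{\partial}{\partial\lambda}+\lambda^\beta\bigg)(I-B)^\beta p_{\alpha_1,\alpha_2}^\beta(n,t_1,t_2),\quad n\ge0,$$ with $p_{\alpha_1,\alpha_2}^\beta(0,0,t_2)=p_{\alpha_1,\alpha_2}^\beta(0,t_1,0)=p_{\alpha_1,\alpha_2}^\beta(0,0,0)=1$ and $p_{\alpha_1,\alpha_2}^\beta(n,\cdot,\cdot)=0$ for $n<0$. Here $B$ is the backward shift, $Bp(n,t_1,t_2)=p(n-1,t_1,t_2)$, $(I-B)^\beta=\sum_{k=0}^\infty\frac{(\beta)_k}{k!}(-B)^k$, $(\beta)_k=\beta(\beta-1)\cdots(\beta-k+1)$, $(\beta)_0=1$, and the $t_i$-derivatives are Caputo derivatives: $\frac{\mathrm{d}^\alpha}{\mathrm{d}t^\alpha}g(t)=\frac{1}{\Gamma(1-\alpha)}\int_0^t\frac{g'(s)}{(t-s)^\alpha}\,\mathrm{d}s$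 for $0<\alpha<1$, and $g'(t)$ for $\alpha=1$. Space fractional Poisson random field (SFPRF) $N_\beta$ with parameter $\lambda>0$: a nonnegative-integer-valued random field on $\mathbb{R}^2_+$ whose state probabilities $p_\beta(n,t_1,t_2)=\mathrm{Pr}\{N_\beta(t_1,t_2)=n\}$ (regarded also as functions of $\lambda\in(0,\infty)$) solve $$\frac{\partial^2}{\partial t_2\partial t_1}p_\beta(n,t_1,t_2)=-\bigg(\frac{\lambda^{\beta+1}}{\beta}\frac{\partial}{\partial\lambda}+\lambda^\beta\bigg)(I-B)^\beta p_\beta(n,t_1,t_2),\quad n\ge0,$$ with $p_\beta(0,0,t_2)=p_\beta(0,t_1,0)=p_\beta(0,0,0)=1$ and $p_\beta(n,\cdot,\cdot)=0$ for $n<0$; it is the STFPRF with $\alpha_1=\alpha_2=1$. Two parameter stable subordinator of index $\beta\in(0,1)$: a process $\{H_\beta(t_1,t_2)\}$ vanishing a.s. on the axes, with stationary and independent increments over disjoint rectangles $(s_1,t_1]\times(s_2,t_2]$ (increment $X(t_1,t_2)-X(s_1,t_2)-X(t_1,s_2)+X(s_1,s_2)$), non-decreasing in the coordinatewise order, with $\mathbb{E}e^{-uH_\beta(t_1,t_2)}=e^{-t_1t_2u^\beta}$, $u>0$; for $\beta=1$, $H_1(t_1,t_2)=t_1t_2$. Folded solution: the density of $T_{2\alpha}(t)$ is $2u_{2\alpha}(x,t)$ for $x\ge0$ and $0$ for $x<0$ (for $\alpha=1$ this is the point mass at $x=t$, i.e. $T_2(t)=t$). The fractional time derivative is of Caputo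 type (for order $\nu=2\alpha\in(1,2)$: $\frac{1}{\Gamma(2-\nu)}\int_0^t\frac{g''(s)}{(t-s)^{\nu-1}}\,\mathrm{d}s$). It is known (Orsingher–Beghin) that $\int_0^\infty e^{-zt}\mathrm{Pr}\{T_{2\alpha}(t)\in\mathrm{d}x\}\,\mathrm{d}t=z^{\alpha-1}e^{-z^{\alpha}x}\,\mathrm{d}x$, $z>0$. *)

theory Defs
  imports "HOL-Probability.Probability"
begin

section \<open>Random processes, independence, equality in distribution\<close>

abbreviation R2plus :: "(real \<times> real) set" where
  "R2plus \<equiv> {0..} \<times> {0..}"

definition random_process :: "'a measure \<Rightarrow> 'i set \<Rightarrow> 'b measure \<Rightarrow> ('i \<Rightarrow> 'a \<Rightarrow> 'b) \<Rightarrow> bool" where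
  "random_process M I S X \<longleftrightarrow> (\<forall>i\<in>I. X i \<in> measurable M S)"

definition process_algebra :: "'a measure \<Rightarrow> 'i set \<Rightarrow> 'b measure \<Rightarrow> ('i \<Rightarrow> 'a \<Rightarrow> 'b) \<Rightarrow> 'a measure" where
  "process_algebra M I S X = sigma (space M) {X i -` A \<inter> space M | i A. i \<in> I \<and> A \<in> sets S}"

text \<open>
  Joint measurability in time and outcome, needed for the process to be evaluated at random times.
  The outcome space carries the \<open>\<sigma>\<close>-algebra of the process itself: with that of \<^term>\<open>M\<close>, a
  process independent of a random time \<^term>\<open>T\<close> with diffuse law could be altered at
  time \<^term>\<open>T\<close>, which changes none of its finite-dimensional laws.
\<close>
definition measurable_process ::
    "'a measure \<Rightarrow> 'i::topological_space set \<Rightarrow> 'b measure \<Rightarrow> ('i \<Rightarrow> 'a \<Rightarrow> 'b) \<Rightarrow> bool" where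
  "measurable_process M I S X \<longleftrightarrow>
     (\<lambda>(i, \<omega>). X i \<omega>) \<in> measurable (restrict_space borel I \<Otimes>\<^sub>M process_algebra M I S X) S"

definition independent_algebras :: "'a measure \<Rightarrow> 'a measure list \<Rightarrow> bool" where
  "independent_algebras M As \<longleftrightarrow>
     prob_space.indep_sets M (\<lambda>k. sets (As ! k)) {..<length As}"

definition eq_in_distribution ::
    "'b measure \<Rightarrow> 'a measure \<Rightarrow> ('a \<Rightarrow> 'b) \<Rightarrow> 'c measure \<Rightarrow> ('c \<Rightarrow> 'b) \<Rightarrow> bool" where
  "eq_in_distribution S M X M' Y \<longleftrightarrow>
     X \<in> measurable M S \<and> Y \<in> measurable M' S \<and> distr M S X = distr M' S Y"


section \<open>Caputo derivatives\<close>

text \<open>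
  \<open>has_caputo_deriv \<nu> g h\<close>: on \<open>(0, \<infinity>)\<close> the function \<open>g\<close> has the Caputo derivative \<open>h\<close> of order
  \<open>\<nu> > 0\<close>. Here \<open>G k\<close> is the \<open>k\<close>-th derivative of \<open>g\<close>, extended continuously to \<open>0\<close> for
  \<open>k < \<lceil>\<nu>\<rceil>\<close>; only the top one may be singular at \<open>0\<close>. For \<open>0 < \<nu> < 1\<close> the kernel is
  \<open>(t - s)\<^sup>-\<^sup>\<nu> / \<Gamma>(1 - \<nu>)\<close>, for \<open>1 < \<nu> < 2\<close> it is \<open>(t - s)\<^sup>1\<^sup>-\<^sup>\<nu> / \<Gamma>(2 - \<nu>)\<close>.
\<close>
definition has_caputo_deriv :: "real \<Rightarrow> (real \<Rightarrow> real) \<Rightarrow> (real \<Rightarrow> real) \<Rightarrow> bool" where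
  "has_caputo_deriv \<nu> g h \<longleftrightarrow>
     (let n = nat \<lceil>\<nu>\<rceil> in
      \<exists>G :: nat \<Rightarrow> real \<Rightarrow> real.
        G 0 = g \<and>
        (\<forall>k<n. continuous_on {0..} (G k) \<and>
               (\<forall>t>0. (G k has_real_derivative G (Suc k) t) (at t))) \<and>
        (\<forall>t>0.
          if \<nu> = real n then h t = G n t
          else set_integrable lborel {0<..<t} (\<lambda>s. G n s / (t - s) powr (\<nu> + 1 - real n)) \<and>
               h t = (LINT s:{0<..<t}|lborel. G n s / (t - s) powr (\<nu> + 1 - real n))
                       / Gamma (real n - \<nu>)))"


section \<open>Space-time fractional Poisson random fields\<close>

definition backward_shift :: "(int \<Rightarrow> real) \<Rightarrow> int \<Rightarrow> real" where
  "backward_shift f n = f (n - 1)"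

text \<open>\<open>(I - B)\<^sup>\<beta>\<close>, with \<open>(\<beta>)\<^sub>k / k!\<close> written as a generalised binomial coefficient.\<close>
definition fractional_difference :: "real \<Rightarrow> (int \<Rightarrow> real) \<Rightarrow> int \<Rightarrow> real" where
  "fractional_difference \<beta> f n =
     (\<Sum>k. (\<beta> gchoose k) * (-1) ^ k * (backward_shift ^^ k) f n)"

text \<open>
  A family of distributions \<open>p l (t\<^sub>1, t\<^sub>2)\<close>, indexed by the rate \<open>l\<close>, on the nonnegative integers, as a function
  on all integers.
\<close>
definition state_prob :: "(real \<Rightarrow> real \<times> real \<Rightarrow> nat pmf) \<Rightarrow> real \<Rightarrow> real \<times> real \<Rightarrow> int \<Rightarrow> real" where
  "state_prob p l t n = (if n < 0 then 0 else pmf (p l t) (nat n))"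

text \<open>
  Classical solutions of the governing equation: the state probabilities are continuously
  differentiable in the rate, jointly in rate and time, and the iterated Caputo derivative (first in
  \<open>t\<^sub>1\<close>, giving \<open>D\<close>, then in \<open>t\<^sub>2\<close>) exists. The equation is imposed for \<open>t\<^sub>1, t\<^sub>2 > 0\<close>.
\<close>
definition solves_STFPRF_equation ::
    "real \<Rightarrow> real \<Rightarrow> real \<Rightarrow> (real \<Rightarrow> real \<times> real \<Rightarrow> nat pmf) \<Rightarrow> bool" where
  "solves_STFPRF_equation \<alpha>1 \<alpha>2 \<beta> p \<longleftrightarrow>
     (\<forall>n\<ge>0.
        continuous_on ({0<..} \<times> R2plus) (\<lambda>(l, t). state_prob p l t n) \<and>
        (\<forall>l>0. \<forall>t\<in>R2plus. (\<lambda>m. state_prob p m t n) differentiable (at l)) \<and>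
        continuous_on ({0<..} \<times> R2plus) (\<lambda>(l, t). deriv (\<lambda>m. state_prob p m t n) l)) \<and>
     (\<forall>n\<ge>0. \<forall>l>0. \<exists>D :: real \<Rightarrow> real \<Rightarrow> real.
        (\<forall>t2\<ge>0. has_caputo_deriv \<alpha>1 (\<lambda>t1. state_prob p l (t1, t2) n) (\<lambda>t1. D t1 t2)) \<and>
        (\<forall>t1>0. has_caputo_deriv \<alpha>2 (\<lambda>t2. D t1 t2)
           (\<lambda>t2. - (l powr (\<beta> + 1) / \<beta> *
                      deriv (\<lambda>m. fractional_difference \<beta> (state_prob p m (t1, t2)) n) l
                    + l powr \<beta> * fractional_difference \<beta> (state_prob p l (t1, t2)) n)))) \<and>
     (\<forall>l>0. \<forall>s\<ge>0. state_prob p l (0, s) 0 = 1 \<and> state_prob p l (s, 0) 0 = 1)"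

text \<open>
  The equation involves a derivative in the rate, so a field with a fixed rate is one whose
  distribution is the member at that rate
  of a family solving it for all positive rates.
\<close>
definition STFPRF ::
    "real \<Rightarrow> real \<Rightarrow> real \<Rightarrow> real \<Rightarrow> 'a measure \<Rightarrow> (real \<times> real \<Rightarrow> 'a \<Rightarrow> nat) \<Rightarrow> bool" where
  "STFPRF \<alpha>1 \<alpha>2 \<beta> rate M N \<longleftrightarrow>
     random_process M R2plus (count_space UNIV) N \<and>
     (\<exists>p. solves_STFPRF_equation \<alpha>1 \<alpha>2 \<beta> p \<and>
          (\<forall>t\<in>R2plus. distr M (count_space UNIV) (N t) = measure_pmf (p rate t)))"

definition SFPRF :: "real \<Rightarrow> real \<Rightarrow> 'a measure \<Rightarrow> (real \<times> real \<Rightarrow> 'a \<Rightarrow> nat) \<Rightarrow> bool" where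
  "SFPRF \<beta> rate M N \<longleftrightarrow> STFPRF 1 1 \<beta> rate M N"


section \<open>Two parameter stable subordinators\<close>

definition rect_increment ::
    "(real \<times> real \<Rightarrow> 'a \<Rightarrow> real) \<Rightarrow> real \<times> real \<Rightarrow> real \<times> real \<Rightarrow> 'a \<Rightarrow> real" where
  "rect_increment X s t \<omega> =
     X (fst t, snd t) \<omega> - X (fst s, snd t) \<omega> - X (fst t, snd s) \<omega> + X (fst s, snd s) \<omega>"

abbreviation coord_le :: "real \<times> real \<Rightarrow> real \<times> real \<Rightarrow> bool" where
  "coord_le s t \<equiv> fst s \<le> fst t \<and> snd s \<le> snd t"

definition stable_subordinator2 :: "real \<Rightarrow> 'a measure \<Rightarrow> (real \<times> real \<Rightarrow> 'a \<Rightarrow> real) \<Rightarrow> bool" where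
  "stable_subordinator2 \<beta> M H \<longleftrightarrow>
     random_process M R2plus borel H \<and>
     (\<forall>t\<in>R2plus. \<forall>\<omega>\<in>space M. 0 \<le> H t \<omega>) \<and>
     (if \<beta> = 1 then (\<forall>t\<in>R2plus. AE \<omega> in M. H t \<omega> = fst t * snd t)
      else
        (\<forall>s\<ge>0. AE \<omega> in M. H (0, s) \<omega> = 0 \<and> H (s, 0) \<omega> = 0) \<and>
        (\<forall>s\<in>R2plus. \<forall>t\<in>R2plus. \<forall>h\<in>R2plus. coord_le s t \<longrightarrow>
           distr M borel (rect_increment H (s + h) (t + h)) = distr M borel (rect_increment H s t)) \<and>
        (\<forall>(J :: nat set) a b. finite J \<longrightarrow>
           (\<forall>j\<in>J. a j \<in> R2plus \<and> b j \<in> R2plus \<and> coord_le (a j) (b j)) \<longrightarrow>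
           disjoint_family_on (\<lambda>j. {fst (a j)<..fst (b j)} \<times> {snd (a j)<..snd (b j)}) J \<longrightarrow>
           prob_space.indep_vars M (\<lambda>_. borel) (\<lambda>j. rect_increment H (a j) (b j)) J) \<and>
        (AE \<omega> in M. \<forall>s\<in>R2plus. \<forall>t\<in>R2plus. coord_le s t \<longrightarrow> H s \<omega> \<le> H t \<omega>) \<and>
        (\<forall>t\<in>R2plus. \<forall>u>0.
           (LINT \<omega>|M. exp (- u * H t \<omega>)) = exp (- fst t * snd t * u powr \<beta>)))"


section \<open>Poisson processes\<close>

definition poisson_process :: "real \<Rightarrow> 'a measure \<Rightarrow> (real \<Rightarrow> 'a \<Rightarrow> nat) \<Rightarrow> bool" where
  "poisson_process rate M N \<longleftrightarrow>
     random_process M {0..} (count_space UNIV) N \<and>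
     (AE \<omega> in M. N 0 \<omega> = 0) \<and>
     (AE \<omega> in M. mono_on {0..} (\<lambda>t. N t \<omega>) \<and>
                 (\<forall>t\<ge>0. continuous (at_right t) (\<lambda>s. N s \<omega>))) \<and>
     (\<forall>s t. 0 \<le> s \<and> s < t \<longrightarrow>
        distr M (count_space UNIV) (\<lambda>\<omega>. N t \<omega> - N s \<omega>) = measure_pmf (poisson_pmf (rate * (t - s)))) \<and>
     (\<forall>(n :: nat) t. 0 \<le> t 0 \<longrightarrow> (\<forall>i<n. t i \<le> t (Suc i)) \<longrightarrow>
        prob_space.indep_vars M (\<lambda>_. count_space UNIV) (\<lambda>i \<omega>. N (t (Suc i)) \<omega> - N (t i) \<omega>) {..<n})"


section \<open>Folded solutions of the fractional diffusion equation\<close>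

definition test_function :: "(real \<Rightarrow> real) \<Rightarrow> bool" where
  "test_function \<phi> \<longleftrightarrow>
     (\<forall>k x. (deriv ^^ k) \<phi> differentiable (at x)) \<and> (\<exists>R. \<forall>x. \<bar>x\<bar> > R \<longrightarrow> \<phi> x = 0)"

text \<open>The pairing of \<open>u(\<cdot>, t)\<close> with \<open>\<phi>\<close>, where \<open>u(\<cdot>, 0)\<close> is the Dirac mass at the origin.\<close>
definition pairing :: "(real \<Rightarrow> real \<Rightarrow> real) \<Rightarrow> (real \<Rightarrow> real) \<Rightarrow> real \<Rightarrow> real" where
  "pairing u \<phi> t = (if t = 0 then \<phi> 0 else (LINT x|lborel. u x t * \<phi> x))"

text \<open>
  The equation \<open>\<partial>\<^sub>t\<^sup>2\<^sup>\<alpha> u = \<partial>\<^sub>x\<^sup>2 u\<close> with \<open>u(\<cdot>, 0) = \<delta>\<close>, in the sense of distributions in \<open>x\<close>: the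
  fundamental solution has a kink at \<open>x = 0\<close> unless \<open>2\<alpha> = 1\<close>, so that a pointwise reading at
  \<open>x = 0\<close> has no solution. The initial condition enters through the continuity at time \<open>0\<close>
  contained in \<^const>\<open>has_caputo_deriv\<close>.
\<close>
definition solves_fractional_cauchy :: "real \<Rightarrow> (real \<Rightarrow> real \<Rightarrow> real) \<Rightarrow> bool" where
  "solves_fractional_cauchy \<alpha> u \<longleftrightarrow>
     (\<forall>t>0. (\<lambda>x. u x t) \<in> borel_measurable borel \<and>
            (\<forall>R. set_integrable lborel {-R..R} (\<lambda>x. u x t))) \<and>
     (\<forall>\<phi>. test_function \<phi> \<longrightarrow>
        has_caputo_deriv (2 * \<alpha>) (pairing u \<phi>) (\<lambda>t. LINT x|lborel. u x t * (deriv ^^ 2) \<phi> x) \<and>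
        (\<alpha> > 1/2 \<longrightarrow> (pairing u \<phi> has_real_derivative 0) (at 0 within {0..})))"

text \<open>
  For \<open>\<alpha> = 1\<close> the fundamental solution of the wave equation is \<open>(\<delta>\<^sub>t + \<delta>\<^sub>-\<^sub>t) / 2\<close>, whose folding is
  the point mass at \<open>t\<close>; at \<open>t = 0\<close> the folded initial condition is the point mass at \<open>0\<close>.
\<close>
definition folded_process :: "real \<Rightarrow> 'a measure \<Rightarrow> (real \<Rightarrow> 'a \<Rightarrow> real) \<Rightarrow> bool" where
  "folded_process \<alpha> M T \<longleftrightarrow>
     random_process M {0..} borel T \<and>
     (\<forall>t\<ge>0. \<forall>\<omega>\<in>space M. 0 \<le> T t \<omega>) \<and>
     (if \<alpha> = 1 then (\<forall>t\<ge>0. AE \<omega> in M. T t \<omega> = t)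
      else
        (AE \<omega> in M. T 0 \<omega> = 0) \<and>
        (\<exists>u. solves_fractional_cauchy \<alpha> u \<and>
             (\<forall>t>0. (\<forall>x\<ge>0. 0 \<le> u x t) \<and>
                    distributed M lborel (T t) (\<lambda>x. ennreal (if 0 \<le> x then 2 * u x t else 0)))))"

end

theory Submission
  imports Defs "HOL-Real_Asymp.Real_Asymp"
begin

text \<open>
  Put \<open>c = \<lambda>\<^sup>\<beta> (1 - u)\<^sup>\<beta>\<close> for \<open>0 \<le> u < 1\<close>. All three random variables have the generating function
  \<open>E exp (- c T\<^sub>1 T\<^sub>2)\<close>, where \<open>T\<^sub>i\<close> is the value of the \<open>i\<close>-th folded process at time \<open>t\<^sub>i\<close>. For the
  subordinated Poisson process this follows by conditioning, first on \<open>H\<^sub>\<beta>\<close> and then on the \<open>T\<^sub>i\<close>.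

  For the fractional fields, dividing the governing equation by \<open>\<lambda>\<close> makes its right-hand side a
  derivative \<open>\<partial>/\<partial>\<lambda> (\<lambda>\<^sup>\<beta> (I - B)\<^sup>\<beta> p)\<close>. Inverting the Caputo derivatives, integrating over \<open>\<lambda>\<close> and only
  then taking Laplace transforms in both times keeps every transformed function bounded; the
  generating function in \<open>n\<close> turns \<open>(I - B)\<^sup>\<beta>\<close> into the factor \<open>(1 - u)\<^sup>\<beta>\<close>. What remains is a linear
  first-order equation in \<open>\<lambda>\<close>. Its homogeneous solutions blow up as \<open>\<lambda> \<longlongrightarrow> 0\<close>, so the bounded solution
  is unique, and it is explicit. For \<open>\<alpha>\<^sub>1 = \<alpha>\<^sub>2 = 1\<close> it is the transform of \<open>exp (- c t\<^sub>1 t\<^sub>2)\<close>; in general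
  it is that of \<open>E exp (- c T\<^sub>1 T\<^sub>2)\<close>, because \<open>\<integral> e\<^sup>-\<^sup>z\<^sup>t E f(T\<^sub>2\<^sub>\<alpha>(t)) dt = z\<^sup>\<alpha>\<^sup>-\<^sup>1 \<integral> e\<^sup>-\<^sup>a\<^sup>x f(x) dx\<close> with
  \<open>a = z\<^sup>\<alpha>\<close>.

  The last formula is derived from the Cauchy problem alone. Nothing controls the solution on the
  negative half-line, but its total mass on the positive one is constant, and this replaces the
  missing boundary condition at the origin.
\<close>

section \<open>Riemann-Liouville integrals, Laplace transforms and Caputo derivatives\<close>

text \<open>The equation gives no control over the rate derivatives for large times or small rates,
  so its right-hand side need not have a Laplace transform. Integrated over a rate interval it
  becomes an increment of l^\<beta> (I - B)^\<beta> p, for fixed n a finite combination of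
  probabilities; hence each n is transformed separately and the sum over n is taken last. Apart from
  a factor 1 / (z1 z2), the transformed solution depends on the rate, u and the z_i only through tau
  = c / (z1^\<alpha>1 z2^\<alpha>2): it is \<open>stieltjes\<close> at tau, the integral of e^-v /
  (1 + tau v). Going from orders 1, 1 to \<alpha>1, \<alpha>2 thus replaces z_i by z_i^\<alpha>i
  inside tau, which is what the two random times do. For the law of these times, test functions
  supported in (0, infinity) see only the folded density and give 0 against the Dirac initial value.
  Their limits with bounded second derivatives vanish to second order at 0. Two exponentials and a
  constant can be combined into such a limit, and the known expectation of the constant closes the
  equation.\<close>

definition rl_kernel :: "real \<Rightarrow> real \<Rightarrow> real" where
  "rl_kernel \<nu> t = (if 0 < t then t powr (\<nu> - 1) / Gamma \<nu> else 0)"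

text \<open>A convolution on the whole line: \<open>rl_kernel\<close> vanishes for arguments up to 0
  and the indicator removes negative times, so translations and Fubini apply without tracking the
  interval (0, t).\<close>

definition rl_integral :: "real \<Rightarrow> (real \<Rightarrow> real) \<Rightarrow> real \<Rightarrow> real" where
  "rl_integral \<nu> f t = (\<integral>s. rl_kernel \<nu> (t - s) * (indicator {0<..} s * f s) \<partial>lborel)"

definition laplace :: "real \<Rightarrow> (real \<Rightarrow> real) \<Rightarrow> real" where
  "laplace z f = (\<integral>t. indicator {0<..} t * exp (- z * t) * f t \<partial>lborel)"

lemma rl_kernel_measurable [measurable]: "rl_kernel \<nu> \<in> borel_measurable borel"
  unfolding rl_kernel_def by measurable

lemma rl_kernel_nonneg: "0 < \<nu> \<Longrightarrow> 0 \<le> rl_kernel \<nu> t"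
  unfolding rl_kernel_def by (auto intro!: divide_nonneg_pos Gamma_real_pos)

text \<open>The Gamma and Beta integrals come as Henstock-Kurzweil integrals; for a nonnegative
  integrand the value is also that of the Lebesgue integral.\<close>

lemma has_bochner_integral_nonneg_HK:
  fixes f :: "real \<Rightarrow> real"
  assumes [measurable]: "f \<in> borel_measurable borel" and nn: "\<And>x. x \<in> S \<Longrightarrow> 0 \<le> f x"
    and S: "S \<in> sets borel" and I: "(f has_integral I) S"
  shows "has_bochner_integral lborel (\<lambda>x. indicator S x * f x) I"
proof (rule has_bochner_integral_nn_integral)
  have "((\<lambda>x. indicator S x * f x) has_integral I) UNIV"
    using I has_integral_restrict_UNIV [of S f I] by (rule_tac has_integral_eq_rhs) (simp_all add: indicator_def of_bool_def if_distrib if_distribR cong: if_cong)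
  then show "(\<integral>\<^sup>+x. ennreal (indicator S x * f x) \<partial>lborel) = ennreal I"
    using S nn by (intro nn_integral_has_integral_lborel) (auto simp: indicator_def)
  show "0 \<le> I" using I nn by (rule has_integral_nonneg)
  show "(\<lambda>x. indicator S x * f x) \<in> borel_measurable lborel" using S by measurable
  show "AE x in lborel. 0 \<le> indicator S x * f x" using nn by (auto simp: indicator_def)
qed

section \<open>The fractional integration kernel and its convolutions\<close>

lemma rl_kernel_laplace:
  assumes "0 < \<nu>" "0 < z"
  shows "has_bochner_integral lborel (\<lambda>t. exp (- z * t) * rl_kernel \<nu> t) (z powr (- \<nu>))"
proof -
  let ?f = "\<lambda>t::real. t powr (\<nu> - 1) / exp t"
  have "has_bochner_integral lborel (\<lambda>t. indicator {0..} t * ?f t) (Gamma \<nu>)"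
    by (intro has_bochner_integral_nonneg_HK Gamma_integral_real assms) auto
  then have i: "integrable lborel (\<lambda>t. indicator {0..} t * ?f t)"
    and e: "(\<integral>t. indicator {0..} t * ?f t \<partial>lborel) = Gamma \<nu>"
    by (auto simp: has_bochner_integral_iff)
  let ?g = "\<lambda>t. indicator {0..} (0 + z * t) * ?f (0 + z * t)"
  have "integrable lborel ?g"
    using lborel_integrable_real_affine [OF i, of z 0] assms by simp
  moreover have "z * (\<integral>t. ?g t \<partial>lborel) = Gamma \<nu>"
    using lborel_integral_real_affine [of z "\<lambda>t. indicator {0..} t * ?f t" 0] assms e by simp
  ultimately have 1: "has_bochner_integral lborel ?g (Gamma \<nu> / z)"
    using assms by (auto simp: has_bochner_integral_iff field_simps)
  have 2: "exp (- z * t) * rl_kernel \<nu> t = (z powr (1 - \<nu>) / Gamma \<nu>) * ?g t" for t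
  proof (cases "0 < t")
    case True
    have "z powr (1 - \<nu>) * z powr (\<nu> - 1) = 1" using assms by (simp flip: powr_add)
    then show ?thesis
      using True assms by (simp add: rl_kernel_def powr_mult exp_minus field_simps)
  next
    case False
    then show ?thesis using assms
      by (cases "t = 0") (auto simp: rl_kernel_def zero_le_mult_iff indicator_def)
  qed
  have "Gamma \<nu> \<noteq> 0" using Gamma_real_pos [OF assms(1)] by linarith
  then have 3: "z powr (1 - \<nu>) / Gamma \<nu> * (Gamma \<nu> / z) = z powr (- \<nu>)"
    using assms by (simp add: powr_diff powr_minus field_simps)
  show ?thesis
    unfolding 2 using has_bochner_integral_mult_right [OF 1, of "z powr (1 - \<nu>) / Gamma \<nu>"] 3
    by simp
qed

text \<open>The semigroup law of the kernels under convolution: the substitution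
  \<open>x = (s - r) / (t - r)\<close> turns the product into a multiple of the integrand of
  \<open>Beta b a\<close>.\<close>

lemma rl_kernel_beta:
  assumes "0 < a" "0 < b" "r < t"
  shows "has_bochner_integral lborel (\<lambda>s. rl_kernel a (t - s) * rl_kernel b (s - r))
           (rl_kernel (a + b) (t - r))"
proof -
  let ?f = "\<lambda>x::real. x powr (b - 1) * (1 - x) powr (a - 1)"
  let ?F = "\<lambda>x. indicator {0..1} x * ?f x"
  let ?d = "t - r"
  have d: "0 < ?d" using assms by simp
  have "has_bochner_integral lborel ?F (Beta b a)"
    by (intro has_bochner_integral_nonneg_HK has_integral_Beta_real assms) auto
  then have i: "integrable lborel ?F" and e: "(\<integral>t. ?F t \<partial>lborel) = Beta b a"
    by (auto simp: has_bochner_integral_iff)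
  let ?g = "\<lambda>s. ?F (- r / ?d + (1 / ?d) * s)"
  have "integrable lborel ?g"
    using lborel_integrable_real_affine [OF i, of "1 / ?d" "- r / ?d"] d by simp
  moreover have "Beta b a = 1 / ?d * (\<integral>t. ?g t \<partial>lborel)"
    using lborel_integral_real_affine [of "1 / ?d" ?F "- r / ?d"] d e by simp
  then have "(\<integral>t. ?g t \<partial>lborel) = Beta b a * ?d" using d by simp
  ultimately have 1: "has_bochner_integral lborel ?g (Beta b a * ?d)"
    unfolding has_bochner_integral_iff by blast
  let ?c = "?d powr (a + b - 2) / (Gamma a * Gamma b)"
  have 2: "rl_kernel a (t - s) * rl_kernel b (s - r) = ?c * ?g s" if "s \<noteq> r" "s \<noteq> t" for s
  proof (cases "r < s \<and> s < t")
    case True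
    have eq: "- r / ?d + (1 / ?d) * s = (s - r) / ?d" by (simp add: diff_divide_distrib)
    have eq': "1 - (s - r) / ?d = (t - s) / ?d" using d by (simp add: divide_simps)
    have "?d powr (a + b - 2) = ?d powr (a - 1) * ?d powr (b - 1)"
      by (simp flip: powr_add)
    moreover have "(s - r) / ?d \<in> {0..1}" using True d by (auto simp: field_simps)
    ultimately show ?thesis
      using True d unfolding eq eq'
      by (simp add: rl_kernel_def powr_divide)
  next
    case False
    then have "s < r \<or> t < s" using that by auto
    then have "(s - r) / ?d \<notin> {0..1}" using d by (auto simp: field_simps)
    moreover have eq: "- r / ?d + (1 / ?d) * s = (s - r) / ?d" by (simp add: diff_divide_distrib)
    ultimately show ?thesis
      using False unfolding eq by (auto simp: rl_kernel_def)
  qed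
  have 3: "?c * (Beta b a * ?d) = rl_kernel (a + b) ?d"
  proof -
    have "?d powr (a + b - 2) * ?d = ?d powr (a + b - 1)"
      using d powr_add[of ?d "a + b - 2" 1] by simp
    moreover have "Gamma a \<noteq> 0" "Gamma b \<noteq> 0"
      using Gamma_real_pos [OF assms(1)] Gamma_real_pos [OF assms(2)] by linarith+
    moreover have "?c * (Beta b a * ?d)
        = (?d powr (a + b - 2) * ?d) * (Gamma a * Gamma b / (Gamma a * Gamma b)) / Gamma (a + b)"
      by (simp add: Beta_def add.commute mult.commute mult.left_commute)
    ultimately show ?thesis using d by (simp add: rl_kernel_def)
  qed
  have 4: "has_bochner_integral lborel (\<lambda>s. ?c * ?g s) (rl_kernel (a + b) ?d)"
    using has_bochner_integral_mult_right [OF 1, of ?c] 3 by simp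
  have ae: "AE s in lborel. ?c * ?g s = rl_kernel a (t - s) * rl_kernel b (s - r)"
    using AE_lborel_singleton [of r] AE_lborel_singleton [of t] by eventually_elim (metis 2)
  have m: "(\<lambda>s. rl_kernel a (t - s) * rl_kernel b (s - r)) \<in> borel_measurable lborel"
    by measurable
  show ?thesis
    by (rule iffD1 [OF has_bochner_integral_cong_AE [OF _ m ae] 4])
       (rule borel_measurable_integrable, rule integrable.intros, rule 4)
qed

lemma rl_kernel_one: "rl_kernel 1 t = (if 0 < t then 1 else 0)"
  by (simp add: rl_kernel_def)

lemma rl_kernel_integral:
  assumes "0 < \<nu>" "0 < t"
  shows "has_bochner_integral lborel (\<lambda>s. rl_kernel \<nu> (t - s) * indicator {0<..} s)
           (t powr \<nu> / Gamma (\<nu> + 1))"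
proof -
  have "rl_kernel 1 (s - 0) = indicator {0<..} s" for s
    by (simp add: rl_kernel_one indicator_def)
  then show ?thesis
    using rl_kernel_beta [of \<nu> 1 0 t] assms by (simp add: rl_kernel_def)
qed

lemma rl_integrable_bounded:
  assumes "0 < \<nu>" "0 < t" and [measurable]: "f \<in> borel_measurable borel"
    and B: "\<And>s. 0 < s \<Longrightarrow> s < t \<Longrightarrow> \<bar>f s\<bar> \<le> B"
  shows "integrable lborel (\<lambda>s. rl_kernel \<nu> (t - s) * (indicator {0<..} s * f s))"
    and "\<bar>rl_integral \<nu> f t\<bar> \<le> B * (t powr \<nu> / Gamma (\<nu> + 1))"
proof -
  let ?k = "\<lambda>s. rl_kernel \<nu> (t - s) * indicator {0<..} s"
  have i: "integrable lborel ?k" and e: "(\<integral>s. ?k s \<partial>lborel) = t powr \<nu> / Gamma (\<nu> + 1)"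
    using rl_kernel_integral [OF assms(1,2)] by (auto simp: has_bochner_integral_iff)
  have b: "norm (rl_kernel \<nu> (t - s) * (indicator {0<..} s * f s)) \<le> B * ?k s" for s
  proof (cases "0 < s \<and> s < t")
    case True
    then show ?thesis
      using mult_left_mono [OF B rl_kernel_nonneg [OF assms(1)], of s "t - s"]
        rl_kernel_nonneg [OF assms(1), of "t - s"]
      by (simp add: abs_mult mult.commute)
  qed (auto simp: rl_kernel_def indicator_def)
  show 1: "integrable lborel (\<lambda>s. rl_kernel \<nu> (t - s) * (indicator {0<..} s * f s))"
  proof (rule Bochner_Integration.integrable_bound [OF integrable_mult_right [OF i, of B]])
    show "AE s in lborel. norm (rl_kernel \<nu> (t - s) * (indicator {0<..} s * f s)) \<le> norm (B * ?k s)"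
      unfolding real_norm_def [of "B * _"] by (intro AE_I2 order_trans [OF b abs_ge_self])
  qed measurable
  have "norm (rl_integral \<nu> f t) \<le> (\<integral>s. B * ?k s \<partial>lborel)"
    unfolding rl_integral_def using b
    by (intro Bochner_Integration.integral_norm_bound_integral 1 integrable_mult_right [OF i]) auto
  then show "\<bar>rl_integral \<nu> f t\<bar> \<le> B * (t powr \<nu> / Gamma (\<nu> + 1))" using e by simp
qed

text \<open>Translation invariance makes the integral of \<open>\<bar>K (t - s)\<bar>\<close> over
  \<open>t\<close> independent of \<open>s\<close>, which yields the absolute integrability behind
  Fubini.\<close>

lemma integral_convolution:
  fixes K F :: "real \<Rightarrow> real"
  assumes K: "integrable lborel K" and F: "integrable lborel F"
  shows "integrable lborel (\<lambda>t. \<integral>s. K (t - s) * F s \<partial>lborel)"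
    and "(\<integral>t. (\<integral>s. K (t - s) * F s \<partial>lborel) \<partial>lborel) = (\<integral>t. K t \<partial>lborel) * (\<integral>t. F t \<partial>lborel)"
proof -
  have [measurable]: "K \<in> borel_measurable borel" "F \<in> borel_measurable borel"
    using K F by auto
  have tr: "integrable lborel (\<lambda>t. K (t - s))" "(\<integral>t. K (t - s) \<partial>lborel) = (\<integral>t. K t \<partial>lborel)" for s
    using lborel_integrable_real_affine [OF K, of 1 "-s"] lborel_integral_real_affine [of 1 K "-s"]
    by (auto simp: add.commute)
  have tr': "(\<integral>t. \<bar>K (t - s)\<bar> \<partial>lborel) = (\<integral>t. \<bar>K t\<bar> \<partial>lborel)" for s
    using lborel_integral_real_affine [of 1 "\<lambda>t. \<bar>K t\<bar>" "-s"] by (auto simp: add.commute)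
  have I: "integrable (lborel \<Otimes>\<^sub>M lborel) (\<lambda>(s, t). K (t - s) * F s)"
  proof (rule lborel_pair.Fubini_integrable)
    show "integrable lborel (\<lambda>s. \<integral>t. norm (case (s, t) of (s, t) \<Rightarrow> K (t - s) * F s) \<partial>lborel)"
      using F by (simp add: abs_mult tr')
    show "AE s in lborel. integrable lborel (\<lambda>t. case (s, t) of (s, t) \<Rightarrow> K (t - s) * F s)"
      using tr(1) by simp
  qed measurable
  from lborel_pair.integrable_snd [OF I]
  show "integrable lborel (\<lambda>t. \<integral>s. K (t - s) * F s \<partial>lborel)" by simp
  from lborel_pair.Fubini_integral [OF I]
  show "(\<integral>t. (\<integral>s. K (t - s) * F s \<partial>lborel) \<partial>lborel) = (\<integral>t. K t \<partial>lborel) * (\<integral>t. F t \<partial>lborel)"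
    by (simp add: tr)
qed

text \<open>The weight \<open>exp (- z * t)\<close> splits into \<open>exp (- z * (t - s))\<close>
  and \<open>exp (- z * s)\<close>, so the weighted fractional integral is a convolution of two
  integrable functions.\<close>

lemma laplace_rl_integral:
  assumes "0 < \<nu>" "0 < z" and F: "integrable lborel (\<lambda>t. indicator {0<..} t * exp (- z * t) * f t)"
  shows "integrable lborel (\<lambda>t. indicator {0<..} t * exp (- z * t) * rl_integral \<nu> f t)"
    and "laplace z (rl_integral \<nu> f) = z powr (- \<nu>) * laplace z f"
proof -
  let ?K = "\<lambda>t. exp (- z * t) * rl_kernel \<nu> t"
  let ?F = "\<lambda>t. indicator {0<..} t * exp (- z * t) * f t"
  have K: "integrable lborel ?K" "(\<integral>t. ?K t \<partial>lborel) = z powr (- \<nu>)"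
    using rl_kernel_laplace [OF assms(1,2)] by (auto simp: has_bochner_integral_iff)
  have eq: "(\<integral>s. ?K (t - s) * ?F s \<partial>lborel) = indicator {0<..} t * exp (- z * t) * rl_integral \<nu> f t" for t
  proof (cases "0 < t")
    case True
    have "(\<integral>s. ?K (t - s) * ?F s \<partial>lborel)
        = (\<integral>s. exp (- z * t) * (rl_kernel \<nu> (t - s) * (indicator {0<..} s * f s)) \<partial>lborel)"
      by (intro Bochner_Integration.integral_cong) (auto simp: algebra_simps exp_diff exp_minus field_simps)
    then show ?thesis using True by (simp add: rl_integral_def)
  next
    case False
    then have z: "?K (t - s) * ?F s = 0" for s by (auto simp: rl_kernel_def indicator_def)
    show ?thesis unfolding z using False by simp
  qed
  from integral_convolution [OF K(1) F]
  show "integrable lborel (\<lambda>t. indicator {0<..} t * exp (- z * t) * rl_integral \<nu> f t)"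
    and "laplace z (rl_integral \<nu> f) = z powr (- \<nu>) * laplace z f"
    unfolding eq K laplace_def by auto
qed

lemma rl_integral_one:
  "rl_integral 1 f t = (LINT s:{0<..<t}|lborel. f s)"
  unfolding rl_integral_def set_lebesgue_integral_def
  by (intro Bochner_Integration.integral_cong) (auto simp: rl_kernel_one indicator_def)

text \<open>For \<open>r < t\<close> the integral over \<open>s\<close> of the two kernels is
  \<open>rl_kernel 1\<close>, that is 1; the same value with \<open>\<bar>f\<bar>\<close> in place
  of \<open>f\<close> justifies Fubini. With orders \<nu> and 1 - \<nu> this undoes the fractional
  integral of \<open>g'\<close> that defines a Caputo derivative.\<close>

lemma rl_integral_compose:
  assumes "0 < a" "0 < b" "a + b = 1" "0 < t" and f: "set_integrable lborel {0<..<t} f"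
  shows "rl_integral a (rl_integral b f) t = (LINT s:{0<..<t}|lborel. f s)"
proof -
  let ?f = "\<lambda>r. indicator {0<..<t} r * f r"
  have fi: "integrable lborel ?f" using f by (simp add: set_integrable_def)
  then have [measurable]: "?f \<in> borel_measurable borel" by simp
  have B: "has_bochner_integral lborel (\<lambda>s. rl_kernel a (t - s) * rl_kernel b (s - r)) 1"
    if "r < t" for r
    using rl_kernel_beta [OF assms(1,2) that] that assms(3) by (simp add: rl_kernel_one)
  have Bi: "integrable lborel (\<lambda>s. (rl_kernel a (t - s) * rl_kernel b (s - r)) * ?f r)" for r
    using B [of r] by (cases "r < t") (auto simp: has_bochner_integral_iff)
  have Be: "(\<integral>s. (rl_kernel a (t - s) * rl_kernel b (s - r)) * ?f r \<partial>lborel) = ?f r" for r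
    using B [of r] by (cases "r < t") (auto simp: has_bochner_integral_iff)
  have Bn: "(\<integral>s. norm (rl_kernel a (t - s) * rl_kernel b (s - r) * ?f r) \<partial>lborel) = \<bar>?f r\<bar>" for r
  proof -
    have "(\<integral>s. norm (rl_kernel a (t - s) * rl_kernel b (s - r) * ?f r) \<partial>lborel)
      = (\<integral>s. (rl_kernel a (t - s) * rl_kernel b (s - r)) * \<bar>?f r\<bar> \<partial>lborel)"
      by (intro Bochner_Integration.integral_cong)
         (auto simp: abs_mult rl_kernel_nonneg assms)
    also have "\<dots> = \<bar>?f r\<bar>"
      using B [of r] by (cases "r < t") (auto simp: has_bochner_integral_iff)
    finally show ?thesis .
  qed
  have I: "integrable (lborel \<Otimes>\<^sub>M lborel)
      (\<lambda>(r, s). (rl_kernel a (t - s) * rl_kernel b (s - r)) * ?f r)"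
  proof (rule lborel_pair.Fubini_integrable)
    show "integrable lborel (\<lambda>r. \<integral>s. norm (case (r, s) of (r, s) \<Rightarrow>
        rl_kernel a (t - s) * rl_kernel b (s - r) * ?f r) \<partial>lborel)"
      unfolding split_conv Bn using fi by (rule integrable_abs)
    show "AE r in lborel. integrable lborel (\<lambda>s. case (r, s) of (r, s) \<Rightarrow>
        rl_kernel a (t - s) * rl_kernel b (s - r) * ?f r)"
      unfolding split_conv using Bi by (rule AE_I2)
  qed measurable
  have "rl_integral a (rl_integral b f) t
      = (\<integral>s. (\<integral>r. (rl_kernel a (t - s) * rl_kernel b (s - r)) * ?f r \<partial>lborel) \<partial>lborel)"
    unfolding rl_integral_def
  proof (intro Bochner_Integration.integral_cong refl)
    fix s
    have "rl_kernel a (t - s) * (indicator {0<..} s *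
            (\<integral>r. rl_kernel b (s - r) * (indicator {0<..} r * f r) \<partial>lborel))
        = (\<integral>r. (rl_kernel a (t - s) * indicator {0<..} s) *
             (rl_kernel b (s - r) * (indicator {0<..} r * f r)) \<partial>lborel)"
      by simp
    also have "\<dots> = (\<integral>r. (rl_kernel a (t - s) * rl_kernel b (s - r)) * ?f r \<partial>lborel)"
      by (intro Bochner_Integration.integral_cong) (auto simp: rl_kernel_def indicator_def)
    finally show "rl_kernel a (t - s) * (indicator {0<..} s *
            (\<integral>r. rl_kernel b (s - r) * (indicator {0<..} r * f r) \<partial>lborel)) = \<dots>" .
  qed
  also have "\<dots> = (\<integral>r. (\<integral>s. (rl_kernel a (t - s) * rl_kernel b (s - r)) * ?f r \<partial>lborel) \<partial>lborel)"
    using lborel_pair.Fubini_integral [OF I] by simp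
  also have "\<dots> = (LINT s:{0<..<t}|lborel. f s)"
    by (simp only: Be) (simp add: set_lebesgue_integral_def)
  finally show ?thesis .
qed

section \<open>Inversion of Caputo derivatives\<close>

lemma set_integral_derivative:
  fixes g g' :: "real \<Rightarrow> real"
  assumes "0 < t" and c: "continuous_on {0..} g" and d: "\<And>s. 0 < s \<Longrightarrow> (g has_real_derivative g' s) (at s)"
    and i: "set_integrable lborel {0<..<t} g'"
  shows "g t = g 0 + (LINT s:{0<..<t}|lborel. g' s)"
proof -
  have "(g' has_integral (g t - g 0)) {0..t}"
    using assms by (intro fundamental_theorem_of_calculus_interior)
      (auto intro: continuous_on_subset simp: has_real_derivative_iff_has_vector_derivative)
  then have "(g' has_integral (g t - g 0)) {0<..<t}"
    by (simp add: has_integral_Icc_iff_Ioo)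
  moreover have "(g' has_integral (LINT s:{0<..<t}|lborel. g' s)) {0<..<t}"
    using set_borel_integral_eq_integral [OF i] by (simp add: integrable_integral)
  ultimately have "g t - g 0 = (LINT s:{0<..<t}|lborel. g' s)" by (rule has_integral_unique)
  then show ?thesis by simp
qed

text \<open>
  The case \<open>0 < \<nu> \<le> 1\<close> of \<^const>\<open>has_caputo_deriv\<close> with the derivative \<open>g'\<close> made explicit; for
  \<open>1 < \<nu> < 2\<close> the same relation of order \<open>\<nu> - 1\<close> holds between \<open>g'\<close> and \<open>h\<close>.
\<close>
definition caputo_primitive :: "real \<Rightarrow> (real \<Rightarrow> real) \<Rightarrow> (real \<Rightarrow> real) \<Rightarrow> (real \<Rightarrow> real) \<Rightarrow> bool" where
  "caputo_primitive \<nu> g g' h \<longleftrightarrow>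
    continuous_on {0..} g \<and> (\<forall>t>0. (g has_real_derivative g' t) (at t)) \<and>
    (\<forall>t>0. if \<nu> = 1 then h t = g' t
      else set_integrable lborel {0<..<t} (\<lambda>s. g' s / (t - s) powr \<nu>) \<and>
        h t = (LINT s:{0<..<t}|lborel. g' s / (t - s) powr \<nu>) / Gamma (1 - \<nu>))"

lemma caputo_primitive_inversion:
  assumes "0 < \<nu>" "\<nu> \<le> 1" and P: "caputo_primitive \<nu> g g' h" and "0 < t"
    and h: "set_integrable lborel {0<..<t} h"
  shows "g t = g 0 + rl_integral \<nu> h t"
proof (cases "\<nu> = 1")
  case True
  have "h s = g' s" if "0 < s" for s using P True that by (simp add: caputo_primitive_def)
  then have eq: "indicator {0<..<t} s *\<^sub>R g' s = indicator {0<..<t} s *\<^sub>R h s" for s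
    by (simp add: indicator_def)
  have "set_integrable lborel {0<..<t} g' \<longleftrightarrow> set_integrable lborel {0<..<t} h"
    "(LINT s:{0<..<t}|lborel. g' s) = (LINT s:{0<..<t}|lborel. h s)"
    by (simp_all only: set_integrable_def set_lebesgue_integral_def eq)
  moreover from P have "continuous_on {0..} g" "\<And>s. 0 < s \<Longrightarrow> (g has_real_derivative g' s) (at s)"
    by (simp_all add: caputo_primitive_def)
  ultimately show ?thesis
    using set_integral_derivative [of t g g'] h \<open>0 < t\<close> True by (simp add: rl_integral_one)
next
  case False
  with assms have nu: "0 < \<nu>" "\<nu> < 1" by auto
  from P have P': "continuous_on {0..} g" "\<And>t. 0 < t \<Longrightarrow> (g has_real_derivative g' t) (at t)"
    "\<And>t. 0 < t \<Longrightarrow> set_integrable lborel {0<..<t} (\<lambda>s. g' s / (t - s) powr \<nu>)"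
    "\<And>t. 0 < t \<Longrightarrow> h t = (LINT s:{0<..<t}|lborel. g' s / (t - s) powr \<nu>) / Gamma (1 - \<nu>)"
    using False by (simp_all add: caputo_primitive_def)
  let ?G = "\<lambda>s. indicator {0<..<t} s * (g' s / (t - s) powr \<nu>)"
  \<comment> \<open>On (0, t) the factor (t - s)^-\<nu> is at least t^-\<nu>, so integrability of
    \<open>g'\<close> against it implies integrability of \<open>g'\<close> itself.\<close>
  have gi: "set_integrable lborel {0<..<t} g'"
    unfolding set_integrable_def
  proof (rule Bochner_Integration.integrable_bound)
    have I: "integrable lborel ?G" using P'(3) [OF \<open>0 < t\<close>] by (simp add: set_integrable_def)
    show "integrable lborel (\<lambda>s. t powr \<nu> * ?G s)" using I by (rule integrable_mult_right)
    have "(\<lambda>s. (t - s) powr \<nu> * ?G s) \<in> borel_measurable lborel"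
      using borel_measurable_integrable [OF I] by measurable
    also have "(\<lambda>s. (t - s) powr \<nu> * ?G s) = (\<lambda>s. indicator {0<..<t} s *\<^sub>R g' s)"
      by (auto simp: indicator_def)
    finally show "(\<lambda>s. indicator {0<..<t} s *\<^sub>R g' s) \<in> borel_measurable lborel" .
    show "AE s in lborel. norm (indicator {0<..<t} s *\<^sub>R g' s) \<le> norm (t powr \<nu> * ?G s)"
    proof (rule AE_I2)
      fix s
      show "norm (indicator {0<..<t} s *\<^sub>R g' s) \<le> norm (t powr \<nu> * ?G s)"
      proof (cases "s \<in> {0<..<t}")
        case True
        then have "(t - s) powr \<nu> \<le> t powr \<nu>" "0 < (t - s) powr \<nu>" using nu by (auto intro!: powr_mono2)
        then show ?thesis
          using True mult_right_mono [of "(t - s) powr \<nu>" "t powr \<nu>" "\<bar>g' s\<bar>"]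
          by (simp add: abs_mult field_simps)
      qed auto
    qed
  qed
  \<comment> \<open>Division by \<open>Gamma (1 - \<nu>)\<close> makes (s - r)^-\<nu> the kernel of
    order 1 - \<nu>, so that \<open>rl_integral_compose\<close> applies with the complementary
    order.\<close>
  have hR: "h s = rl_integral (1 - \<nu>) g' s" if "0 < s" for s
  proof -
    have "(LINT r:{0<..<s}|lborel. g' r / (s - r) powr \<nu>) / Gamma (1 - \<nu>)
        = (LINT r:{0<..<s}|lborel. g' r / (s - r) powr \<nu> / Gamma (1 - \<nu>))"
      unfolding set_lebesgue_integral_def scaleR_conv_of_real
      by (subst Bochner_Integration.integral_divide_zero [symmetric]) simp
    also have "\<dots> = rl_integral (1 - \<nu>) g' s"
      unfolding rl_integral_def set_lebesgue_integral_def
      by (intro Bochner_Integration.integral_cong)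
         (auto simp: rl_kernel_def indicator_def powr_minus_divide)
    finally show ?thesis using P'(4) [OF that] by simp
  qed
  have "rl_integral \<nu> h t = rl_integral \<nu> (rl_integral (1 - \<nu>) g') t"
    unfolding rl_integral_def [of \<nu>]
    by (intro Bochner_Integration.integral_cong) (simp_all add: hR indicator_def)
  also have "\<dots> = (LINT s:{0<..<t}|lborel. g' s)"
    using nu \<open>0 < t\<close> gi by (intro rl_integral_compose) auto
  finally show ?thesis using set_integral_derivative [of t g g'] P' gi \<open>0 < t\<close> by simp
qed

lemma has_caputo_deriv_primitive:
  assumes "0 < \<nu>" "\<nu> \<le> 1" "has_caputo_deriv \<nu> g h"
  obtains g' where "caputo_primitive \<nu> g g' h"
proof -
  have n: "nat \<lceil>\<nu>\<rceil> = 1" using assms by linarith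
  from assms(3) obtain G where G: "G 0 = g"
    "\<forall>k<1. continuous_on {0..} (G k) \<and> (\<forall>t>0. (G k has_real_derivative G (Suc k) t) (at t))"
    "\<forall>t>0. if \<nu> = real 1 then h t = G 1 t
          else set_integrable lborel {0<..<t} (\<lambda>s. G 1 s / (t - s) powr (\<nu> + 1 - real 1)) \<and>
               h t = (LINT s:{0<..<t}|lborel. G 1 s / (t - s) powr (\<nu> + 1 - real 1)) / Gamma (real 1 - \<nu>)"
    unfolding has_caputo_deriv_def Let_def n by blast
  show thesis by (rule that [of "G 1"]) (use G in \<open>cases "\<nu> = 1"; simp add: caputo_primitive_def\<close>)
qed

lemma caputo_inversion:
  assumes "0 < \<nu>" "\<nu> \<le> 1" "has_caputo_deriv \<nu> g h" "0 < t" "set_integrable lborel {0<..<t} h"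
  shows "g t = g 0 + rl_integral \<nu> h t"
proof -
  obtain g' where "caputo_primitive \<nu> g g' h" by (rule has_caputo_deriv_primitive [OF assms(1-3)])
  then show ?thesis using assms by (intro caputo_primitive_inversion)
qed

text \<open>Meant for the axis \<open>t2 = 0\<close>, where the state probabilities do not depend on
  \<open>t1\<close>: there the intermediate derivative in \<open>t1\<close> is 0, which is the
  initial value for the inversion in \<open>t2\<close>.\<close>

lemma has_caputo_deriv_const:
  assumes "0 < \<nu>" "\<nu> \<le> 1" "has_caputo_deriv \<nu> g h" "\<And>s. 0 \<le> s \<Longrightarrow> g s = c" "0 < t"
  shows "h t = 0"
proof -
  obtain g' where P: "caputo_primitive \<nu> g g' h" by (rule has_caputo_deriv_primitive [OF assms(1-3)])
  have "g' s = 0" if "0 < s" for s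
  proof -
    have "(g has_real_derivative g' s) (at s)" using P that by (simp add: caputo_primitive_def)
    moreover have "(g has_real_derivative 0) (at s)"
    proof (rule has_field_derivative_transform_within_open)
      show "((\<lambda>_. c) has_real_derivative 0) (at s)" by simp
      show "s \<in> {0<..}" using that by simp
    qed (use assms(4) in simp_all)
    ultimately show ?thesis by (rule DERIV_unique)
  qed
  then have z: "indicator {0<..<t} s *\<^sub>R (g' s / (t - s) powr \<nu>) = 0" for s
    by (auto simp: indicator_def)
  have "(LINT s:{0<..<t}|lborel. g' s / (t - s) powr \<nu>) = 0"
    unfolding set_lebesgue_integral_def z by simp
  then show ?thesis
    using P \<open>0 < t\<close> \<open>\<And>s. 0 < s \<Longrightarrow> g' s = 0\<close>
    by (cases "\<nu> = 1") (simp_all add: caputo_primitive_def)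
qed

section \<open>Rules and bounds for Laplace transforms\<close>

lemma exp_indicator_integrable:
  fixes z :: real
  assumes "0 < z"
  shows "has_bochner_integral lborel (\<lambda>t. indicator {0<..} t * exp (- z * t)) (1 / z)"
proof -
  have "rl_kernel 1 t = indicator {0<..} t" for t by (simp add: rl_kernel_one indicator_def)
  then show ?thesis
    using rl_kernel_laplace [of 1 z] assms by (simp add: powr_minus_divide mult.commute)
qed

lemma laplace_integrable_bounded:
  fixes z :: real
  assumes "0 < z" and [measurable]: "(\<lambda>t. indicator {0<..} t * f t) \<in> borel_measurable borel"
    and B: "\<And>t. 0 < t \<Longrightarrow> \<bar>f t\<bar> \<le> B"
  shows "integrable lborel (\<lambda>t. indicator {0<..} t * exp (- z * t) * f t)"
proof (rule Bochner_Integration.integrable_bound)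
  show "integrable lborel (\<lambda>t. B * (indicator {0<..} t * exp (- z * t)))"
    using exp_indicator_integrable [OF assms(1)] by (auto simp: has_bochner_integral_iff)
  have "(\<lambda>t. exp (- z * t) * (indicator {0<..} t * f t)) \<in> borel_measurable lborel" by measurable
  then show "(\<lambda>t. indicator {0<..} t * exp (- z * t) * f t) \<in> borel_measurable lborel"
    by (simp add: ac_simps)
  show "AE t in lborel. norm (indicator {0<..} t * exp (- z * t) * f t)
      \<le> norm (B * (indicator {0<..} t * exp (- z * t)))"
    using B by (intro AE_I2) (force simp: indicator_def abs_mult mult.commute)
qed

lemma laplace_cong: "(\<And>t. 0 < t \<Longrightarrow> f t = g t) \<Longrightarrow> laplace z f = laplace z g"
  unfolding laplace_def by (intro Bochner_Integration.integral_cong) (auto simp: indicator_def)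

lemma laplace_const: "0 < z \<Longrightarrow> laplace z (\<lambda>t. c) = c / z"
  using exp_indicator_integrable [of z] by (simp add: laplace_def has_bochner_integral_iff)

lemma laplace_abs_le:
  assumes "0 < z" and B: "\<And>t. 0 < t \<Longrightarrow> \<bar>f t\<bar> \<le> B"
  shows "\<bar>laplace z f\<bar> \<le> B / z"
proof (cases "integrable lborel (\<lambda>t. indicator {0<..} t * exp (- z * t) * f t)")
  case True
  have 1: "has_bochner_integral lborel (\<lambda>t. B * (indicator {0<..} t * exp (- z * t))) (B * (1 / z))"
    using exp_indicator_integrable [OF assms(1)] by (rule has_bochner_integral_mult_right)
  have "norm (laplace z f) \<le> (\<integral>t. B * (indicator {0<..} t * exp (- z * t)) \<partial>lborel)"
    unfolding laplace_def
  proof (rule Bochner_Integration.integral_norm_bound_integral [OF True])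
    show "norm (indicator {0<..} t * exp (- z * t) * f t) \<le> B * (indicator {0<..} t * exp (- z * t))" for t
      using B [of t] by (auto simp: indicator_def abs_mult mult.commute)
  qed (use 1 in \<open>auto simp: has_bochner_integral_iff\<close>)
  with 1 show ?thesis by (simp add: has_bochner_integral_iff)
next
  \<comment> \<open>An integral that does not exist has the value 0, and \<open>B\<close> is
    nonnegative, so the bound survives.\<close>
  case False
  have "0 \<le> B" using B [of 1] by linarith
  with False assms show ?thesis by (simp add: laplace_def not_integrable_integral_eq)
qed

lemma laplace_add:
  assumes "integrable lborel (\<lambda>t. indicator {0<..} t * exp (- z * t) * f t)"
    and "integrable lborel (\<lambda>t. indicator {0<..} t * exp (- z * t) * g t)"
  shows "laplace z (\<lambda>t. f t + g t) = laplace z f + laplace z g"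
  using assms by (simp add: laplace_def distrib_left)

lemma laplace_cmult: "laplace z (\<lambda>t. c * f t) = c * laplace z f"
proof -
  have "laplace z (\<lambda>t. c * f t) = (\<integral>t. c * (indicator {0<..} t * exp (- z * t) * f t) \<partial>lborel)"
    unfolding laplace_def by (intro Bochner_Integration.integral_cong) auto
  then show ?thesis by (simp add: laplace_def)
qed

lemma set_integrable_bounded:
  fixes h :: "real \<Rightarrow> real"
  assumes [measurable]: "(\<lambda>t. indicator {0<..} t * h t) \<in> borel_measurable borel"
    and B: "\<And>s. 0 < s \<Longrightarrow> s < t \<Longrightarrow> \<bar>h s\<bar> \<le> B"
  shows "set_integrable lborel {0<..<t} h"
  unfolding set_integrable_def
proof (rule Bochner_Integration.integrable_bound)
  have "integrable lborel (indicator {0<..<t} :: real \<Rightarrow> real)"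
    by (rule integrable_real_indicator) (simp, cases "0 \<le> t", simp_all)
  then show "integrable lborel (\<lambda>s. B * indicator {0<..<t} s)" by simp
  have "(\<lambda>s. indicator {0<..<t} s * (indicator {0<..} s * h s)) \<in> borel_measurable lborel"
    by measurable
  also have "(\<lambda>s. indicator {0<..<t} s * (indicator {0<..} s * h s)) = (\<lambda>s. indicator {0<..<t} s *\<^sub>R h s)"
    by (auto simp: indicator_def)
  finally show "(\<lambda>s. indicator {0<..<t} s *\<^sub>R h s) \<in> borel_measurable lborel" .
  show "AE s in lborel. norm (indicator {0<..<t} s *\<^sub>R h s) \<le> norm (B * indicator {0<..<t} s)"
    using B by (intro AE_I2) (force simp: indicator_def)
qed

lemma laplace_caputo_le_one:
  assumes nu: "0 < \<nu>" "\<nu> \<le> 1" and z: "0 < z" and P: "caputo_primitive \<nu> g g' h"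
    and m: "(\<lambda>t. indicator {0<..} t * h t) \<in> borel_measurable borel"
    and B: "\<And>t. 0 < t \<Longrightarrow> \<bar>h t\<bar> \<le> B"
  shows "integrable lborel (\<lambda>t. indicator {0<..} t * exp (- z * t) * g t)"
    and "laplace z g = g 0 / z + z powr (- \<nu>) * laplace z h"
proof -
  have g: "g t = g 0 + rl_integral \<nu> h t" if "0 < t" for t
    using B set_integrable_bounded [OF m] that by (intro caputo_primitive_inversion [OF nu P]) auto
  note hi = laplace_integrable_bounded [OF z m B]
  note R = laplace_rl_integral [OF nu(1) z hi]
  have c: "integrable lborel (\<lambda>t. indicator {0<..} t * exp (- z * t) * g 0)"
    using exp_indicator_integrable [OF z] by (auto simp: has_bochner_integral_iff)
  have "indicator {0<..} t * exp (- z * t) * g t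
      = indicator {0<..} t * exp (- z * t) * g 0 + indicator {0<..} t * exp (- z * t) * rl_integral \<nu> h t" for t
    using g [of t] by (simp add: indicator_def distrib_left)
  then show "integrable lborel (\<lambda>t. indicator {0<..} t * exp (- z * t) * g t)"
    using c R(1) by simp
  have "laplace z g = laplace z (\<lambda>t. g 0 + rl_integral \<nu> h t)" using g by (rule laplace_cong)
  also have "\<dots> = g 0 / z + z powr (- \<nu>) * laplace z h"
    using laplace_add [OF c R(1)] R(2) laplace_const [OF z] by simp
  finally show "laplace z g = g 0 / z + z powr (- \<nu>) * laplace z h" .
qed

text \<open>Above order 1 two relations are chained: order 1 between \<open>g\<close> and its
  derivative \<open>G 1\<close>, and order \<nu> - 1 between \<open>G 1\<close> and
  \<open>h\<close>. The value \<open>G 1 0\<close> that would appear in between is 0 by the initial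
  condition.\<close>

lemma laplace_caputo:
  assumes nu: "0 < \<nu>" "\<nu> < 2" and z: "0 < z" and C: "has_caputo_deriv \<nu> g h"
    and m: "(\<lambda>t. indicator {0<..} t * h t) \<in> borel_measurable borel"
    and B: "\<And>t. 0 < t \<Longrightarrow> \<bar>h t\<bar> \<le> B"
    and g0: "1 < \<nu> \<Longrightarrow> (g has_real_derivative 0) (at 0 within {0..})"
  shows "laplace z g = g 0 / z + z powr (- \<nu>) * laplace z h"
proof (cases "\<nu> \<le> 1")
  case True
  obtain g' where "caputo_primitive \<nu> g g' h" by (rule has_caputo_deriv_primitive [OF nu(1) True C])
  then show ?thesis using laplace_caputo_le_one(2) True nu z m B by blast
next
  case False
  then have n: "nat \<lceil>\<nu>\<rceil> = 2" using nu by linarith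
  have ne: "\<nu> \<noteq> real 2" "\<nu> + 1 - real 2 = \<nu> - 1" "real 2 - \<nu> = 1 - (\<nu> - 1)" using nu by auto
  from C obtain G where G: "G 0 = g"
    "\<forall>k<2. continuous_on {0..} (G k) \<and> (\<forall>t>0. (G k has_real_derivative G (Suc k) t) (at t))"
    "\<forall>t>0. if \<nu> = real 2 then h t = G 2 t
          else set_integrable lborel {0<..<t} (\<lambda>s. G 2 s / (t - s) powr (\<nu> + 1 - real 2)) \<and>
               h t = (LINT s:{0<..<t}|lborel. G 2 s / (t - s) powr (\<nu> + 1 - real 2)) / Gamma (real 2 - \<nu>)"
    unfolding has_caputo_deriv_def Let_def n by blast
  have P: "caputo_primitive (\<nu> - 1) (G 1) (G 2) h"
    using G(2) [rule_format, of 1] G(3) ne nu unfolding caputo_primitive_def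
    by (simp add: numeral_2_eq_2)
  have c0: "continuous_on {0..} g" and d0: "\<And>t. 0 < t \<Longrightarrow> (g has_real_derivative G 1 t) (at t)"
    using G(1) G(2) [rule_format, of 0] by auto
  have c1: "continuous_on {0..} (G 1)" using G(2) by simp
  have P1: "caputo_primitive 1 g (G 1) (G 1)" using c0 d0 by (simp add: caputo_primitive_def)
  have G1: "set_integrable lborel {0<..<t} (G 1)" for t
  proof -
    have "set_integrable lborel {0..t} (G 1)"
      using c1 by (intro borel_integrable_atLeastAtMost') (auto intro: continuous_on_subset)
    then show ?thesis by (rule set_integrable_subset) auto
  qed
  \<comment> \<open>\<open>G 1 0\<close> is only the continuous extension of the derivative. By the
    mean value theorem it is also the limit of the difference quotients at 0, and \<open>g0\<close>
    prescribes that limit.\<close>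
  have "G 1 0 = 0"
  proof -
    have "((\<lambda>t. (g t - g 0) / (t - 0)) \<longlongrightarrow> 0) (at 0 within {0..})"
      using g0 False by (simp add: has_field_derivative_iff)
    moreover have "((\<lambda>t. (g t - g 0) / (t - 0)) \<longlongrightarrow> G 1 0) (at 0 within {0..})"
    proof (rule tendstoI)
      fix e :: real assume "0 < e"
      then obtain d where d: "0 < d" "\<And>x. x \<in> {0..} \<Longrightarrow> dist x 0 < d \<Longrightarrow> dist (G 1 x) (G 1 0) < e"
        using c1 unfolding continuous_on_iff by (metis atLeast_iff order_refl)
      have "dist ((g t - g 0) / (t - 0)) (G 1 0) < e" if "0 < t" "t < d" for t
      proof -
        have "continuous_on {0..t} g" using c0 by (rule continuous_on_subset) auto
        moreover have "(g has_derivative (\<lambda>x. x * G 1 s)) (at s)" if "0 < s" for s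
          using d0 [OF that] by (simp add: has_field_derivative_def mult_commute_abs)
        ultimately obtain x where x: "0 < x" "x < t" "g t - g 0 = (t - 0) * G 1 x"
          using mvt [of 0 t g "\<lambda>s x. x * G 1 s"] \<open>0 < t\<close> by auto
        then have "(g t - g 0) / (t - 0) = G 1 x" using that by simp
        then show ?thesis using d(2) [of x] x that by (simp add: dist_real_def)
      qed
      then show "\<forall>\<^sub>F t in at 0 within {0..}. dist ((g t - g 0) / (t - 0)) (G 1 0) < e"
        unfolding eventually_at using d(1) by (intro exI [of _ d]) (auto simp: dist_real_def)
    qed
    moreover have "at 0 within {0..} \<noteq> (bot :: real filter)"
      unfolding at_within_Ici_at_right by simp
    ultimately show ?thesis using tendsto_unique by blast
  qed
  have nu1: "0 < \<nu> - 1" "\<nu> - 1 \<le> 1" using False nu by auto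
  note L1 = laplace_caputo_le_one [OF nu1 z P m B]
  have gr: "g t = g 0 + rl_integral 1 (G 1) t" if "0 < t" for t
    using caputo_primitive_inversion [OF _ _ P1 that G1] by simp
  note R = laplace_rl_integral [OF zero_less_one z L1(1)]
  have c: "integrable lborel (\<lambda>t. indicator {0<..} t * exp (- z * t) * g 0)"
    using exp_indicator_integrable [OF z] by (auto simp: has_bochner_integral_iff)
  have "laplace z g = laplace z (\<lambda>t. g 0 + rl_integral 1 (G 1) t)" using gr by (rule laplace_cong)
  also have "\<dots> = g 0 / z + z powr (- 1) * (z powr (- (\<nu> - 1)) * laplace z h)"
    using laplace_add [OF c R(1)] R(2) laplace_const [OF z] L1(2) \<open>G 1 0 = 0\<close> by simp
  also have "z powr (- 1) * (z powr (- (\<nu> - 1)) * laplace z h) = z powr (- \<nu>) * laplace z h"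
    using z by (simp add: powr_diff powr_minus_divide)
  finally show ?thesis .
qed

section \<open>Interchange of fractional integrals, transforms and parameter integrals\<close>

lemma rl_integral_swap:
  fixes J :: "real \<Rightarrow> real \<Rightarrow> real"
  assumes nu: "0 < \<nu>" and "0 < t" and w: "integrable lborel w"
    and J: "case_prod J \<in> borel_measurable borel"
    and B: "\<And>l s. \<bar>J l s\<bar> \<le> B"
  shows "(\<integral>l. w l * rl_integral \<nu> (J l) t \<partial>lborel) = rl_integral \<nu> (\<lambda>s. \<integral>l. w l * J l s \<partial>lborel) t"
proof -
  have [measurable]: "w \<in> borel_measurable borel" using w by auto
  have [measurable]: "case_prod J \<in> borel_measurable (lborel \<Otimes>\<^sub>M lborel)"
    using J by (simp add: lborel_prod)
  let ?k = "\<lambda>s. rl_kernel \<nu> (t - s) * indicator {0<..} s"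
  have k: "integrable lborel ?k" using rl_kernel_integral [OF assms(1,2)] by (auto simp: has_bochner_integral_iff)
  have wk: "integrable (lborel \<Otimes>\<^sub>M lborel) (\<lambda>(l, s). w l * ?k s)"
  proof (rule lborel_pair.Fubini_integrable)
    have "(\<integral>s. norm (w l * ?k s) \<partial>lborel) = \<bar>w l\<bar> * (\<integral>s. \<bar>?k s\<bar> \<partial>lborel)" for l
      by (simp only: abs_mult real_norm_def integral_mult_right_zero)
    then show "integrable lborel (\<lambda>l. \<integral>s. norm (case (l, s) of (l, s) \<Rightarrow> w l * ?k s) \<partial>lborel)"
      using w by simp
  qed (use k in simp_all)
  have I: "integrable (lborel \<Otimes>\<^sub>M lborel) (\<lambda>(l, s). w l * (?k s * J l s))"
  proof (rule Bochner_Integration.integrable_bound [OF integrable_mult_right [OF wk, of B]])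
    have "\<bar>w l * ?k s\<bar> * \<bar>J l s\<bar> \<le> \<bar>w l * ?k s\<bar> * \<bar>B\<bar>" for l s
      using B [of l s] by (intro mult_left_mono) auto
    then show "AE p in lborel \<Otimes>\<^sub>M lborel. norm (case p of (l, s) \<Rightarrow> w l * (?k s * J l s))
        \<le> norm (B * (case p of (l, s) \<Rightarrow> w l * ?k s))"
      by (intro AE_I2) (auto simp: abs_mult ac_simps)
  qed measurable
  have "(\<integral>l. w l * rl_integral \<nu> (J l) t \<partial>lborel) = (\<integral>l. (\<integral>s. w l * (?k s * J l s) \<partial>lborel) \<partial>lborel)"
    by (simp add: rl_integral_def mult.assoc)
  also have "\<dots> = (\<integral>s. (\<integral>l. w l * (?k s * J l s) \<partial>lborel) \<partial>lborel)"
    by (rule lborel_pair.Fubini_integral [OF I, symmetric])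
  also have "\<dots> = (\<integral>s. (\<integral>l. ?k s * (w l * J l s) \<partial>lborel) \<partial>lborel)"
    by (simp add: ac_simps)
  also have "\<dots> = rl_integral \<nu> (\<lambda>s. \<integral>l. w l * J l s \<partial>lborel) t"
    by (simp only: rl_integral_def integral_mult_right_zero mult.assoc)
  finally show ?thesis .
qed

lemma laplace_integral_swap:
  fixes G :: "real \<Rightarrow> real \<Rightarrow> real"
  assumes z: "0 < z" and w: "integrable lborel w"
    and G: "case_prod G \<in> borel_measurable borel" and B: "\<And>l t. \<bar>G l t\<bar> \<le> B"
  shows "laplace z (\<lambda>t. \<integral>l. w l * G l t \<partial>lborel) = (\<integral>l. w l * laplace z (G l) \<partial>lborel)"
proof -
  have [measurable]: "w \<in> borel_measurable borel" using w by auto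
  have [measurable]: "case_prod G \<in> borel_measurable (lborel \<Otimes>\<^sub>M lborel)"
    using G by (simp add: lborel_prod)
  let ?e = "\<lambda>t. indicator {0<..} t * exp (- z * t)"
  have e: "integrable lborel ?e" using exp_indicator_integrable [OF z] by (auto simp: has_bochner_integral_iff)
  have we: "integrable (lborel \<Otimes>\<^sub>M lborel) (\<lambda>(l, t). w l * ?e t)"
  proof (rule lborel_pair.Fubini_integrable)
    have "(\<integral>t. norm (w l * ?e t) \<partial>lborel) = \<bar>w l\<bar> * (\<integral>t. \<bar>?e t\<bar> \<partial>lborel)" for l
      by (simp only: abs_mult real_norm_def integral_mult_right_zero)
    then show "integrable lborel (\<lambda>l. \<integral>t. norm (case (l, t) of (l, t) \<Rightarrow> w l * ?e t) \<partial>lborel)"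
      using w by simp
  qed (use e in simp_all)
  have I: "integrable (lborel \<Otimes>\<^sub>M lborel) (\<lambda>(l, t). w l * (?e t * G l t))"
  proof (rule Bochner_Integration.integrable_bound [OF integrable_mult_right [OF we, of B]])
    have "\<bar>w l * ?e t\<bar> * \<bar>G l t\<bar> \<le> \<bar>w l * ?e t\<bar> * \<bar>B\<bar>" for l t
      using B [of l t] by (intro mult_left_mono) auto
    then show "AE p in lborel \<Otimes>\<^sub>M lborel. norm (case p of (l, t) \<Rightarrow> w l * (?e t * G l t))
        \<le> norm (B * (case p of (l, t) \<Rightarrow> w l * ?e t))"
      by (intro AE_I2) (auto simp: abs_mult ac_simps)
  qed measurable
  have "laplace z (\<lambda>t. \<integral>l. w l * G l t \<partial>lborel) = (\<integral>t. (\<integral>l. ?e t * (w l * G l t) \<partial>lborel) \<partial>lborel)"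
    by (simp only: laplace_def integral_mult_right_zero)
  also have "\<dots> = (\<integral>t. (\<integral>l. w l * (?e t * G l t) \<partial>lborel) \<partial>lborel)"
    by (simp only: mult.left_commute)
  also have "\<dots> = (\<integral>l. (\<integral>t. w l * (?e t * G l t) \<partial>lborel) \<partial>lborel)"
    by (rule lborel_pair.Fubini_integral [OF I])
  also have "\<dots> = (\<integral>l. w l * laplace z (G l) \<partial>lborel)"
    by (simp only: laplace_def integral_mult_right_zero)
  finally show ?thesis .
qed

lemma rl_integral_cong:
  "(\<And>s. 0 < s \<Longrightarrow> s < t \<Longrightarrow> f s = g s) \<Longrightarrow> rl_integral \<nu> f t = rl_integral \<nu> g t"
  unfolding rl_integral_def by (intro Bochner_Integration.integral_cong) (auto simp: rl_kernel_def indicator_def)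

lemma borel_measurable_compose3:
  fixes X :: "real \<Rightarrow> real \<Rightarrow> real \<Rightarrow> real"
  assumes X: "(\<lambda>(a, b, c). X a b c) \<in> borel_measurable borel"
    and [measurable]: "f \<in> borel_measurable N" "g \<in> borel_measurable N" "h \<in> borel_measurable N"
  shows "(\<lambda>x. X (f x) (g x) (h x)) \<in> borel_measurable N"
proof -
  have "(\<lambda>x. (f x, g x, h x)) \<in> measurable N borel" by (simp add: borel_prod [symmetric])
  from measurable_compose [OF this X] show ?thesis by simp
qed

lemma borel_measurable_compose2:
  fixes X :: "real \<Rightarrow> real \<Rightarrow> real"
  assumes X: "(\<lambda>(a, b). X a b) \<in> borel_measurable borel"
    and [measurable]: "f \<in> borel_measurable N" "g \<in> borel_measurable N"
  shows "(\<lambda>x. X (f x) (g x)) \<in> borel_measurable N"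
proof -
  have "(\<lambda>x. (f x, g x)) \<in> measurable N borel" by (simp add: borel_prod [symmetric])
  from measurable_compose [OF this X] show ?thesis by simp
qed

lemma rl_integral_measurable:
  fixes X :: "real \<Rightarrow> real \<Rightarrow> real \<Rightarrow> real"
  assumes X: "(\<lambda>(a, b, c). X a b c) \<in> borel_measurable borel"
  shows "(\<lambda>(a, b). rl_integral \<nu> (X a b) t) \<in> borel_measurable borel"
proof -
  have [measurable]: "(\<lambda>y. X (fst (fst y)) (snd (fst y)) (snd y))
      \<in> borel_measurable ((borel \<Otimes>\<^sub>M borel) \<Otimes>\<^sub>M lborel)"
    by (rule borel_measurable_compose3 [OF X]) measurable
  have "(\<lambda>(x, s). rl_kernel \<nu> (t - s) * (indicator {0<..} s * X (fst x) (snd x) s))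
      \<in> borel_measurable ((borel \<Otimes>\<^sub>M borel) \<Otimes>\<^sub>M lborel)"
    unfolding split_beta by measurable
  from lborel.borel_measurable_lebesgue_integral [OF this]
  show ?thesis unfolding borel_prod rl_integral_def split_beta .
qed

lemma laplace_measurable:
  fixes X :: "real \<Rightarrow> real \<Rightarrow> real"
  assumes X: "(\<lambda>(a, b). X a b) \<in> borel_measurable borel"
  shows "(\<lambda>a. laplace z (X a)) \<in> borel_measurable borel"
proof -
  have [measurable]: "(\<lambda>y. X (fst y) (snd y)) \<in> borel_measurable (borel \<Otimes>\<^sub>M lborel)"
    by (rule borel_measurable_compose2 [OF X]) measurable
  have "(\<lambda>(x, s). indicator {0<..} s * exp (- z * s) * X x s) \<in> borel_measurable (borel \<Otimes>\<^sub>M lborel)"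
    unfolding split_beta by measurable
  from lborel.borel_measurable_lebesgue_integral [OF this]
  show ?thesis unfolding laplace_def .
qed

text \<open>The inner fractional integral depends on \<open>s1\<close> as a parameter, so the
  transform in \<open>t1\<close> first has to be moved inside it; only then does the transform in
  \<open>t2\<close> meet a fractional integral in its own variable.\<close>

lemma laplace2_rl_integral:
  fixes K :: "real \<Rightarrow> real \<Rightarrow> real"
  assumes \<alpha>: "0 < \<alpha>1" "0 < \<alpha>2" and z: "0 < z1" "0 < z2"
    and K: "(\<lambda>(s1, s2). K s1 s2) \<in> borel_measurable borel" and B: "\<And>s1 s2. \<bar>K s1 s2\<bar> \<le> B"
  shows "laplace z2 (\<lambda>t2. laplace z1 (\<lambda>t1. rl_integral \<alpha>1 (\<lambda>s1. rl_integral \<alpha>2 (K s1) t2) t1))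
    = z1 powr (- \<alpha>1) * z2 powr (- \<alpha>2) * laplace z2 (\<lambda>s2. laplace z1 (\<lambda>s1. K s1 s2))"
proof -
  have Ks: "K s1 \<in> borel_measurable borel" for s1
    by (rule borel_measurable_compose2 [OF K]) simp_all
  have K': "(\<lambda>(s2, s1). K s1 s2) \<in> borel_measurable borel"
    unfolding split_beta borel_prod [symmetric] by (rule borel_measurable_compose2 [OF K]) measurable
  have K3: "(\<lambda>(a :: real, b, c). K b c) \<in> borel_measurable borel"
    unfolding split_beta borel_prod [symmetric] by (rule borel_measurable_compose2 [OF K]) measurable
  let ?w = "\<lambda>s1. indicator {0<..} s1 * exp (- z1 * s1)"
  have w: "integrable lborel ?w" using exp_indicator_integrable [OF z(1)] by (auto simp: has_bochner_integral_iff)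
  have inner: "laplace z1 (\<lambda>t1. rl_integral \<alpha>1 (\<lambda>s1. rl_integral \<alpha>2 (K s1) t2) t1)
      = z1 powr (- \<alpha>1) * rl_integral \<alpha>2 (\<lambda>s2. laplace z1 (\<lambda>s1. K s1 s2)) t2" if t2: "0 < t2" for t2
  proof -
    have "(\<lambda>s1. rl_integral \<alpha>2 (K s1) t2) \<in> borel_measurable borel"
      by (rule borel_measurable_compose2 [OF rl_integral_measurable [OF K3], where f = "\<lambda>_. 0" and g = "\<lambda>x. x"]) simp_all
    then have m: "(\<lambda>s1. indicator {0<..} s1 * rl_integral \<alpha>2 (K s1) t2) \<in> borel_measurable borel"
      by (intro borel_measurable_times borel_measurable_indicator) simp_all
    note i = laplace_integrable_bounded [OF z(1) m rl_integrable_bounded(2) [OF \<alpha>(2) t2 Ks B]]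
    have "laplace z1 (rl_integral \<alpha>1 (\<lambda>s1. rl_integral \<alpha>2 (K s1) t2))
        = z1 powr (- \<alpha>1) * laplace z1 (\<lambda>s1. rl_integral \<alpha>2 (K s1) t2)"
      by (rule laplace_rl_integral(2) [OF \<alpha>(1) z(1) i])
    also have "laplace z1 (\<lambda>s1. rl_integral \<alpha>2 (K s1) t2) = rl_integral \<alpha>2 (\<lambda>s2. laplace z1 (\<lambda>s1. K s1 s2)) t2"
      unfolding laplace_def by (rule rl_integral_swap [OF \<alpha>(2) t2 w K B])
    finally show ?thesis .
  qed
  have Lm: "(\<lambda>s2. laplace z1 (\<lambda>s1. K s1 s2)) \<in> borel_measurable borel"
    by (rule laplace_measurable [OF K'])
  then have m: "(\<lambda>s2. indicator {0<..} s2 * laplace z1 (\<lambda>s1. K s1 s2)) \<in> borel_measurable borel"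
    by (intro borel_measurable_times borel_measurable_indicator) simp_all
  note i = laplace_integrable_bounded [OF z(2) m laplace_abs_le [OF z(1) B]]
  have "laplace z2 (\<lambda>t2. laplace z1 (\<lambda>t1. rl_integral \<alpha>1 (\<lambda>s1. rl_integral \<alpha>2 (K s1) t2) t1))
      = z1 powr (- \<alpha>1) * laplace z2 (rl_integral \<alpha>2 (\<lambda>s2. laplace z1 (\<lambda>s1. K s1 s2)))"
    by (subst laplace_cmult [symmetric]) (rule laplace_cong, rule inner)
  also have "laplace z2 (rl_integral \<alpha>2 (\<lambda>s2. laplace z1 (\<lambda>s1. K s1 s2)))
      = z2 powr (- \<alpha>2) * laplace z2 (\<lambda>s2. laplace z1 (\<lambda>s1. K s1 s2))"
    by (rule laplace_rl_integral(2) [OF \<alpha>(2) z(2) i])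
  finally show ?thesis by simp
qed

section \<open>Uniqueness of Laplace transforms\<close>

text \<open>Weierstrass approximation in the variable \<open>y = exp (- \<theta> x)\<close>.\<close>
lemma exponential_sum_approximation:
  fixes f :: "real \<Rightarrow> real"
  assumes c: "continuous_on {0..} f" and l: "(f \<longlongrightarrow> 0) at_top" and "0 < \<theta>" "0 < e"
  obtains n :: nat and a :: "nat \<Rightarrow> real"
    where "\<And>x. 0 \<le> x \<Longrightarrow> \<bar>f x - (\<Sum>k\<le>n. a k * exp (- (\<theta> * real k) * x))\<bar> < e"
proof -
  \<comment> \<open>The point \<open>y = 0\<close> stands for \<open>x\<close> at infinity, so the
    decay of \<open>f\<close> becomes the continuity of \<open>g\<close> at 0.\<close>
  define g where "g y = (if y = 0 then 0 else f (- ln y / \<theta>))" for y :: real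
  have "continuous (at y within {0..1}) g" if "y \<in> {0..1}" for y
  proof (cases "y = 0")
    case True
    have "filterlim (\<lambda>y. - ln y / \<theta>) at_top (at_right 0)"
      using \<open>0 < \<theta>\<close> by real_asymp
    then have "((\<lambda>y. f (- ln y / \<theta>)) \<longlongrightarrow> 0) (at_right 0)" by (rule filterlim_compose [OF l])
    then have "(g \<longlongrightarrow> 0) (at_right 0)"
      by (rule Lim_transform_eventually) (auto simp: g_def eventually_at_filter)
    then have "(g \<longlongrightarrow> g 0) (at 0 within {0..1})"
      by (simp add: g_def at_within_Icc_at_right)
    then show ?thesis using True by (simp add: continuous_within)
  next
    case False
    then have y: "0 < y" "y \<le> 1" using that by auto
    have "continuous_on {0<..1} (\<lambda>y. f (- ln y / \<theta>))"
      using \<open>0 < \<theta>\<close> by (intro continuous_on_compose2 [OF c] continuous_intros)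
        (auto intro!: divide_nonpos_pos)
    then have "continuous_on {0<..1} g"
      by (rule continuous_on_eq) (auto simp: g_def)
    then have "continuous (at y within {0<..1}) g" using y by (simp add: continuous_on_eq_continuous_within)
    moreover have "at y within {0<..1} = at y within {0..1}"
      by (rule at_within_nhd [of y "{0<..}"]) (use y in auto)
    ultimately show ?thesis by (simp add: continuous_within)
  qed
  then have "continuous_on {0..1} g" by (simp add: continuous_on_eq_continuous_within)
  then obtain p where p: "real_polynomial_function p" "\<And>y. y \<in> {0..1} \<Longrightarrow> \<bar>g y - p y\<bar> < e"
    using Stone_Weierstrass_real_polynomial_function [of "{0..1}" g e] \<open>0 < e\<close> by auto
  then obtain a n where a: "p = (\<lambda>x. \<Sum>i\<le>n. a i * x ^ i)"
    unfolding real_polynomial_function_iff_sum by blast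
  show thesis
  proof (rule that)
    fix x :: real assume "0 \<le> x"
    then have "\<bar>g (exp (- (\<theta> * x))) - p (exp (- (\<theta> * x)))\<bar> < e"
      using \<open>0 < \<theta>\<close> by (intro p) auto
    moreover have "g (exp (- (\<theta> * x))) = f x" using \<open>0 < \<theta>\<close> by (simp add: g_def)
    moreover have "p (exp (- (\<theta> * x))) = (\<Sum>k\<le>n. a k * exp (- (\<theta> * real k) * x))"
      by (simp add: a exp_of_nat_mult [symmetric] ac_simps)
    ultimately show "\<bar>f x - (\<Sum>k\<le>n. a k * exp (- (\<theta> * real k) * x))\<bar> < e" by simp
  qed
qed

lemma borel_measurable_indicator_continuous:
  fixes f :: "real \<Rightarrow> real"
  assumes "continuous_on {0<..} f"
  shows "(\<lambda>t. indicator {0<..} t * f t) \<in> borel_measurable borel"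
  using borel_measurable_continuous_on_indicator [OF _ assms] by simp

text \<open>Exponential sums approximate \<phi>, a positive weight times f, uniformly, and each
  exponential integrates to 0 against F = e^-t f. Hence the integral of F \<phi>, which is a
  positive weight times f^2, is 0.\<close>

lemma laplace_unique_zero:
  fixes f :: "real \<Rightarrow> real"
  assumes c: "continuous_on {0<..} f" and B: "\<And>t. 0 < t \<Longrightarrow> \<bar>f t\<bar> \<le> B"
    and L: "\<And>z. 0 < z \<Longrightarrow> laplace z f = 0" and "0 < t"
  shows "f t = 0"
proof -
  have m: "(\<lambda>t. indicator {0<..} t * f t) \<in> borel_measurable borel"
    using c by (rule borel_measurable_indicator_continuous)
  have B0: "0 \<le> B" using B [of 1] by linarith
  define F where "F t = indicator {0<..} t * exp (- 1 * t) * f t" for t :: real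
  have Fi: "integrable lborel F"
    unfolding F_def by (rule laplace_integrable_bounded [OF _ m B]) auto
  then have Fm [measurable]: "F \<in> borel_measurable borel" by auto
  \<comment> \<open>The factor \<open>exp (- t)\<close> provides decay at infinity and
    \<open>1 - exp (- t)\<close> provides continuity at 0, where \<open>f\<close> is bounded but may
    have no limit.\<close>
  define \<phi> where "\<phi> t = (if t = 0 then 0 else exp (- t) * (1 - exp (- t)) * f t)" for t :: real
  have phi_le: "\<bar>\<phi> t\<bar> \<le> B * exp (- t)" "\<bar>\<phi> t\<bar> \<le> B * (1 - exp (- t))" if "0 \<le> t" for t
  proof -
    have a: "0 \<le> 1 - exp (- t)" "1 - exp (- t) \<le> 1" "exp (- t) \<le> 1" using that by auto
    have "\<bar>\<phi> t\<bar> \<le> exp (- t) * (1 - exp (- t)) * B"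
    proof (cases "t = 0")
      case False
      then show ?thesis using that a B [of t] by (simp add: \<phi>_def abs_mult mult_left_mono)
    qed (simp add: \<phi>_def)
    moreover have "exp (- t) * (1 - exp (- t)) * B \<le> exp (- t) * 1 * B"
      by (rule mult_right_mono [OF mult_left_mono [OF a(2)] B0]) simp
    moreover have "exp (- t) * (1 - exp (- t)) * B \<le> 1 * (1 - exp (- t)) * B"
      by (rule mult_right_mono [OF mult_right_mono [OF a(3) a(1)] B0])
    ultimately show "\<bar>\<phi> t\<bar> \<le> B * exp (- t)" "\<bar>\<phi> t\<bar> \<le> B * (1 - exp (- t))"
      by (simp_all only: mult.commute [of B] mult_1_right mult_1_left)
  qed
  have "continuous (at t within {0..}) \<phi>" if "t \<in> {0..}" for t
  proof (cases "t = 0")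
    case True
    have "((\<lambda>t. B * (1 - exp (- t))) \<longlongrightarrow> B * (1 - exp (- 0))) (at 0 within {0..})"
      by (intro tendsto_intros)
    then have "((\<lambda>t. B * (1 - exp (- t))) \<longlongrightarrow> 0) (at 0 within {0..})" by simp
    moreover have "\<forall>\<^sub>F t in at 0 within {0..}. norm (\<phi> t) \<le> B * (1 - exp (- t))"
      unfolding eventually_at_filter using phi_le(2) by (intro always_eventually) simp
    ultimately have "(\<phi> \<longlongrightarrow> 0) (at 0 within {0..})" by (rule Lim_null_comparison [rotated])
    then show ?thesis using True by (simp add: continuous_within \<phi>_def)
  next
    case False
    then have t: "0 < t" using that by simp
    have "continuous_on {0<..} (\<lambda>t. exp (- t) * (1 - exp (- t)) * f t)"
      by (intro continuous_intros c)
    then have "continuous_on {0<..} \<phi>" by (rule continuous_on_eq) (auto simp: \<phi>_def)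
    then have "isCont \<phi> t" using t by (simp add: continuous_on_eq_continuous_at)
    then show ?thesis by (rule continuous_at_imp_continuous_at_within)
  qed
  then have pc: "continuous_on {0..} \<phi>" by (simp add: continuous_on_eq_continuous_within)
  have pl: "(\<phi> \<longlongrightarrow> 0) at_top"
  proof (rule Lim_null_comparison)
    show "\<forall>\<^sub>F t in at_top. norm (\<phi> t) \<le> B * exp (- t)"
      using phi_le(1) by (intro eventually_mono [OF eventually_ge_at_top [of 0]]) auto
    have "((\<lambda>t :: real. exp (- t)) \<longlongrightarrow> 0) at_top" by real_asymp
    then show "((\<lambda>t. B * exp (- t)) \<longlongrightarrow> 0) at_top" by (rule tendsto_mult_right_zero)
  qed
  have Fphi: "F t * \<phi> t = indicator {0<..} t * (exp (- t) * exp (- t) * (1 - exp (- t)) * (f t)\<^sup>2)" for t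
    by (auto simp: F_def \<phi>_def indicator_def power2_eq_square)
  have Fphi0: "0 \<le> F t * \<phi> t" for t unfolding Fphi by (auto simp: indicator_def)
  have pm: "(\<lambda>t. indicator {0..} t * \<phi> t) \<in> borel_measurable borel"
    using borel_measurable_continuous_on_indicator [OF _ pc] by simp
  have Fpm: "(\<lambda>t. F t * \<phi> t) \<in> borel_measurable borel"
  proof -
    have "(\<lambda>t. F t * (indicator {0..} t * \<phi> t)) \<in> borel_measurable borel" using pm by measurable
    also have "(\<lambda>t. F t * (indicator {0..} t * \<phi> t)) = (\<lambda>t. F t * \<phi> t)"
      by (auto simp: F_def indicator_def)
    finally show ?thesis .
  qed
  have Fpi: "integrable lborel (\<lambda>t. F t * \<phi> t)"
  proof (rule Bochner_Integration.integrable_bound [OF integrable_mult_right [OF Fi, of B]])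
    show "AE t in lborel. norm (F t * \<phi> t) \<le> norm (B * F t)"
    proof (rule AE_I2)
      fix t show "norm (F t * \<phi> t) \<le> norm (B * F t)"
      proof (cases "0 < t")
        case True
        then have "\<bar>\<phi> t\<bar> \<le> B * 1" using phi_le(1) [of t] B0 mult_left_mono [of "exp (-t)" 1 B] by simp
        then show ?thesis using B0 mult_left_mono [of "\<bar>\<phi> t\<bar>" B "\<bar>F t\<bar>"] by (simp add: abs_mult mult.commute)
      qed (simp add: F_def)
    qed
  qed (use Fpm in simp)
  have "(\<integral>t. F t * \<phi> t \<partial>lborel) \<le> 0"
  proof (rule field_le_epsilon)
    fix e :: real assume "0 < e"
    define I where "I = (\<integral>t. \<bar>F t\<bar> \<partial>lborel)"
    have I0: "0 \<le> I" by (simp add: I_def)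
    define d where "d = e / (I + 1)"
    have d: "0 < d" "d * I \<le> e" using \<open>0 < e\<close> I0 by (auto simp: d_def divide_simps)
    obtain n :: nat and a where a: "\<And>x. 0 \<le> x \<Longrightarrow> \<bar>\<phi> x - (\<Sum>k\<le>n. a k * exp (- (1 * real k) * x))\<bar> < d"
      by (rule exponential_sum_approximation [OF pc pl zero_less_one d(1)]) blast
    let ?S = "\<lambda>t. \<Sum>k\<le>n. a k * exp (- (1 * real k) * t)"
    have eqk: "F t * (a k * exp (- (1 * real k) * t)) = a k * (indicator {0<..} t * exp (- (real k + 1) * t) * f t)" for t k
    proof -
      have "exp (- (real k + 1) * t) = exp (- 1 * t) * exp (- (1 * real k) * t)"
        unfolding exp_add [symmetric] by (simp add: algebra_simps)
      then show ?thesis by (simp only: F_def ac_simps)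
    qed
    have ki: "integrable lborel (\<lambda>t. indicator {0<..} t * exp (- (real k + 1) * t) * f t)" for k
      by (rule laplace_integrable_bounded [OF _ m B]) auto
    have "(\<integral>t. indicator {0<..} t * exp (- (real k + 1) * t) * f t \<partial>lborel) = 0" for k
      using L [of "real k + 1"] by (simp add: laplace_def)
    then have S0: "(\<integral>t. F t * ?S t \<partial>lborel) = 0"
      unfolding sum_distrib_left eqk
      by (subst Bochner_Integration.integral_sum) (simp_all only: integral_mult_right_zero mult_zero_right
          sum.neutral_const integrable_mult_right [OF ki])
    have Si: "integrable lborel (\<lambda>t. F t * ?S t)"
      unfolding sum_distrib_left eqk
      by (intro Bochner_Integration.integrable_sum integrable_mult_right ki)
    have "(\<integral>t. F t * \<phi> t \<partial>lborel) = (\<integral>t. F t * \<phi> t - F t * ?S t \<partial>lborel)"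
      using Fpi Si S0 by simp
    also have "\<dots> \<le> (\<integral>t. d * \<bar>F t\<bar> \<partial>lborel)"
    proof (intro integral_mono Bochner_Integration.integrable_diff Fpi Si)
      fix t
      have "F t * \<phi> t - F t * ?S t \<le> \<bar>F t\<bar> * \<bar>\<phi> t - ?S t\<bar>"
        unfolding right_diff_distrib [symmetric] abs_mult [symmetric] by (rule abs_ge_self)
      also have "\<dots> \<le> \<bar>F t\<bar> * d"
      proof (cases "0 < t")
        case True
        then show ?thesis using a [of t] by (intro mult_left_mono) auto
      qed (simp add: F_def)
      finally show "F t * \<phi> t - F t * ?S t \<le> d * \<bar>F t\<bar>" by (simp add: mult.commute)
    qed (use Fi in simp)
    also have "\<dots> \<le> 0 + e" using d(2) by (simp add: I_def)
    finally show "(\<integral>t. F t * \<phi> t \<partial>lborel) \<le> 0 + e" .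
  qed
  moreover have "0 \<le> (\<integral>t. F t * \<phi> t \<partial>lborel)" using Fphi0 by simp
  ultimately have "(\<integral>t. F t * \<phi> t \<partial>lborel) = 0" by linarith
  then have ae: "AE t in lborel. F t * \<phi> t = 0"
    using integral_nonneg_eq_0_iff_AE [OF Fpi] Fphi0 by simp
  \<comment> \<open>The set where \<open>f\<close> is nonzero is open by continuity and null by the
    vanishing integral; a nonempty open set is not negligible.\<close>
  define S where "S = {0<..} \<inter> f -` (- {0})"
  have S: "open S" unfolding S_def
    using c by (rule continuous_open_preimage) auto
  have "AE t in lborel. t \<notin> S"
    using ae
  proof eventually_elim
    case (elim t)
    then show ?case unfolding Fphi by (auto simp: S_def indicator_def)
  qed
  then have "S \<in> null_sets lborel"
    using S by (subst AE_iff_null_sets) auto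
  then have "negligible S" using null_sets_completionI [of S lborel] by (simp add: negligible_iff_null_sets)
  then have "S = {}" using S open_not_negligible by blast
  then show ?thesis using \<open>0 < t\<close> by (auto simp: S_def)
qed

section \<open>Smooth cut-off functions\<close>

text \<open>
  Closed under differentiation by induction, which makes every member infinitely differentiable;
  the factor \<open>x\<^sup>-\<^sup>k\<close> is needed for this.
\<close>
inductive smooth_function :: "(real \<Rightarrow> real) \<Rightarrow> bool" where
  smooth_const: "smooth_function (\<lambda>x. c)"
| smooth_ident: "smooth_function (\<lambda>x. x)"
| smooth_exp: "smooth_function exp"
| smooth_flat: "smooth_function (\<lambda>x. if 0 < x then exp (- 1 / x) / x ^ k else 0)"
| smooth_add: "smooth_function f \<Longrightarrow> smooth_function g \<Longrightarrow> smooth_function (\<lambda>x. f x + g x)"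
| smooth_mult: "smooth_function f \<Longrightarrow> smooth_function g \<Longrightarrow> smooth_function (\<lambda>x. f x * g x)"
| smooth_compose: "smooth_function f \<Longrightarrow> smooth_function g \<Longrightarrow> smooth_function (\<lambda>x. f (g x))"
| smooth_inverse: "smooth_function f \<Longrightarrow> (\<And>x. f x \<noteq> 0) \<Longrightarrow> smooth_function (\<lambda>x. inverse (f x))"

lemma flat_tendsto_0: "((\<lambda>x::real. exp (- 1 / x) / x ^ k) \<longlongrightarrow> 0) (at_right 0)"
proof -
  have "((\<lambda>x::real. inverse x ^ k / exp (inverse x)) \<longlongrightarrow> 0) (at_right 0)"
    by (rule filterlim_compose [OF tendsto_power_div_exp_0 filterlim_inverse_at_top_right])
  then show ?thesis by (simp add: field_simps exp_minus)
qed

lemma flat_has_derivative: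
  fixes k :: nat
  defines "b \<equiv> \<lambda>k (x::real). if 0 < x then exp (- 1 / x) / x ^ k else 0"
  shows "(b k has_real_derivative b (k + 2) x + - real k * b (k + 1) x) (at x)"
proof -
  consider "0 < x" | "x < 0" | "x = 0" by linarith
  then show ?thesis
  proof cases
    case 1
    have "((\<lambda>x. exp (- 1 / x) * inverse x ^ k) has_real_derivative
        exp (- 1 / x) * (1 / x ^ 2) * inverse x ^ k + exp (- 1 / x) * (real k * inverse x ^ (k - 1) * (- (inverse x ^ 2)))) (at x)"
      using 1 by (auto intro!: derivative_eq_intros simp: power2_eq_square divide_inverse)
    also have "exp (- 1 / x) * (1 / x ^ 2) * inverse x ^ k + exp (- 1 / x) * (real k * inverse x ^ (k - 1) * (- (inverse x ^ 2)))
        = b (k + 2) x + - real k * b (k + 1) x"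
    proof (cases k)
      case (Suc j)
      then show ?thesis using 1
        by (simp add: b_def power2_eq_square field_simps)
    qed (use 1 in \<open>simp add: b_def field_simps power2_eq_square\<close>)
    finally have d: "((\<lambda>x. exp (- 1 / x) * inverse x ^ k) has_real_derivative
      b (k + 2) x + - real k * b (k + 1) x) (at x)" .
    show ?thesis
    proof (rule has_field_derivative_transform_within_open [OF d])
      show "open {0::real<..}" "x \<in> {0<..}" using 1 by auto
    qed (simp add: b_def divide_inverse power_inverse)
  next
    case 2
    have d: "((\<lambda>x. 0) has_real_derivative b (k + 2) x + - real k * b (k + 1) x) (at x)"
      using 2 by (simp add: b_def)
    show ?thesis
    proof (rule has_field_derivative_transform_within_open [OF d])
      show "open {..<0::real}" "x \<in> {..<0}" using 2 by auto
    qed (simp add: b_def)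
  next
    \<comment> \<open>The difference quotient of \<open>b k\<close> at 0 is
      \<open>b (k + 1)\<close>, so differentiability at 0 is the flatness of the next function of
      the family.\<close>
    case 3
    have "((\<lambda>h. b (k + 1) h) \<longlongrightarrow> 0) (at 0)"
      unfolding filterlim_at_split
    proof
      show "(b (k + 1) \<longlongrightarrow> 0) (at_left 0)"
        by (rule tendsto_eventually) (auto simp: b_def eventually_at_filter)
      show "(b (k + 1) \<longlongrightarrow> 0) (at_right 0)"
        by (rule Lim_transform_eventually [OF flat_tendsto_0 [of "k + 1"]])
           (auto simp: b_def eventually_at_filter)
    qed
    moreover have "b (k + 1) h = (b k (0 + h) - b k 0) / h" for h
      by (simp add: b_def field_simps)
    ultimately show ?thesis using 3 unfolding DERIV_def by (simp add: b_def)
  qed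
qed

lemma smooth_function_has_derivative:
  assumes "smooth_function f"
  shows "\<exists>f'. smooth_function f' \<and> (\<forall>x. (f has_real_derivative f' x) (at x))"
  using assms
proof induction
  case (smooth_const c)
  show ?case by (intro exI [of _ "\<lambda>x. 0"]) (simp add: smooth_function.smooth_const)
next
  case smooth_ident
  show ?case by (intro exI [of _ "\<lambda>x. 1"]) (simp add: smooth_function.smooth_const)
next
  case smooth_exp
  show ?case by (intro exI [of _ exp]) (simp add: smooth_function.smooth_exp)
next
  case (smooth_flat k)
  show ?case
    by (intro exI conjI allI, rule smooth_function.smooth_add [OF smooth_function.smooth_flat
          smooth_function.smooth_mult [OF smooth_function.smooth_const smooth_function.smooth_flat]],
        rule flat_has_derivative)
next
  case (smooth_add f g)
  then obtain f' g' where *: "smooth_function f'" "\<And>x. (f has_real_derivative f' x) (at x)"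
    "smooth_function g'" "\<And>x. (g has_real_derivative g' x) (at x)" by blast
  show ?case
    by (intro exI [of _ "\<lambda>x. f' x + g' x"] conjI allI smooth_function.smooth_add DERIV_add *)
next
  case (smooth_mult f g)
  then obtain f' g' where *: "smooth_function f'" "\<And>x. (f has_real_derivative f' x) (at x)"
    "smooth_function g'" "\<And>x. (g has_real_derivative g' x) (at x)" by blast
  show ?case
    by (intro exI [of _ "\<lambda>x. f' x * g x + g' x * f x"] conjI allI smooth_function.smooth_add
        smooth_function.smooth_mult DERIV_mult * smooth_mult.hyps)
next
  case (smooth_compose f g)
  then obtain f' g' where *: "smooth_function f'" "\<And>x. (f has_real_derivative f' x) (at x)"
    "smooth_function g'" "\<And>x. (g has_real_derivative g' x) (at x)" by blast
  have "((\<lambda>x. f (g x)) has_real_derivative f' (g x) * g' x) (at x)" for x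
    by (rule DERIV_chain2 [OF *(2,4)])
  moreover have "smooth_function (\<lambda>x. f' (g x) * g' x)"
    by (rule smooth_function.smooth_mult [OF smooth_function.smooth_compose [OF *(1) smooth_compose.hyps(2)] *(3)])
  ultimately show ?case by blast
next
  case (smooth_inverse f)
  then obtain f' where f': "smooth_function f'" "\<And>x. (f has_real_derivative f' x) (at x)" by blast
  have "smooth_function (\<lambda>x. (- 1) * f' x * (inverse (f x) * inverse (f x)))"
    by (rule smooth_function.smooth_mult [OF smooth_function.smooth_mult [OF smooth_function.smooth_const f'(1)]
          smooth_function.smooth_mult]; rule smooth_function.smooth_inverse [OF smooth_inverse.hyps])
  moreover have "((\<lambda>x. inverse (f x)) has_real_derivative (- 1) * f' x * (inverse (f x) * inverse (f x))) (at x)" for x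
    using DERIV_inverse' [OF f'(2) smooth_inverse(2)] by (simp add: ac_simps)
  ultimately show ?case by blast
qed

lemma smooth_function_deriv:
  assumes "smooth_function f"
  shows "smooth_function (deriv f)" "(f has_real_derivative deriv f x) (at x)"
proof -
  obtain f' where f': "smooth_function f'" "\<And>x. (f has_real_derivative f' x) (at x)"
    using smooth_function_has_derivative [OF assms] by blast
  then have "deriv f = f'" by (auto intro: DERIV_imp_deriv)
  with f' show "smooth_function (deriv f)" "(f has_real_derivative deriv f x) (at x)" by simp_all
qed

lemma smooth_function_iterate: "smooth_function f \<Longrightarrow> smooth_function ((deriv ^^ k) f)"
  by (induction k) (auto intro: smooth_function_deriv)

lemma smooth_function_continuous: "smooth_function f \<Longrightarrow> continuous_on A f"
  using smooth_function_deriv(2) by (intro continuous_at_imp_continuous_on) (blast intro: DERIV_isCont)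

lemma test_functionI:
  assumes "smooth_function \<phi>" "\<And>x. R < \<bar>x\<bar> \<Longrightarrow> \<phi> x = 0"
  shows "test_function \<phi>"
  unfolding test_function_def
proof (intro conjI allI)
  fix k x show "(deriv ^^ k) \<phi> differentiable (at x)"
    using smooth_function_deriv(2) [OF smooth_function_iterate [OF assms(1)], of k x]
    by (auto simp: real_differentiable_def)
qed (use assms(2) in blast)

text \<open>The quotient b(x) / (b(x) + b(1 - x)) for the flat function b(x) = e^(-1/x). The forms
  \<open>x ^ 0\<close> and \<open>1 + (- 1) * x\<close> are chosen so that every piece is a literal
  instance of a rule of \<open>smooth_function\<close>.\<close>

definition smooth_step :: "real \<Rightarrow> real" where
  "smooth_step x = (let b = (\<lambda>x. if 0 < x then exp (- 1 / x) / x ^ 0 else 0) in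
     b x * inverse (b x + b (1 + (- 1) * x)))"

lemma smooth_step_denominator:
  "(if 0 < x then exp (- 1 / x) / x ^ 0 else 0) +
   (if 0 < 1 + (- 1) * x then exp (- 1 / (1 + (- 1) * x)) / (1 + (- 1) * x) ^ 0 else 0) > (0 :: real)"
  by (cases "0 < x") (auto intro: add_pos_nonneg)

lemma smooth_step_smooth: "smooth_function smooth_step"
proof -
  have b: "smooth_function (\<lambda>x. if 0 < x then exp (- 1 / x) / x ^ 0 else 0)"
    by (rule smooth_flat)
  have b1: "smooth_function (\<lambda>x. if 0 < 1 + (- 1) * x then exp (- 1 / (1 + (- 1) * x)) / (1 + (- 1) * x) ^ 0 else 0)"
    by (rule smooth_compose [OF b smooth_add [OF smooth_const smooth_mult [OF smooth_const smooth_ident]]])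
  show ?thesis
    unfolding smooth_step_def Let_def
    by (rule smooth_mult [OF b smooth_inverse [OF smooth_add [OF b b1] less_imp_neq [OF smooth_step_denominator, symmetric]]])
qed

lemma smooth_step_le_0: "x \<le> 0 \<Longrightarrow> smooth_step x = 0"
  by (simp add: smooth_step_def)

lemma smooth_step_ge_1: "1 \<le> x \<Longrightarrow> smooth_step x = 1"
  by (simp add: smooth_step_def)

lemma smooth_step_bounds: "0 \<le> smooth_step x" "smooth_step x \<le> 1"
  unfolding smooth_step_def Let_def using smooth_step_denominator [of x]
  by (auto simp: divide_simps simp flip: divide_inverse intro: add_nonneg_nonneg)

lemma deriv_smooth_step_outside:
  assumes "x < 0 \<or> 1 < x"
  shows "deriv smooth_step x = 0" "deriv (deriv smooth_step) x = 0"
proof -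
  have d1: "deriv smooth_step y = 0" if y: "y < 0 \<or> 1 < y" for y
  proof -
    consider "y < 0" | "1 < y" using y by blast
    then show ?thesis
    proof cases
      case 1
      then have "eventually (\<lambda>z. z \<in> {..<0}) (nhds y)" by (intro eventually_nhds_in_open) auto
      then have "eventually (\<lambda>z. smooth_step z = 0) (nhds y)"
        by eventually_elim (simp add: smooth_step_le_0)
      then have "deriv smooth_step y = deriv (\<lambda>_. 0) y" by (rule deriv_cong_ev) simp
      then show ?thesis by simp
    next
      case 2
      then have "eventually (\<lambda>z. z \<in> {1<..}) (nhds y)" by (intro eventually_nhds_in_open) auto
      then have "eventually (\<lambda>z. smooth_step z = 1) (nhds y)"
        by eventually_elim (simp add: smooth_step_ge_1)
      then have "deriv smooth_step y = deriv (\<lambda>_. 1) y" by (rule deriv_cong_ev) simp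
      then show ?thesis by simp
    qed
  qed
  show "deriv smooth_step x = 0" using d1 assms by blast
  have "eventually (\<lambda>z. z \<in> {..<0} \<union> {1<..}) (nhds x)"
    using assms by (intro eventually_nhds_in_open) auto
  then have "eventually (\<lambda>z. deriv smooth_step z = 0) (nhds x)"
    by eventually_elim (use d1 in auto)
  then have "deriv (deriv smooth_step) x = deriv (\<lambda>_. 0) x" by (rule deriv_cong_ev) simp
  then show "deriv (deriv smooth_step) x = 0" by simp
qed

lemma smooth_step_deriv_bounded:
  obtains S where "1 \<le> S" "\<And>x. \<bar>smooth_step x\<bar> \<le> S" "\<And>x. \<bar>deriv smooth_step x\<bar> \<le> S"
    "\<And>x. \<bar>deriv (deriv smooth_step) x\<bar> \<le> S"
proof -
  have bd: "\<exists>S. \<forall>x\<in>{0..1}. \<bar>f x\<bar> \<le> S" if "smooth_function f" for f :: "real \<Rightarrow> real"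
  proof -
    have "bounded (f ` {0..1})"
      by (intro compact_imp_bounded compact_continuous_image smooth_function_continuous that) simp
    then show ?thesis by (auto simp: bounded_iff)
  qed
  obtain S1 where S1: "\<And>x. x \<in> {0..1} \<Longrightarrow> \<bar>deriv smooth_step x\<bar> \<le> S1"
    using bd [of "deriv smooth_step"] smooth_function_deriv(1) [OF smooth_step_smooth] by blast
  obtain S2 where S2: "\<And>x. x \<in> {0..1} \<Longrightarrow> \<bar>deriv (deriv smooth_step) x\<bar> \<le> S2"
    using bd [of "deriv (deriv smooth_step)"] smooth_function_deriv(1) smooth_step_smooth by blast
  show thesis
  proof (rule that [of "max 1 (max S1 S2)"])
    fix x
    show "\<bar>smooth_step x\<bar> \<le> max 1 (max S1 S2)" using smooth_step_bounds [of x] by simp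
    show "\<bar>deriv smooth_step x\<bar> \<le> max 1 (max S1 S2)"
      using S1 [of x] deriv_smooth_step_outside(1) [of x] by (cases "x \<in> {0..1}") auto
    show "\<bar>deriv (deriv smooth_step) x\<bar> \<le> max 1 (max S1 S2)"
      using S2 [of x] deriv_smooth_step_outside(2) [of x] by (cases "x \<in> {0..1}") auto
  qed simp
qed

text \<open>
  For \<open>k \<ge> 2\<close>: rises from 0 to 1 on \<open>[1/k, 2/k]\<close> and falls back to 0 on \<open>[k, 2k]\<close>.
\<close>
definition cutoff :: "real \<Rightarrow> real \<Rightarrow> real" where
  "cutoff k x = smooth_step ((- 1) + k * x) * smooth_step (2 + (- inverse k) * x)"

lemma cutoff_smooth: "smooth_function (cutoff k)"
  unfolding cutoff_def
  by (rule smooth_mult; rule smooth_compose [OF smooth_step_smooth smooth_add];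
      (rule smooth_const | rule smooth_mult [OF smooth_const smooth_ident]))

lemma cutoff_bounds: "0 \<le> cutoff k x" "cutoff k x \<le> 1"
  using smooth_step_bounds by (auto simp: cutoff_def mult_le_one)

lemma cutoff_zero:
  assumes "0 < k"
  shows "x \<le> 1 / k \<Longrightarrow> cutoff k x = 0" and "2 * k < \<bar>x\<bar> \<Longrightarrow> cutoff k x = 0"
proof -
  show 1: "cutoff k x = 0" if "x \<le> 1 / k" for x
    using that assms by (simp add: cutoff_def smooth_step_le_0 field_simps)
  show "cutoff k x = 0" if "2 * k < \<bar>x\<bar>"
  proof (cases "x \<le> 0")
    case True
    then show ?thesis using assms 1 [of x] by (smt (verit) divide_pos_pos)
  next
    case False
    then have "2 + (- inverse k) * x \<le> 0" using that assms by (simp add: field_simps)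
    then show ?thesis by (simp add: cutoff_def smooth_step_le_0)
  qed
qed

lemma cutoff_eventually_one:
  assumes "0 < x"
  shows "\<forall>\<^sub>F k in at_top. cutoff k x = 1"
  using eventually_ge_at_top [of "2 / x"] eventually_ge_at_top [of x] eventually_gt_at_top [of 0]
proof eventually_elim
  case (elim k)
  then have "1 \<le> (- 1) + k * x" "1 \<le> 2 + (- inverse k) * x"
    using assms by (auto simp: field_simps)
  then show ?case by (simp add: cutoff_def smooth_step_ge_1)
qed

text \<open>
  The bound is uniform in \<open>k\<close> because \<open>f\<close> vanishes to second order at 0, where the second
  derivative of the cut-off is of size \<open>k\<^sup>2\<close>.
\<close>
lemma cutoff_mult_second_deriv:
  assumes f: "smooth_function f" and k: "1 \<le> k"
    and S: "1 \<le> S" "\<And>x. \<bar>smooth_step x\<bar> \<le> S" "\<And>x. \<bar>deriv smooth_step x\<bar> \<le> S"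
      "\<And>x. \<bar>deriv (deriv smooth_step) x\<bar> \<le> S"
    and C: "0 \<le> x \<Longrightarrow> \<bar>f x\<bar> \<le> C" "0 \<le> x \<Longrightarrow> \<bar>f x\<bar> \<le> C * x\<^sup>2" "0 \<le> x \<Longrightarrow> \<bar>deriv f x\<bar> \<le> C"
      "0 \<le> x \<Longrightarrow> \<bar>deriv f x\<bar> \<le> C * x" "0 \<le> x \<Longrightarrow> \<bar>deriv (deriv f) x\<bar> \<le> C"
  shows "0 \<le> x \<Longrightarrow> \<bar>(deriv ^^ 2) (\<lambda>x. cutoff k x * f x) x\<bar> \<le> 20 * S\<^sup>2 * C" 
    and "2 / k < x \<Longrightarrow> x < k \<Longrightarrow> (deriv ^^ 2) (\<lambda>x. cutoff k x * f x) x = deriv (deriv f) x"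
proof -
  note s0 = smooth_function_deriv(2) [OF smooth_step_smooth]
  note s1 = smooth_function_deriv(2) [OF smooth_function_deriv(1) [OF smooth_step_smooth]]
  note f0 = smooth_function_deriv(2) [OF f]
  note f1 = smooth_function_deriv(2) [OF smooth_function_deriv(1) [OF f]]
  \<comment> \<open>\<open>A\<close> is the rising factor of the cut-off and \<open>D\<close> the
    falling one; the digits 1 and 2 mark first and second derivatives. Only the derivatives of
    \<open>A\<close> grow with \<open>k\<close>.\<close>
  define A A1 A2 where "A x = smooth_step ((- 1) + k * x)" and "A1 x = k * deriv smooth_step ((- 1) + k * x)"
    and "A2 x = k\<^sup>2 * deriv (deriv smooth_step) ((- 1) + k * x)" for x
  define D D1 D2 where "D x = smooth_step (2 + (- inverse k) * x)"
    and "D1 x = - inverse k * deriv smooth_step (2 + (- inverse k) * x)"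
    and "D2 x = (inverse k)\<^sup>2 * deriv (deriv smooth_step) (2 + (- inverse k) * x)" for x
  have s0': "((\<lambda>x. smooth_step (a + b * x)) has_real_derivative b * deriv smooth_step (a + b * x)) (at x)"
    and s1': "((\<lambda>x. deriv smooth_step (a + b * x)) has_real_derivative b * deriv (deriv smooth_step) (a + b * x)) (at x)"
    for a b x
  proof -
    have "((\<lambda>x. a + b * x) has_real_derivative b) (at x)" by (auto intro!: derivative_eq_intros)
    from DERIV_chain2 [OF s0 this] DERIV_chain2 [OF s1 this]
    show "((\<lambda>x. smooth_step (a + b * x)) has_real_derivative b * deriv smooth_step (a + b * x)) (at x)"
      "((\<lambda>x. deriv smooth_step (a + b * x)) has_real_derivative b * deriv (deriv smooth_step) (a + b * x)) (at x)"
      by (simp_all only: mult.commute [of b "deriv _ _"])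
  qed
  have "(A has_real_derivative A1 x) (at x)" for x
    unfolding A_def A1_def by (rule s0')
  moreover have "(A1 has_real_derivative A2 x) (at x)" for x
    unfolding A1_def A2_def power2_eq_square mult.assoc by (rule DERIV_cmult [OF s1'])
  moreover have "(D has_real_derivative D1 x) (at x)" for x
    unfolding D_def D1_def by (rule s0')
  moreover have "(D1 has_real_derivative D2 x) (at x)" for x
    using DERIV_cmult [OF s1' [of 2 "- inverse k" x], of "- inverse k"]
    by (simp add: D1_def [abs_def] D2_def power2_eq_square mult.assoc)
  ultimately have AD [derivative_intros]: "(A has_real_derivative A1 x) (at x)" "(A1 has_real_derivative A2 x) (at x)"
    "(D has_real_derivative D1 x) (at x)" "(D1 has_real_derivative D2 x) (at x)" for x
    by simp_all
  define g1 where "g1 x = (A1 x * D x + A x * D1 x) * f x + A x * D x * deriv f x" for x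
  define g2 where "g2 x = (A2 x * D x + 2 * (A1 x * D1 x) + A x * D2 x) * f x
     + 2 * ((A1 x * D x + A x * D1 x) * deriv f x) + A x * D x * deriv (deriv f) x" for x
  have "((\<lambda>x. cutoff k x * f x) has_real_derivative g1 x) (at x)" for x
  proof -
    have "((\<lambda>x. A x * D x * f x) has_real_derivative g1 x) (at x)"
      by (rule DERIV_cong [OF DERIV_mult [OF DERIV_mult [OF AD(1,3)] f0]]) (simp add: g1_def algebra_simps)
    then show ?thesis by (simp add: cutoff_def A_def D_def)
  qed
  then have 1: "deriv (\<lambda>x. cutoff k x * f x) = g1" by (intro ext DERIV_imp_deriv)
  have "(g1 has_real_derivative g2 x) (at x)" for x
    unfolding g1_def
    by (rule DERIV_cong [OF DERIV_add [OF DERIV_mult [OF DERIV_add [OF DERIV_mult [OF AD(2,3)] DERIV_mult [OF AD(1,4)]] f0]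
          DERIV_mult [OF DERIV_mult [OF AD(1,3)] f1]]]) (simp add: g2_def algebra_simps)
  then have 2: "deriv g1 = g2" by (intro ext DERIV_imp_deriv)
  have eq: "(deriv ^^ 2) (\<lambda>x. cutoff k x * f x) x = g2 x"
    by (simp add: numeral_2_eq_2 1 2)
  show "(deriv ^^ 2) (\<lambda>x. cutoff k x * f x) x = deriv (deriv f) x" if "2 / k < x" "x < k"
  proof -
    have "1 < (- 1) + k * x" "1 < 2 + (- inverse k) * x" using that k by (auto simp: field_simps)
    then show ?thesis unfolding eq
      by (simp add: g2_def A_def A1_def A2_def D_def D1_def D2_def deriv_smooth_step_outside smooth_step_ge_1)
  qed
  show "\<bar>(deriv ^^ 2) (\<lambda>x. cutoff k x * f x) x\<bar> \<le> 20 * S\<^sup>2 * C" if x: "0 \<le> x"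
  proof -
    have C0: "0 \<le> C" using C(1) x by linarith
    have S2: "S \<le> S * S" using S(1) by (simp add: mult_le_cancel_left1)
    have ik: "0 < inverse k" "inverse k \<le> 1" using k by (auto simp: field_simps)
    have A: "\<bar>A x\<bar> \<le> S" "\<bar>D x\<bar> \<le> S" unfolding A_def D_def by (rule S(2))+
    have D1: "\<bar>D1 x\<bar> \<le> S"
      unfolding D1_def abs_mult using ik S(3) mult_mono [of "\<bar>- inverse k\<bar>" 1 _ S] S(1) by simp
    have D2: "\<bar>D2 x\<bar> \<le> S"
      unfolding D2_def abs_mult using ik S(4) mult_mono [of "\<bar>(inverse k)\<^sup>2\<bar>" 1 _ S] S(1)
      by (simp add: power_le_one)
    have A1z: "A1 x = 0 \<and> A2 x = 0" if "2 / k < x"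
    proof -
      have "1 < (- 1) + k * x" using that k by (auto simp: field_simps)
      then show ?thesis by (simp add: A1_def A2_def deriv_smooth_step_outside)
    qed
    have A1: "\<bar>A1 x\<bar> \<le> k * S" and A2: "\<bar>A2 x\<bar> \<le> k\<^sup>2 * S"
      unfolding A1_def A2_def abs_mult using k S by (simp_all add: mult_left_mono)
    \<comment> \<open>Where derivatives of the rising factor can be nonzero,
      \<open>k * x \<le> 2\<close>; so each power of \<open>k\<close> they carry is absorbed by a
      power of \<open>x\<close> from the bounds on \<open>f\<close> and its derivative.\<close>
    have xk: "k * x \<le> 2" if "x \<le> 2 / k" using that k by (simp add: field_simps)
    have A2f: "\<bar>A2 x * f x\<bar> \<le> 4 * S * C"
    proof (cases "x \<le> 2 / k")
      case True
      have "\<bar>A2 x * f x\<bar> \<le> (k\<^sup>2 * S) * (C * x\<^sup>2)"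
        unfolding abs_mult using A2 C(2) x S(1) k by (intro mult_mono) auto
      also have "\<dots> = (k * x)\<^sup>2 * (S * C)" by (simp add: power_mult_distrib)
      also have "\<dots> \<le> 2\<^sup>2 * (S * C)"
        using xk [OF True] x k S(1) C0 by (intro mult_right_mono power_mono) auto
      finally show ?thesis by simp
    qed (use A1z S(1) C0 in auto)
    have A1f: "\<bar>A1 x * deriv f x\<bar> \<le> 2 * S * C"
    proof (cases "x \<le> 2 / k")
      case True
      have "\<bar>A1 x * deriv f x\<bar> \<le> (k * S) * (C * x)"
        unfolding abs_mult using A1 C(4) x S(1) k by (intro mult_mono) auto
      also have "\<dots> = (k * x) * (S * C)" by simp
      also have "\<dots> \<le> 2 * (S * C)"
        using xk [OF True] S(1) C0 by (intro mult_right_mono) auto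
      finally show ?thesis by simp
    qed (use A1z S(1) C0 in auto)
    have A0f: "\<bar>A1 x * f x\<bar> \<le> 4 * S * C"
    proof (cases "x \<le> 2 / k")
      case True
      have "\<bar>A1 x * f x\<bar> \<le> (k * S) * (C * x\<^sup>2)"
        unfolding abs_mult using A1 C(2) x S(1) k by (intro mult_mono) auto
      also have "\<dots> \<le> (k * S) * (C * (k * x\<^sup>2))"
        using k S(1) C0 mult_right_mono [of 1 k "x\<^sup>2"] by (intro mult_left_mono) auto
      also have "\<dots> = (k * x)\<^sup>2 * (S * C)" by (simp add: power2_eq_square)
      also have "\<dots> \<le> 2\<^sup>2 * (S * C)"
        using xk [OF True] x k S(1) C0 by (intro mult_right_mono power_mono) auto
      finally show ?thesis by simp
    qed (use A1z S(1) C0 in auto)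
    have b: "\<bar>p * q\<bar> \<le> c * S * C * S" if "\<bar>p\<bar> \<le> c * S * C" "\<bar>q\<bar> \<le> S" for p q c :: real
      unfolding abs_mult using that by (intro mult_mono) (auto intro: order_trans [OF abs_ge_zero])
    have b3: "\<bar>p * q * r\<bar> \<le> S * S * C" if "\<bar>p\<bar> \<le> S" "\<bar>q\<bar> \<le> S" "\<bar>r\<bar> \<le> C" for p q r :: real
      unfolding abs_mult using that S(1) by (intro mult_mono) auto
    have t1: "\<bar>(A2 x * f x) * D x\<bar> \<le> 4 * S * C * S" by (rule b [OF A2f A(2)])
    have t2: "\<bar>(A1 x * f x) * D1 x\<bar> \<le> 4 * S * C * S" by (rule b [OF A0f D1])
    have t3: "\<bar>A x * D2 x * f x\<bar> \<le> S * S * C" by (rule b3 [OF A(1) D2 C(1) [OF x]])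
    have t4: "\<bar>(A1 x * deriv f x) * D x\<bar> \<le> 2 * S * C * S" by (rule b [OF A1f A(2)])
    have t5: "\<bar>A x * D1 x * deriv f x\<bar> \<le> S * S * C" by (rule b3 [OF A(1) D1 C(3) [OF x]])
    have t6: "\<bar>A x * D x * deriv (deriv f) x\<bar> \<le> S * S * C" by (rule b3 [OF A(1) A(2) C(5) [OF x]])
    have "g2 x = (A2 x * f x) * D x + 2 * ((A1 x * f x) * D1 x) + A x * D2 x * f x
        + 2 * ((A1 x * deriv f x) * D x) + 2 * (A x * D1 x * deriv f x) + A x * D x * deriv (deriv f) x"
      by (simp add: g2_def algebra_simps)
    \<comment> \<open>The six products contribute 4 + 8 + 1 + 4 + 2 + 1 = 20 times S^2 C.\<close>
    then have "\<bar>g2 x\<bar> \<le> 4 * S * C * S + 2 * (4 * S * C * S) + S * S * C + 2 * (2 * S * C * S) + 2 * (S * S * C) + S * S * C"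
      using t1 t2 t3 t4 t5 t6 by linarith
    also have "\<dots> = 20 * S\<^sup>2 * C" by (simp add: power2_eq_square algebra_simps)
    finally show ?thesis unfolding eq .
  qed
qed

section \<open>The law of the folded solution\<close>

lemma (in prob_space) integrable_bounded_compose:
  fixes f :: "real \<Rightarrow> real"
  assumes [measurable]: "X \<in> borel_measurable M" "f \<in> borel_measurable borel"
    and X: "\<And>\<omega>. \<omega> \<in> space M \<Longrightarrow> 0 \<le> X \<omega>" and B: "\<And>x. 0 \<le> x \<Longrightarrow> \<bar>f x\<bar> \<le> B"
  shows "integrable M (\<lambda>\<omega>. f (X \<omega>))" and "\<bar>\<integral>\<omega>. f (X \<omega>) \<partial>M\<bar> \<le> B"
proof -
  show i: "integrable M (\<lambda>\<omega>. f (X \<omega>))"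
    by (rule integrable_const_bound [of _ B]) (use X B in auto)
  have "\<bar>\<integral>\<omega>. f (X \<omega>) \<partial>M\<bar> \<le> (\<integral>\<omega>. \<bar>f (X \<omega>)\<bar> \<partial>M)" by (rule integral_abs_bound)
  also have "\<dots> \<le> B" by (rule integral_le_const) (use i X B in auto)
  finally show "\<bar>\<integral>\<omega>. f (X \<omega>) \<partial>M\<bar> \<le> B" .
qed

text \<open>A tightness argument. Replacing \<open>f\<close> by \<open>g k * f\<close> costs at most
  \<open>B\<close> times the lost mass \<open>1 - E g k (X t)\<close>; this mass is small at
  \<open>t0\<close> for large \<open>k\<close>, and for that fixed \<open>k\<close> it stays small
  near \<open>t0\<close> because it is continuous in time.\<close>

lemma (in prob_space) tendsto_expectation_cutoff:
  fixes f :: "real \<Rightarrow> real" and X :: "real \<Rightarrow> 'a \<Rightarrow> real"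
  assumes X: "\<And>t. 0 \<le> t \<Longrightarrow> X t \<in> borel_measurable M" "\<And>t \<omega>. 0 \<le> t \<Longrightarrow> \<omega> \<in> space M \<Longrightarrow> 0 \<le> X t \<omega>"
    and t0: "0 < t0"
    and f: "f \<in> borel_measurable borel" "\<And>x. 0 \<le> x \<Longrightarrow> \<bar>f x\<bar> \<le> B"
    and g: "\<And>k. g k \<in> borel_measurable borel" "\<And>k x. 0 \<le> x \<Longrightarrow> 0 \<le> g k x" "\<And>k x. 0 \<le> x \<Longrightarrow> g k x \<le> 1"
    and lg: "\<And>k :: nat. ((\<lambda>t. \<integral>\<omega>. g k (X t \<omega>) \<partial>M) \<longlongrightarrow> (\<integral>\<omega>. g k (X t0 \<omega>) \<partial>M)) (at t0)"
    and lfg: "\<And>k. ((\<lambda>t. \<integral>\<omega>. g k (X t \<omega>) * f (X t \<omega>) \<partial>M) \<longlongrightarrow> (\<integral>\<omega>. g k (X t0 \<omega>) * f (X t0 \<omega>) \<partial>M)) (at t0)"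
    and g1: "(\<lambda>k. \<integral>\<omega>. g k (X t0 \<omega>) \<partial>M) \<longlonglongrightarrow> 1"
  shows "((\<lambda>t. \<integral>\<omega>. f (X t \<omega>) \<partial>M) \<longlongrightarrow> (\<integral>\<omega>. f (X t0 \<omega>) \<partial>M)) (at t0)"
proof (rule tendstoI)
  fix e :: real assume e: "0 < e"
  have B0: "0 \<le> B" using f(2) [of 0] by linarith
  \<comment> \<open>Chosen so that the errors \<open>B * d\<close>, \<open>d\<close> and
    \<open>B * d\<close> add up to \<open>e / 2\<close>.\<close>
  define d where "d = e / (4 * B + 2)"
  have d: "0 < d" using e B0 by (simp add: d_def)
  have "\<forall>\<^sub>F k in sequentially. dist (\<integral>\<omega>. g k (X t0 \<omega>) \<partial>M) 1 < d / 2"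
    using tendstoD [OF g1, of "d / 2"] d by simp
  then obtain k where k: "dist (\<integral>\<omega>. g k (X t0 \<omega>) \<partial>M) 1 < d / 2"
    by (meson eventually_sequentially order_refl)
  have diff: "\<bar>(\<integral>\<omega>. f (X t \<omega>) \<partial>M) - (\<integral>\<omega>. g k (X t \<omega>) * f (X t \<omega>) \<partial>M)\<bar>
      \<le> B * (1 - (\<integral>\<omega>. g k (X t \<omega>) \<partial>M))" if t: "0 < t" for t
  proof -
    have m: "X t \<in> borel_measurable M" "\<And>\<omega>. \<omega> \<in> space M \<Longrightarrow> 0 \<le> X t \<omega>" using X t by auto
    have i1: "integrable M (\<lambda>\<omega>. f (X t \<omega>))" by (rule integrable_bounded_compose(1) [OF m(1) f(1) m(2) f(2)])
    have i2: "integrable M (\<lambda>\<omega>. g k (X t \<omega>))"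
      by (rule integrable_bounded_compose(1) [OF m(1) g(1) m(2), of _ 1]) (use g in auto)
    have i3: "integrable M (\<lambda>\<omega>. g k (X t \<omega>) * f (X t \<omega>))"
      by (rule integrable_bounded_compose(1) [OF m(1) _ m(2), of "\<lambda>x. g k x * f x" B])
        (use f g mult_mono [of "g k _" 1 "\<bar>f _\<bar>" B] in \<open>auto simp: abs_mult\<close>)
    have "(\<integral>\<omega>. f (X t \<omega>) \<partial>M) - (\<integral>\<omega>. g k (X t \<omega>) * f (X t \<omega>) \<partial>M)
        = (\<integral>\<omega>. (1 - g k (X t \<omega>)) * f (X t \<omega>) \<partial>M)"
      using i1 i3 by (simp add: left_diff_distrib)
    also have "\<bar>\<dots>\<bar> \<le> (\<integral>\<omega>. \<bar>(1 - g k (X t \<omega>)) * f (X t \<omega>)\<bar> \<partial>M)"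
      by (rule integral_abs_bound)
    also have "\<dots> \<le> (\<integral>\<omega>. B * (1 - g k (X t \<omega>)) \<partial>M)"
    proof (rule integral_mono)
      show "integrable M (\<lambda>\<omega>. \<bar>(1 - g k (X t \<omega>)) * f (X t \<omega>)\<bar>)"
        using i1 i3 by (simp add: left_diff_distrib)
      show "integrable M (\<lambda>\<omega>. B * (1 - g k (X t \<omega>)))" using i2 by simp
      show "\<bar>(1 - g k (X t \<omega>)) * f (X t \<omega>)\<bar> \<le> B * (1 - g k (X t \<omega>))" if "\<omega> \<in> space M" for \<omega>
        using f(2) [OF m(2) [OF that]] g(3) [OF m(2) [OF that], of k]
          mult_left_mono [of "\<bar>f (X t \<omega>)\<bar>" B "1 - g k (X t \<omega>)"]
        by (simp add: abs_mult mult.commute)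
    qed
    also have "(\<integral>\<omega>. B * (1 - g k (X t \<omega>)) \<partial>M) = B * (1 - (\<integral>\<omega>. g k (X t \<omega>) \<partial>M))"
      using i2 by (simp add: prob_space)
    finally show ?thesis .
  qed
  show "\<forall>\<^sub>F t in at t0. dist (\<integral>\<omega>. f (X t \<omega>) \<partial>M) (\<integral>\<omega>. f (X t0 \<omega>) \<partial>M) < e"
  proof -
    have "0 < d / 2" using d by simp
    note tendstoD [OF lg this, of k] tendstoD [OF lfg d, of k]
    moreover have "\<forall>\<^sub>F t in at t0. t \<in> {0<..}" using t0 by (intro eventually_at_in_open') auto
    ultimately show ?thesis
    proof eventually_elim
      case (elim t)
      have "1 - (\<integral>\<omega>. g k (X t \<omega>) \<partial>M) \<le> d"
        using elim(1) k unfolding dist_real_def by linarith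
      then have "B * (1 - (\<integral>\<omega>. g k (X t \<omega>) \<partial>M)) \<le> B * d"
        using B0 by (rule mult_left_mono)
      moreover have "1 - (\<integral>\<omega>. g k (X t0 \<omega>) \<partial>M) \<le> d"
        using k d unfolding dist_real_def by linarith
      then have "B * (1 - (\<integral>\<omega>. g k (X t0 \<omega>) \<partial>M)) \<le> B * d"
        using B0 by (rule mult_left_mono)
      ultimately have "dist (\<integral>\<omega>. f (X t \<omega>) \<partial>M) (\<integral>\<omega>. f (X t0 \<omega>) \<partial>M) < B * d + d + B * d"
        using diff [of t] diff [OF t0] elim(2) elim(3) unfolding dist_real_def greaterThan_iff by linarith
      also have "\<dots> = d * (2 * B + 1)" by (simp add: algebra_simps)
      also have "\<dots> = e / 2" using B0 by (simp add: d_def field_simps)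
      finally show ?case using e by simp
    qed
  qed
qed

lemma smooth_function_measurable: "smooth_function f \<Longrightarrow> f \<in> borel_measurable borel"
  by (rule borel_measurable_continuous_onI [OF smooth_function_continuous])

lemma deriv_iterate_zero_on_open:
  fixes f :: "real \<Rightarrow> real"
  assumes "open S" "\<And>x. x \<in> S \<Longrightarrow> f x = 0" "x \<in> S"
  shows "(deriv ^^ k) f x = 0"
  using assms(3)
proof (induction k arbitrary: x)
  case 0
  then show ?case using assms(2) by simp
next
  case (Suc k)
  have "eventually (\<lambda>y. y \<in> S) (nhds x)" by (rule eventually_nhds_in_open [OF assms(1) Suc.prems])
  then have "eventually (\<lambda>y. (deriv ^^ k) f y = 0) (nhds x)"
    by eventually_elim (rule Suc.IH)
  then have "deriv ((deriv ^^ k) f) x = deriv (\<lambda>_. 0) x" by (rule deriv_cong_ev) simp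
  then show ?case by simp
qed

text \<open>The value 1 of \<open>\<alpha>\<close> is left out because the law is then a point mass
  without density; \<open>folded_process_expectation\<close> treats it directly.\<close>

locale folded_law = prob_space M for M :: "'a measure" +
  fixes \<alpha> :: real and T :: "real \<Rightarrow> 'a \<Rightarrow> real" and u :: "real \<Rightarrow> real \<Rightarrow> real"
  assumes alpha: "0 < \<alpha>" "\<alpha> < 1"
    and T_measurable: "0 \<le> t \<Longrightarrow> T t \<in> borel_measurable M"
    and T_nonneg: "0 \<le> t \<Longrightarrow> \<omega> \<in> space M \<Longrightarrow> 0 \<le> T t \<omega>"
    and cauchy: "solves_fractional_cauchy \<alpha> u"
    and u_nonneg: "0 < t \<Longrightarrow> 0 \<le> x \<Longrightarrow> 0 \<le> u x t"
    and density: "0 < t \<Longrightarrow> distributed M lborel (T t) (\<lambda>x. ennreal (if 0 \<le> x then 2 * u x t else 0))"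
begin

text \<open>The cut-offs vanish at 0, so an atom of the law there would be lost when they are
  removed.\<close>

lemma T_pos:
  assumes "0 < t"
  shows "AE \<omega> in M. 0 < T t \<omega>"
proof -
  have Tm: "T t \<in> borel_measurable M" using assms T_measurable by simp
  have "emeasure M (T t -` {0} \<inter> space M) = (\<integral>\<^sup>+x. ennreal (if 0 \<le> x then 2 * u x t else 0) * indicator {0} x \<partial>lborel)"
    by (rule distributed_emeasure [OF density [OF assms]]) simp
  also have "\<dots> = (\<integral>\<^sup>+x. 0 \<partial>(lborel :: real measure))"
    by (rule nn_integral_cong_AE) (use AE_lborel_singleton [of "0 :: real"] in \<open>eventually_elim, simp\<close>)
  finally have "T t -` {0} \<inter> space M \<in> null_sets M"
    using measurable_sets [OF Tm, of "{0}"] by (auto simp: null_sets_def)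
  then have "AE \<omega> in M. \<omega> \<notin> T t -` {0} \<inter> space M" by (rule AE_not_in)
  then show ?thesis
    using AE_space
  proof eventually_elim
    case (elim \<omega>)
    then show ?case using T_nonneg [of t \<omega>] assms by (simp add: less_le)
  qed
qed

text \<open>The factor 1/2 undoes the folding. The test function has to vanish on the negative
  half-line, where the law says nothing about \<open>u\<close>.\<close>

lemma pairing_expectation:
  assumes "0 < t" and [measurable]: "\<phi> \<in> borel_measurable borel" and z: "\<And>x. x < 0 \<Longrightarrow> \<phi> x = 0"
  shows "(LINT x|lborel. u x t * \<phi> x) = (\<integral>\<omega>. \<phi> (T t \<omega>) \<partial>M) / 2"
proof -
  have "(\<integral>\<omega>. \<phi> (T t \<omega>) \<partial>M) = (\<integral>x. (if 0 \<le> x then 2 * u x t else 0) * \<phi> x \<partial>lborel)"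
    by (rule distributed_integral [OF density [OF assms(1)], symmetric]) (use u_nonneg assms(1) in auto)
  also have "\<dots> = (\<integral>x. 2 * (u x t * \<phi> x) \<partial>lborel)"
    by (rule Bochner_Integration.integral_cong) (use z in auto)
  finally show ?thesis by simp
qed

lemma pairing_continuous:
  assumes "test_function \<phi>"
  shows "continuous_on {0..} (pairing u \<phi>)"
proof -
  have "0 < nat \<lceil>2 * \<alpha>\<rceil>" using alpha by simp
  have "has_caputo_deriv (2 * \<alpha>) (pairing u \<phi>) (\<lambda>t. LINT x|lborel. u x t * (deriv ^^ 2) \<phi> x)"
    using cauchy assms by (simp add: solves_fractional_cauchy_def)
  then obtain G where "G 0 = pairing u \<phi>" "\<forall>k<nat \<lceil>2 * \<alpha>\<rceil>. continuous_on {0..} (G k)"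
    unfolding has_caputo_deriv_def Let_def by blast
  with \<open>0 < nat \<lceil>2 * \<alpha>\<rceil>\<close> show ?thesis by (metis (no_types))
qed

lemma expectation_test_continuous:
  assumes \<phi>: "smooth_function \<phi>" "\<And>x. R < \<bar>x\<bar> \<Longrightarrow> \<phi> x = 0" "\<And>x. x < 0 \<Longrightarrow> \<phi> x = 0"
  shows "continuous_on {0<..} (\<lambda>t. \<integral>\<omega>. \<phi> (T t \<omega>) \<partial>M)"
proof -
  have m: "\<phi> \<in> borel_measurable borel"
    by (rule smooth_function_measurable [OF \<phi>(1)])
  have "continuous_on {0<..} (pairing u \<phi>)"
    using pairing_continuous [OF test_functionI [OF \<phi>(1,2)]] by (rule continuous_on_subset) auto
  then have "continuous_on {0<..} (\<lambda>t. 2 * pairing u \<phi> t)" by (intro continuous_intros)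
  then show ?thesis
  proof (rule continuous_on_eq)
    fix t :: real assume "t \<in> {0<..}"
    then show "2 * pairing u \<phi> t = (\<integral>\<omega>. \<phi> (T t \<omega>) \<partial>M)"
      using pairing_expectation [OF _ m \<phi>(3), of t] by (simp add: pairing_def mult.commute)
  qed
qed

text \<open>With support in \<open>x \<ge> \<epsilon>\<close> the test function has value 0 at the
  origin, so the Dirac initial condition contributes nothing, and both pairings are half the
  expectations under the folded law.\<close>

lemma laplace_expectation_test:
  assumes \<phi>: "smooth_function \<phi>" "\<And>x. R < \<bar>x\<bar> \<Longrightarrow> \<phi> x = 0" and eps: "0 < \<epsilon>" "\<And>x. x < \<epsilon> \<Longrightarrow> \<phi> x = 0"
    and z: "0 < z"
  shows "laplace z (\<lambda>t. \<integral>\<omega>. \<phi> (T t \<omega>) \<partial>M)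
       = z powr (- (2 * \<alpha>)) * laplace z (\<lambda>t. \<integral>\<omega>. (deriv ^^ 2) \<phi> (T t \<omega>) \<partial>M)"
proof -
  let ?\<psi> = "(deriv ^^ 2) \<phi>"
  have \<psi>: "smooth_function ?\<psi>" by (rule smooth_function_iterate [OF \<phi>(1)])
  have \<psi>R: "?\<psi> x = 0" if "R < \<bar>x\<bar>" for x
  proof (rule deriv_iterate_zero_on_open [where S = "{x. R < \<bar>x\<bar>}"])
    show "open {x :: real. R < \<bar>x\<bar>}" by (intro open_Collect_less continuous_intros)
  qed (use that \<phi>(2) in auto)
  have \<psi>0: "?\<psi> x = 0" if "x < \<epsilon>" for x
    by (rule deriv_iterate_zero_on_open [where S = "{..<\<epsilon>}"]) (use that eps in auto)
  have m\<phi>: "\<phi> \<in> borel_measurable borel" and m\<psi>: "?\<psi> \<in> borel_measurable borel"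
    by (rule smooth_function_measurable [OF \<phi>(1)], rule smooth_function_measurable [OF \<psi>])
  define h where "h t = (LINT x|lborel. u x t * ?\<psi> x)" for t
  have h: "h t = (\<integral>\<omega>. ?\<psi> (T t \<omega>) \<partial>M) / 2" if "0 < t" for t
    unfolding h_def by (rule pairing_expectation [OF that m\<psi>]) (use \<psi>0 eps in auto)
  have C: "has_caputo_deriv (2 * \<alpha>) (pairing u \<phi>) h"
    and g0: "1 < 2 * \<alpha> \<Longrightarrow> (pairing u \<phi> has_real_derivative 0) (at 0 within {0..})"
    using cauchy test_functionI [OF \<phi>] unfolding h_def by (simp_all add: solves_fractional_cauchy_def)
  have "continuous_on {0<..} (\<lambda>t. \<integral>\<omega>. ?\<psi> (T t \<omega>) \<partial>M)"
    by (rule expectation_test_continuous [OF \<psi> \<psi>R]) (use \<psi>0 eps in auto)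
  then have "continuous_on {0<..} (\<lambda>t. (\<integral>\<omega>. ?\<psi> (T t \<omega>) \<partial>M) / 2)" by (intro continuous_intros) auto
  then have "continuous_on {0<..} h"
    by (rule continuous_on_eq) (simp add: h)
  then have hm: "(\<lambda>t. indicator {0<..} t * h t) \<in> borel_measurable borel"
    by (rule borel_measurable_indicator_continuous)
  have "bounded (?\<psi> ` {- R..R})"
    by (intro compact_imp_bounded compact_continuous_image smooth_function_continuous \<psi>) simp
  then obtain B where B: "\<forall>x\<in>{- R..R}. \<bar>?\<psi> x\<bar> \<le> B"
    unfolding bounded_iff by auto
  have B': "\<bar>?\<psi> x\<bar> \<le> \<bar>B\<bar>" for x
  proof (cases "R < \<bar>x\<bar>")
    case False
    then have "x \<in> {- R..R}" by auto
    then show ?thesis using B by force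
  qed (simp add: \<psi>R)
  have hB: "\<bar>h t\<bar> \<le> \<bar>B\<bar>" if "0 < t" for t
    using integrable_bounded_compose(2) [OF T_measurable m\<psi> T_nonneg B', of t] h [OF that] that by simp
  have "laplace z (pairing u \<phi>) = pairing u \<phi> 0 / z + z powr (- (2 * \<alpha>)) * laplace z h"
    using alpha by (intro laplace_caputo [OF _ _ z C hm hB g0]) auto
  moreover have "pairing u \<phi> 0 = 0" using eps by (simp add: pairing_def)
  moreover have "laplace z (pairing u \<phi>) = laplace z (\<lambda>t. 1 / 2 * (\<integral>\<omega>. \<phi> (T t \<omega>) \<partial>M))"
    by (rule laplace_cong) (use pairing_expectation [OF _ m\<phi>] eps in \<open>simp add: pairing_def\<close>)
  moreover have "laplace z h = laplace z (\<lambda>t. 1 / 2 * (\<integral>\<omega>. ?\<psi> (T t \<omega>) \<partial>M))"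
    by (rule laplace_cong) (simp add: h)
  ultimately show ?thesis unfolding laplace_cmult by simp
qed

lemma expectation_cutoff_tendsto:
  assumes "0 < t" and [measurable]: "f \<in> borel_measurable borel" and B: "\<And>x. 0 \<le> x \<Longrightarrow> \<bar>f x\<bar> \<le> B"
  shows "(\<lambda>k. \<integral>\<omega>. cutoff (real (Suc k)) (T t \<omega>) * f (T t \<omega>) \<partial>M) \<longlonglongrightarrow> (\<integral>\<omega>. f (T t \<omega>) \<partial>M)"
proof (rule integral_dominated_convergence [where w = "\<lambda>_. B"])
  have [measurable]: "T t \<in> borel_measurable M" using assms T_measurable by simp
  have [measurable]: "cutoff k \<in> borel_measurable borel" for k
    by (rule smooth_function_measurable [OF cutoff_smooth])
  show "(\<lambda>\<omega>. f (T t \<omega>)) \<in> borel_measurable M" by measurable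
  show "(\<lambda>\<omega>. cutoff (real (Suc k)) (T t \<omega>) * f (T t \<omega>)) \<in> borel_measurable M" for k by measurable
  show "AE \<omega> in M. norm (cutoff (real (Suc k)) (T t \<omega>) * f (T t \<omega>)) \<le> B" for k
  proof (rule AE_I2)
    fix \<omega> assume "\<omega> \<in> space M"
    then have "\<bar>f (T t \<omega>)\<bar> \<le> B" using B T_nonneg assms(1) by simp
    then show "norm (cutoff (real (Suc k)) (T t \<omega>) * f (T t \<omega>)) \<le> B"
      using mult_mono [of "cutoff (real (Suc k)) (T t \<omega>)" 1 "\<bar>f (T t \<omega>)\<bar>" B] cutoff_bounds
      by (simp add: abs_mult)
  qed
  show "AE \<omega> in M. (\<lambda>k. cutoff (real (Suc k)) (T t \<omega>) * f (T t \<omega>)) \<longlonglongrightarrow> f (T t \<omega>)"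
    using T_pos [OF assms(1)]
  proof eventually_elim
    case (elim \<omega>)
    have "filterlim (\<lambda>k. real (Suc k)) at_top sequentially"
      by (rule filterlim_compose [OF filterlim_real_sequentially filterlim_Suc])
    then have "\<forall>\<^sub>F k in sequentially. cutoff (real (Suc k)) (T t \<omega>) = 1"
      using cutoff_eventually_one [OF elim] by (auto simp: filterlim_iff)
    then have "\<forall>\<^sub>F k in sequentially. cutoff (real (Suc k)) (T t \<omega>) * f (T t \<omega>) = f (T t \<omega>)"
      by eventually_elim simp
    then show ?case by (rule tendsto_eventually)
  qed
qed simp

text \<open>The cut-offs serve as \<open>g\<close> in the tightness lemma: their products with
  smooth functions are test functions, whose expectations are continuous in time by the Cauchy
  problem.\<close>

lemma expectation_smooth_continuous:
  assumes f: "smooth_function f" and B: "\<And>x. 0 \<le> x \<Longrightarrow> \<bar>f x\<bar> \<le> B" and "0 < t"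
  shows "((\<lambda>t. \<integral>\<omega>. f (T t \<omega>) \<partial>M) \<longlongrightarrow> (\<integral>\<omega>. f (T t \<omega>) \<partial>M)) (at t)"
proof -
  have c: "((\<lambda>t. \<integral>\<omega>. cutoff (real (Suc k)) (T t \<omega>) * g (T t \<omega>) \<partial>M)
      \<longlongrightarrow> (\<integral>\<omega>. cutoff (real (Suc k)) (T t \<omega>) * g (T t \<omega>) \<partial>M)) (at t)"
    if "smooth_function g" for g k
  proof -
    have "continuous_on {0<..} (\<lambda>t. \<integral>\<omega>. (\<lambda>x. cutoff (real (Suc k)) x * g x) (T t \<omega>) \<partial>M)"
    proof (rule expectation_test_continuous)
      show "smooth_function (\<lambda>x. cutoff (real (Suc k)) x * g x)"
        by (rule smooth_mult [OF cutoff_smooth that])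
      show "cutoff (real (Suc k)) x * g x = 0" if "2 * real (Suc k) < \<bar>x\<bar>" for x
        using cutoff_zero(2) [of "real (Suc k)" x] that by simp
      show "cutoff (real (Suc k)) x * g x = 0" if "x < 0" for x
        using cutoff_zero(1) [of "real (Suc k)" x] that by (simp add: order_trans [of x 0])
    qed
    then have "isCont (\<lambda>t. \<integral>\<omega>. cutoff (real (Suc k)) (T t \<omega>) * g (T t \<omega>) \<partial>M) t"
      using \<open>0 < t\<close> by (simp add: continuous_on_eq_continuous_at)
    then show ?thesis by (simp add: isCont_def)
  qed
  have m: "f \<in> borel_measurable borel" "\<And>k. cutoff k \<in> borel_measurable borel"
    by (rule smooth_function_measurable [OF f], rule smooth_function_measurable [OF cutoff_smooth])
  show ?thesis
  proof (rule tendsto_expectation_cutoff [where g = "\<lambda>k. cutoff (real (Suc k))", OF T_measurable T_nonneg \<open>0 < t\<close> m(1) B m(2)])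
    show "((\<lambda>t. \<integral>\<omega>. cutoff (real (Suc k)) (T t \<omega>) \<partial>M) \<longlongrightarrow> (\<integral>\<omega>. cutoff (real (Suc k)) (T t \<omega>) \<partial>M)) (at t)" for k
      using c [OF smooth_const [of 1]] by simp
    show "((\<lambda>t. \<integral>\<omega>. cutoff (real (Suc k)) (T t \<omega>) * f (T t \<omega>) \<partial>M)
        \<longlongrightarrow> (\<integral>\<omega>. cutoff (real (Suc k)) (T t \<omega>) * f (T t \<omega>) \<partial>M)) (at t)" for k by (rule c [OF f])
    show "(\<lambda>k. \<integral>\<omega>. cutoff (real (Suc k)) (T t \<omega>) \<partial>M) \<longlonglongrightarrow> 1"
      using expectation_cutoff_tendsto [OF \<open>0 < t\<close>, of "\<lambda>_. 1" 1] by (simp add: prob_space)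
  qed (use cutoff_bounds in simp_all)
qed

end

lemma laplace_tendsto:
  fixes f :: "nat \<Rightarrow> real \<Rightarrow> real"
  assumes z: "0 < z" and m: "\<And>k. (\<lambda>t. indicator {0<..} t * f k t) \<in> borel_measurable borel"
    and B: "\<And>k t. 0 < t \<Longrightarrow> \<bar>f k t\<bar> \<le> B" and l: "\<And>t. 0 < t \<Longrightarrow> (\<lambda>k. f k t) \<longlonglongrightarrow> g t"
  shows "(\<lambda>k. laplace z (f k)) \<longlonglongrightarrow> laplace z g"
  unfolding laplace_def
proof (rule integral_dominated_convergence [where w = "\<lambda>t. B * (indicator {0<..} t * exp (- z * t))"])
  have l': "(\<lambda>k. indicator {0<..} t * exp (- z * t) * f k t) \<longlonglongrightarrow> indicator {0<..} t * exp (- z * t) * g t" for t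
    using l [of t] by (cases "0 < t") (auto intro: tendsto_mult_left)
  then show "AE t in lborel. (\<lambda>k. indicator {0<..} t * exp (- z * t) * f k t) \<longlonglongrightarrow> indicator {0<..} t * exp (- z * t) * g t"
    by (intro AE_I2)
  show m': "(\<lambda>t. indicator {0<..} t * exp (- z * t) * f k t) \<in> borel_measurable lborel" for k
    using laplace_integrable_bounded [OF z m B] by (rule borel_measurable_integrable)
  show "(\<lambda>t. indicator {0<..} t * exp (- z * t) * g t) \<in> borel_measurable lborel"
    by (rule borel_measurable_LIMSEQ_real [OF l' m'])
  show "integrable lborel (\<lambda>t. B * (indicator {0<..} t * exp (- z * t)))"
    using exp_indicator_integrable [OF z] by (auto simp: has_bochner_integral_iff)
  show "AE t in lborel. norm (indicator {0<..} t * exp (- z * t) * f k t) \<le> B * (indicator {0<..} t * exp (- z * t))" for k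
  proof (rule AE_I2)
    fix t show "norm (indicator {0<..} t * exp (- z * t) * f k t) \<le> B * (indicator {0<..} t * exp (- z * t))"
      using B [of t k] by (cases "0 < t") (simp_all add: abs_mult mult.commute)
  qed
qed

lemma smooth_exp_linear: "smooth_function (\<lambda>x. exp (c * x))"
  by (rule smooth_compose [OF smooth_exp smooth_mult [OF smooth_const smooth_ident]])

lemma exp_minus_bounds:
  fixes y :: real
  assumes "0 \<le> y"
  shows "\<bar>exp (- y) - 1\<bar> \<le> y" "\<bar>exp (- y) - 1 + y\<bar> \<le> y\<^sup>2"
proof -
  have l: "1 - y \<le> exp (- y)" using exp_ge_add_one_self [of "- y"] by simp
  have u: "exp (- y) \<le> 1" using assms by simp
  show "\<bar>exp (- y) - 1\<bar> \<le> y" using l u by simp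
  have "0 < 1 + y" using assms by simp
  have "exp (- y) \<le> 1 / (1 + y)"
    using exp_ge_add_one_self [of y] \<open>0 < 1 + y\<close> by (simp add: exp_minus field_simps)
  also have "\<dots> \<le> 1 - y + y\<^sup>2"
  proof -
    have "(1 - y + y\<^sup>2) * (1 + y) = 1 + y ^ 3" by (simp add: algebra_simps power2_eq_square power3_eq_cube)
    then show ?thesis using \<open>0 < 1 + y\<close> assms by (simp add: pos_divide_le_eq)
  qed
  finally show "\<bar>exp (- y) - 1 + y\<bar> \<le> y\<^sup>2" using l by simp
qed

context folded_law
begin

lemma expectation_exp:
  assumes "0 \<le> s"
  shows "0 < t \<Longrightarrow> \<bar>\<integral>\<omega>. exp (- s * T t \<omega>) \<partial>M\<bar> \<le> 1"
    and "(\<lambda>t. indicator {0<..} t * (\<integral>\<omega>. exp (- s * T t \<omega>) \<partial>M)) \<in> borel_measurable borel"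
    and "0 < t \<Longrightarrow> integrable M (\<lambda>\<omega>. exp (- s * T t \<omega>))"
    and "0 < t \<Longrightarrow> ((\<lambda>t. \<integral>\<omega>. exp (- s * T t \<omega>) \<partial>M) \<longlongrightarrow> (\<integral>\<omega>. exp (- s * T t \<omega>) \<partial>M)) (at t)"
proof -
  have b: "\<bar>exp (- s * x)\<bar> \<le> 1" if "0 \<le> x" for x using assms that by simp
  have m: "(\<lambda>x. exp (- s * x)) \<in> borel_measurable borel" by measurable
  show "0 < t \<Longrightarrow> \<bar>\<integral>\<omega>. exp (- s * T t \<omega>) \<partial>M\<bar> \<le> 1"
    by (rule integrable_bounded_compose(2) [OF T_measurable m T_nonneg b]) simp_all
  show "0 < t \<Longrightarrow> integrable M (\<lambda>\<omega>. exp (- s * T t \<omega>))"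
    by (rule integrable_bounded_compose(1) [OF T_measurable m T_nonneg b]) simp_all
  show c: "((\<lambda>t. \<integral>\<omega>. exp (- s * T t \<omega>) \<partial>M) \<longlongrightarrow> (\<integral>\<omega>. exp (- s * T t \<omega>) \<partial>M)) (at t)" if "0 < t" for t
    by (rule expectation_smooth_continuous [OF smooth_exp_linear b that])
  have "continuous_on {0<..} (\<lambda>t. \<integral>\<omega>. exp (- s * T t \<omega>) \<partial>M)"
  proof (intro continuous_at_imp_continuous_on ballI)
    fix t :: real assume "t \<in> {0<..}"
    then show "isCont (\<lambda>t. \<integral>\<omega>. exp (- s * T t \<omega>) \<partial>M) t" unfolding isCont_def by (intro c) simp
  qed
  then show "(\<lambda>t. indicator {0<..} t * (\<integral>\<omega>. exp (- s * T t \<omega>) \<partial>M)) \<in> borel_measurable borel"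
    by (rule borel_measurable_indicator_continuous)
qed

text \<open>The conditions on \<open>f\<close> are those under which the second derivatives of
  \<open>cutoff k x * f x\<close> are bounded uniformly in \<open>k\<close>. Both sides of the
  equation for these test functions then converge by dominated convergence.\<close>

lemma laplace_expectation_smooth:
  assumes f: "smooth_function f" and z: "0 < z"
    and C: "\<And>x. 0 \<le> x \<Longrightarrow> \<bar>f x\<bar> \<le> C" "\<And>x. 0 \<le> x \<Longrightarrow> \<bar>f x\<bar> \<le> C * x\<^sup>2" "\<And>x. 0 \<le> x \<Longrightarrow> \<bar>deriv f x\<bar> \<le> C"
      "\<And>x. 0 \<le> x \<Longrightarrow> \<bar>deriv f x\<bar> \<le> C * x" "\<And>x. 0 \<le> x \<Longrightarrow> \<bar>deriv (deriv f) x\<bar> \<le> C"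
  shows "laplace z (\<lambda>t. \<integral>\<omega>. f (T t \<omega>) \<partial>M)
       = z powr (- (2 * \<alpha>)) * laplace z (\<lambda>t. \<integral>\<omega>. deriv (deriv f) (T t \<omega>) \<partial>M)"
proof -
  obtain S where S: "1 \<le> S" "\<And>x. \<bar>smooth_step x\<bar> \<le> S" "\<And>x. \<bar>deriv smooth_step x\<bar> \<le> S"
    "\<And>x. \<bar>deriv (deriv smooth_step) x\<bar> \<le> S" by (rule smooth_step_deriv_bounded) blast
  define \<phi> where "\<phi> n x = cutoff (real (Suc n)) x * f x" for n x
  define K where "K = 20 * S\<^sup>2 * C"
  have \<phi>: "smooth_function (\<phi> n)" for n unfolding \<phi>_def by (rule smooth_mult [OF cutoff_smooth f])
  have \<phi>'': "smooth_function ((deriv ^^ 2) (\<phi> n))" for n by (rule smooth_function_iterate [OF \<phi>])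
  have zR: "\<phi> n x = 0" if "2 * real (Suc n) < \<bar>x\<bar>" for n x
    using cutoff_zero(2) [of "real (Suc n)" x] that by (simp add: \<phi>_def)
  have z0: "\<phi> n x = 0" if "x < 1 / real (Suc n)" for n x
    using cutoff_zero(1) [of "real (Suc n)" x] that by (simp add: \<phi>_def)
  have zR'': "(deriv ^^ 2) (\<phi> n) x = 0" if "2 * real (Suc n) < \<bar>x\<bar>" for n x
  proof (rule deriv_iterate_zero_on_open [where S = "{x. 2 * real (Suc n) < \<bar>x\<bar>}"])
    show "open {x :: real. 2 * real (Suc n) < \<bar>x\<bar>}" by (intro open_Collect_less continuous_intros)
  qed (use that zR in simp_all)
  have z0'': "(deriv ^^ 2) (\<phi> n) x = 0" if "x < 0" for n x
    by (rule deriv_iterate_zero_on_open [where S = "{..<0}"])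
       (use that z0 in \<open>simp_all add: order.strict_trans [of _ 0]\<close>)
  have b\<phi>: "\<bar>\<phi> n x\<bar> \<le> C" if "0 \<le> x" for n x
    using C(1) [OF that] cutoff_bounds [of "real (Suc n)" x]
      mult_mono [of "cutoff (real (Suc n)) x" 1 "\<bar>f x\<bar>" C] by (simp add: \<phi>_def abs_mult)
  have b\<phi>'': "\<bar>(deriv ^^ 2) (\<phi> n) x\<bar> \<le> K" if "0 \<le> x" for n x
    unfolding \<phi>_def K_def
    by (rule cutoff_mult_second_deriv(1) [OF f _ S C(1) C(2) C(3) C(4) C(5) that]) simp_all
  have e\<phi>'': "(deriv ^^ 2) (\<phi> n) x = deriv (deriv f) x" if "2 / real (Suc n) < x" "x < real (Suc n)" for n x
    unfolding \<phi>_def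
    by (rule cutoff_mult_second_deriv(2) [OF f _ S C(1) C(2) C(3) C(4) C(5) that]) simp_all
  have eq: "laplace z (\<lambda>t. \<integral>\<omega>. \<phi> n (T t \<omega>) \<partial>M)
       = z powr (- (2 * \<alpha>)) * laplace z (\<lambda>t. \<integral>\<omega>. (deriv ^^ 2) (\<phi> n) (T t \<omega>) \<partial>M)" for n
    by (rule laplace_expectation_test [OF \<phi> zR _ z0 z]) (simp_all del: of_nat_Suc)
  have "(\<lambda>n. laplace z (\<lambda>t. \<integral>\<omega>. \<phi> n (T t \<omega>) \<partial>M)) \<longlonglongrightarrow> laplace z (\<lambda>t. \<integral>\<omega>. f (T t \<omega>) \<partial>M)"
  proof (rule laplace_tendsto [OF z])
    show "(\<lambda>t. indicator {0<..} t * (\<integral>\<omega>. \<phi> n (T t \<omega>) \<partial>M)) \<in> borel_measurable borel" for n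
      by (rule borel_measurable_indicator_continuous [OF expectation_test_continuous [OF \<phi> zR]])
         (simp_all add: z0 order.strict_trans [of _ 0])
    show "\<bar>\<integral>\<omega>. \<phi> n (T t \<omega>) \<partial>M\<bar> \<le> C" if "0 < t" for n t
      by (rule integrable_bounded_compose(2) [OF T_measurable smooth_function_measurable [OF \<phi>] T_nonneg b\<phi>])
         (use that in simp_all)
    show "(\<lambda>n. \<integral>\<omega>. \<phi> n (T t \<omega>) \<partial>M) \<longlonglongrightarrow> (\<integral>\<omega>. f (T t \<omega>) \<partial>M)" if "0 < t" for t
      unfolding \<phi>_def by (rule expectation_cutoff_tendsto [OF that smooth_function_measurable [OF f] C(1)])
  qed
  moreover have "(\<lambda>n. laplace z (\<lambda>t. \<integral>\<omega>. (deriv ^^ 2) (\<phi> n) (T t \<omega>) \<partial>M))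
      \<longlonglongrightarrow> laplace z (\<lambda>t. \<integral>\<omega>. deriv (deriv f) (T t \<omega>) \<partial>M)"
  proof (rule laplace_tendsto [OF z])
    show "(\<lambda>t. indicator {0<..} t * (\<integral>\<omega>. (deriv ^^ 2) (\<phi> n) (T t \<omega>) \<partial>M)) \<in> borel_measurable borel" for n
      by (rule borel_measurable_indicator_continuous [OF expectation_test_continuous [OF \<phi>'' zR'' z0'']])
    show "\<bar>\<integral>\<omega>. (deriv ^^ 2) (\<phi> n) (T t \<omega>) \<partial>M\<bar> \<le> K" if "0 < t" for n t
      by (rule integrable_bounded_compose(2) [OF T_measurable smooth_function_measurable [OF \<phi>''] T_nonneg b\<phi>''])
         (use that in simp_all)
    show "(\<lambda>n. \<integral>\<omega>. (deriv ^^ 2) (\<phi> n) (T t \<omega>) \<partial>M) \<longlonglongrightarrow> (\<integral>\<omega>. deriv (deriv f) (T t \<omega>) \<partial>M)" if t: "0 < t" for t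
    proof (rule integral_dominated_convergence [where w = "\<lambda>_. K"])
      have Tm: "T t \<in> borel_measurable M" using t T_measurable by simp
      show "(\<lambda>\<omega>. deriv (deriv f) (T t \<omega>)) \<in> borel_measurable M"
        by (rule measurable_compose [OF Tm smooth_function_measurable
              [OF smooth_function_deriv(1) [OF smooth_function_deriv(1) [OF f]]]])
      show "(\<lambda>\<omega>. (deriv ^^ 2) (\<phi> n) (T t \<omega>)) \<in> borel_measurable M" for n
        by (rule measurable_compose [OF Tm smooth_function_measurable [OF \<phi>'']])
      show "AE \<omega> in M. norm ((deriv ^^ 2) (\<phi> n) (T t \<omega>)) \<le> K" for n
        unfolding real_norm_def by (rule AE_I2, rule b\<phi>'', rule T_nonneg) (use t in simp_all)
      show "AE \<omega> in M. (\<lambda>n. (deriv ^^ 2) (\<phi> n) (T t \<omega>)) \<longlonglongrightarrow> deriv (deriv f) (T t \<omega>)"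
        using T_pos [OF t]
      proof eventually_elim
        case (elim \<omega>)
        have Suc: "filterlim (\<lambda>k. real (Suc k)) at_top sequentially"
          by (rule filterlim_compose [OF filterlim_real_sequentially filterlim_Suc])
        have "\<forall>\<^sub>F n in sequentially. 2 / T t \<omega> < real (Suc n)" "\<forall>\<^sub>F n in sequentially. T t \<omega> < real (Suc n)"
          using Suc unfolding filterlim_at_top_dense by blast+
        then have "\<forall>\<^sub>F n in sequentially. (deriv ^^ 2) (\<phi> n) (T t \<omega>) = deriv (deriv f) (T t \<omega>)"
        proof eventually_elim
          case (elim n)
          show ?case
          proof (rule e\<phi>'')
            show "2 / real (Suc n) < T t \<omega>"
              using elim(1) \<open>0 < T t \<omega>\<close> by (simp add: divide_less_eq mult.commute)
          qed (rule elim(2))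
        qed
        then show ?case by (rule tendsto_eventually)
      qed
    qed simp
  qed
  then have "(\<lambda>n. laplace z (\<lambda>t. \<integral>\<omega>. \<phi> n (T t \<omega>) \<partial>M))
      \<longlonglongrightarrow> z powr (- (2 * \<alpha>)) * laplace z (\<lambda>t. \<integral>\<omega>. deriv (deriv f) (T t \<omega>) \<partial>M)"
    unfolding eq by (rule tendsto_mult_left)
  ultimately show ?thesis by (rule LIMSEQ_unique)
qed

text \<open>Write L(r) for the transform belonging to exp(- r x). The equation for \<open>f\<close>
  is linear in L(s) and L(a), and the terms in L(a) agree on both sides, which leaves (a^2 - s^2)
  L(s) = a (a - s) / z. The exclusion of \<open>s = a\<close> permits the division by a - s.\<close>

lemma laplace_expectation_exp:
  assumes z: "0 < z" and s: "0 < s" "s \<noteq> z powr \<alpha>"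
  shows "laplace z (\<lambda>t. \<integral>\<omega>. exp (- s * T t \<omega>) \<partial>M) = z powr (\<alpha> - 1) / (z powr \<alpha> + s)"
proof -
  define a where "a = z powr \<alpha>"
  have a: "0 < a" using z by (simp add: a_def)
  define F where "F s t = (\<integral>\<omega>. exp (- s * T t \<omega>) \<partial>M)" for s t
  have Fi: "integrable lborel (\<lambda>t. indicator {0<..} t * exp (- z * t) * F s t)" if "0 \<le> s" for s
    unfolding F_def by (rule laplace_integrable_bounded [OF z expectation_exp(2,1)]) (use that in simp_all)
  have ci: "integrable lborel (\<lambda>t. indicator {0<..} t * exp (- z * t) * c)" for c
    using exp_indicator_integrable [OF z] by (auto simp: has_bochner_integral_iff)
  have lin: "laplace z (\<lambda>t. c1 * F s t + c2 * F a t + c3)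
      = c1 * laplace z (F s) + c2 * laplace z (F a) + c3 / z" for c1 c2 c3
  proof -
    have i1: "integrable lborel (\<lambda>t. indicator {0<..} t * exp (- z * t) * (c * F r t))" if "0 < r" for c r
      using integrable_mult_right [OF Fi [of r], of c] that by (simp add: mult.left_commute)
    have i2: "integrable lborel (\<lambda>t. indicator {0<..} t * exp (- z * t) * (c1 * F s t + c2 * F a t))"
      using Bochner_Integration.integrable_add [OF i1 [OF s(1), of c1] i1 [OF a, of c2]] by (simp add: distrib_left)
    show ?thesis
      using laplace_add [OF i2 ci] laplace_add [OF i1 [OF s(1)] i1 [OF a]]
      by (simp add: laplace_cmult laplace_const [OF z])
  qed
  \<comment> \<open>\<open>f(0) = f'(0) = 0\<close>, so \<open>f\<close> may be tested against the density on the half-line; the weight of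
    \<open>exp (- a x)\<close> is such that its transform drops out of the resulting equation.\<close>
  define f where "f x = exp (- s * x) + (- (s / a)) * exp (- a * x) + (s / a - 1)" for x
  have f: "smooth_function f"
    unfolding f_def by (rule smooth_add [OF smooth_add [OF smooth_exp_linear
          smooth_mult [OF smooth_const smooth_exp_linear]] smooth_const])
  have "(f has_real_derivative - s * exp (- s * x) + s * exp (- a * x)) (at x)" for x
    unfolding f_def using a by (auto intro!: derivative_eq_intros)
  then have f1: "deriv f = (\<lambda>x. - s * exp (- s * x) + s * exp (- a * x))"
    by (intro ext DERIV_imp_deriv)
  have "((\<lambda>x. - s * exp (- s * x) + s * exp (- a * x)) has_real_derivative
      s\<^sup>2 * exp (- s * x) + (- (s * a)) * exp (- a * x)) (at x)" for x
    by (auto intro!: derivative_eq_intros simp: power2_eq_square)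
  then have f2: "deriv (deriv f) = (\<lambda>x. s\<^sup>2 * exp (- s * x) + (- (s * a)) * exp (- a * x))"
    unfolding f1 by (intro ext DERIV_imp_deriv)
  \<comment> \<open>One constant for all five conditions: the first summand bounds the second
    derivative, f / x^2 and f' / x, the second bounds f', and the third bounds f.\<close>
  define C where "C = (s\<^sup>2 + s * a) + 2 * s + (2 + 2 * (s / a))"
  have sa: "0 < s / a" "0 < s * a" using s a by auto
  have e1: "0 < exp (- r * x)" "exp (- r * x) \<le> 1" if "0 < r" "0 \<le> x" for r x :: real using that by auto
  have eq: "laplace z (\<lambda>t. \<integral>\<omega>. f (T t \<omega>) \<partial>M)
       = z powr (- (2 * \<alpha>)) * laplace z (\<lambda>t. \<integral>\<omega>. deriv (deriv f) (T t \<omega>) \<partial>M)"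
  proof (rule laplace_expectation_smooth [OF f z, of C])
    fix x :: real assume x: "0 \<le> x"
    note es = e1 [OF s(1) x] and ea = e1 [OF a x]
    have bs: "\<bar>exp (- s * x) - 1\<bar> \<le> s * x" "\<bar>exp (- s * x) - 1 + s * x\<bar> \<le> (s * x)\<^sup>2"
      using exp_minus_bounds [of "s * x"] s x by simp_all
    have ba: "\<bar>exp (- a * x) - 1\<bar> \<le> a * x" "\<bar>exp (- a * x) - 1 + a * x\<bar> \<le> (a * x)\<^sup>2"
      using exp_minus_bounds [of "a * x"] a x by simp_all
    have Cx: "(s\<^sup>2 + s * a) * x \<le> C * x" "(s\<^sup>2 + s * a) * x\<^sup>2 \<le> C * x\<^sup>2"
      using x s(1) sa by (auto simp: C_def intro!: mult_right_mono)
    define q where "q = s / a * exp (- a * x)"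
    have q: "0 < q" "q \<le> s / a"
      using mult_left_mono [OF ea(2), of "s / a"] mult_pos_pos [OF sa(1) ea(1)] sa(1) by (simp_all add: q_def)
    have "f x = exp (- s * x) - q + (s / a - 1)" by (simp add: f_def q_def)
    then have "\<bar>f x\<bar> \<le> 1 + s / a * 1 + (s / a + 1)" using es q sa(1) by linarith
    also have "\<dots> \<le> C" using s(1) sa by (simp add: C_def)
    finally show "\<bar>f x\<bar> \<le> C" .
    have "f x = (exp (- s * x) - 1 + s * x) - s / a * (exp (- a * x) - 1 + a * x)"
      using a by (simp add: f_def field_simps)
    also have "\<bar>\<dots>\<bar> \<le> \<bar>exp (- s * x) - 1 + s * x\<bar> + s / a * \<bar>exp (- a * x) - 1 + a * x\<bar>"
      using abs_triangle_ineq4 [of "exp (- s * x) - 1 + s * x" "s / a * (exp (- a * x) - 1 + a * x)"] sa(1)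
      by (simp only: abs_mult abs_of_pos)
    also have "\<dots> \<le> (s * x)\<^sup>2 + s / a * (a * x)\<^sup>2"
      using bs(2) ba(2) sa(1) by (intro add_mono mult_left_mono) auto
    also have "\<dots> = (s\<^sup>2 + s * a) * x\<^sup>2" using a by (simp add: power2_eq_square field_simps)
    finally show "\<bar>f x\<bar> \<le> C * x\<^sup>2" using Cx(2) by linarith
    have "deriv f x = s * (exp (- a * x) - exp (- s * x))" by (simp add: f1 right_diff_distrib)
    then have f1': "\<bar>deriv f x\<bar> = s * \<bar>exp (- a * x) - exp (- s * x)\<bar>"
      using s(1) by (simp only: abs_mult abs_of_pos)
    have "s * \<bar>exp (- a * x) - exp (- s * x)\<bar> \<le> s * 2"
      using es ea s(1) by (intro mult_left_mono) linarith+
    also have "\<dots> \<le> C" using s(1) sa by (simp add: C_def)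
    finally show "\<bar>deriv f x\<bar> \<le> C" unfolding f1' .
    have "s * \<bar>exp (- a * x) - exp (- s * x)\<bar> \<le> s * (a * x + s * x)"
      using bs(1) ba(1) s(1) by (intro mult_left_mono) linarith+
    also have "\<dots> = (s\<^sup>2 + s * a) * x" by (simp add: power2_eq_square algebra_simps)
    finally show "\<bar>deriv f x\<bar> \<le> C * x" unfolding f1' using Cx(1) by linarith
    have "\<bar>deriv (deriv f) x\<bar> \<le> s\<^sup>2 * exp (- s * x) + s * a * exp (- a * x)"
      unfolding f2 using es ea s a abs_triangle_ineq [of "s\<^sup>2 * exp (- s * x)" "(- (s * a)) * exp (- a * x)"]
      by (simp add: abs_mult)
    also have "\<dots> \<le> s\<^sup>2 * 1 + s * a * 1"
      using es ea sa(2) by (intro add_mono mult_left_mono) auto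
    also have "\<dots> \<le> C" using s(1) sa by (simp add: C_def)
    finally show "\<bar>deriv (deriv f) x\<bar> \<le> C" .
  qed
  have Ef: "(\<integral>\<omega>. f (T t \<omega>) \<partial>M) = 1 * F s t + (- (s / a)) * F a t + (s / a - 1)" if "0 < t" for t
    using expectation_exp(3) [of s t] expectation_exp(3) [of a t] s a that
    by (simp add: f_def F_def prob_space del: minus_mult_left)
  have Ef2: "(\<integral>\<omega>. deriv (deriv f) (T t \<omega>) \<partial>M) = s\<^sup>2 * F s t + (- (s * a)) * F a t + 0" if "0 < t" for t
    using expectation_exp(3) [of s t] expectation_exp(3) [of a t] s a that
    by (simp add: f2 F_def del: minus_mult_left)
  have L1: "laplace z (\<lambda>t. \<integral>\<omega>. f (T t \<omega>) \<partial>M) = 1 * laplace z (F s) + (- (s / a)) * laplace z (F a) + (s / a - 1) / z"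
    unfolding lin [symmetric] by (rule laplace_cong) (rule Ef)
  have L2: "laplace z (\<lambda>t. \<integral>\<omega>. deriv (deriv f) (T t \<omega>) \<partial>M) = s\<^sup>2 * laplace z (F s) + (- (s * a)) * laplace z (F a) + 0 / z"
    unfolding lin [symmetric] by (rule laplace_cong) (rule Ef2)
  have za: "z powr (- (2 * \<alpha>)) = 1 / a\<^sup>2"
    using z by (simp add: a_def powr_minus_divide power2_eq_square flip: powr_add)
  have "a\<^sup>2 * (laplace z (F s) - s / a * laplace z (F a) + (s / a - 1) / z)
      = s\<^sup>2 * laplace z (F s) - s * a * laplace z (F a)"
    using eq a unfolding L1 L2 za by (simp add: field_simps)
  moreover have "a\<^sup>2 * (laplace z (F s) - s / a * laplace z (F a) + (s / a - 1) / z)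
      = a\<^sup>2 * laplace z (F s) - s * a * laplace z (F a) - a * (a - s) / z"
    using a z by (simp add: field_simps power2_eq_square)
  ultimately have "(a\<^sup>2 - s\<^sup>2) * laplace z (F s) = a * (a - s) / z"
    by (simp add: left_diff_distrib)
  then have "(a - s) * ((a + s) * laplace z (F s)) = (a - s) * (a / z)"
    by (simp add: algebra_simps power2_eq_square)
  moreover have "a - s \<noteq> 0" using s(2) by (simp add: a_def)
  ultimately have "(a + s) * laplace z (F s) = a / z" by (metis mult_left_cancel)
  moreover have "a + s \<noteq> 0" using a s(1) by simp
  ultimately have "laplace z (F s) = a / z / (a + s)" by (metis nonzero_eq_divide_eq mult.commute)
  then show ?thesis using z by (simp add: F_def [abs_def] a_def powr_diff)
qed

end

section \<open>From exponentials to bounded continuous functions\<close>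

lemma laplace_exp:
  assumes "0 < z" "0 \<le> c"
  shows "laplace z (\<lambda>x. exp (- c * x)) = 1 / (z + c)"
    and "integrable lborel (\<lambda>x. indicator {0<..} x * exp (- z * x) * exp (- c * x))"
proof -
  have eq: "indicator {0<..} x * exp (- z * x) * exp (- c * x) = indicator {0<..} x * exp (- (z + c) * x)" for x
    by (simp add: exp_add [symmetric] algebra_simps)
  have "has_bochner_integral lborel (\<lambda>x. indicator {0<..} x * exp (- (z + c) * x)) (1 / (z + c))"
    by (rule exp_indicator_integrable) (use assms in simp)
  then show "laplace z (\<lambda>x. exp (- c * x)) = 1 / (z + c)"
    and "integrable lborel (\<lambda>x. indicator {0<..} x * exp (- z * x) * exp (- c * x))"
    unfolding laplace_def eq by (auto simp: has_bochner_integral_iff)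
qed

lemma laplace_sum_cmult:
  assumes "\<And>k. integrable lborel (\<lambda>t. indicator {0<..} t * exp (- z * t) * f k t)"
  shows "laplace z (\<lambda>t. \<Sum>k\<le>n. a k * f k t) = (\<Sum>k\<le>n. a k * laplace z (f k))"
    and "integrable lborel (\<lambda>t. indicator {0<..} t * exp (- z * t) * (\<Sum>k\<le>(n::nat). a k * f k t))"
proof -
  have eq: "indicator {0<..} t * exp (- z * t) * (\<Sum>k\<le>n. a k * f k t)
      = (\<Sum>k\<le>n. a k * (indicator {0<..} t * exp (- z * t) * f k t))" for t
    by (simp only: sum_distrib_left mult.left_commute)
  show "laplace z (\<lambda>t. \<Sum>k\<le>n. a k * f k t) = (\<Sum>k\<le>n. a k * laplace z (f k))"
    unfolding laplace_def eq using assms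
    by (subst Bochner_Integration.integral_sum) (simp_all only: integrable_mult_right integral_mult_right_zero)
  show "integrable lborel (\<lambda>t. indicator {0<..} t * exp (- z * t) * (\<Sum>k\<le>n. a k * f k t))"
    unfolding eq by (intro Bochner_Integration.integrable_sum integrable_mult_right assms)
qed

lemma laplace_diff_abs_le:
  assumes "0 < z" and i: "integrable lborel (\<lambda>t. indicator {0<..} t * exp (- z * t) * f t)"
    "integrable lborel (\<lambda>t. indicator {0<..} t * exp (- z * t) * g t)"
    and B: "\<And>t. 0 < t \<Longrightarrow> \<bar>f t - g t\<bar> \<le> B"
  shows "\<bar>laplace z f - laplace z g\<bar> \<le> B / z"
proof -
  have "laplace z f - laplace z g = laplace z (\<lambda>t. f t - g t)"
    using i by (simp add: laplace_def right_diff_distrib)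
  then show ?thesis using laplace_abs_le [OF assms(1) B] by simp
qed

context folded_law
begin

lemma expectation_exp_sum:
  fixes f :: "real \<Rightarrow> real" and a :: "nat \<Rightarrow> real"
  assumes f: "f \<in> borel_measurable borel" and B: "\<And>x. 0 \<le> x \<Longrightarrow> \<bar>f x\<bar> \<le> B" and \<theta>: "0 < \<theta>"
    and a: "\<And>x. 0 \<le> x \<Longrightarrow> \<bar>f x - (\<Sum>k\<le>n. a k * exp (- (\<theta> * real k) * x))\<bar> < e" and t: "0 < t"
  shows "\<bar>(\<integral>\<omega>. f (T t \<omega>) \<partial>M) - (\<Sum>k\<le>n. a k * (\<integral>\<omega>. exp (- (\<theta> * real k) * T t \<omega>) \<partial>M))\<bar> \<le> e"
proof -
  have fi: "integrable M (\<lambda>\<omega>. f (T t \<omega>))"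
    by (rule integrable_bounded_compose(1) [OF T_measurable f T_nonneg B]) (use t in simp_all)
  have ei: "integrable M (\<lambda>\<omega>. a k * exp (- (\<theta> * real k) * T t \<omega>))" for k
    by (rule integrable_mult_right, rule expectation_exp(3)) (use \<theta> t in simp_all)
  have "(\<integral>\<omega>. f (T t \<omega>) \<partial>M) - (\<Sum>k\<le>n. a k * (\<integral>\<omega>. exp (- (\<theta> * real k) * T t \<omega>) \<partial>M))
      = (\<integral>\<omega>. (\<lambda>x. f x - (\<Sum>k\<le>n. a k * exp (- (\<theta> * real k) * x))) (T t \<omega>) \<partial>M)"
    by (subst Bochner_Integration.integral_diff [OF fi Bochner_Integration.integrable_sum [OF ei]])
       (subst Bochner_Integration.integral_sum [OF ei], simp only: integral_mult_right_zero)
  also have "\<bar>\<dots>\<bar> \<le> e"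
  proof (rule integrable_bounded_compose(2) [OF T_measurable _ T_nonneg])
    show "(\<lambda>x. f x - (\<Sum>k\<le>n. a k * exp (- (\<theta> * real k) * x))) \<in> borel_measurable borel" using f by measurable
    show "\<bar>f x - (\<Sum>k\<le>n. a k * exp (- (\<theta> * real k) * x))\<bar> \<le> e" if "0 \<le> x" for x
      using a [OF that] by simp
  qed (use t in simp_all)
  finally show ?thesis .
qed

text \<open>Exponential sums approximate \<open>f\<close> uniformly, hence also its expectation
  uniformly in time, and for exponentials continuity is known.\<close>

lemma expectation_continuous_decaying:
  fixes f :: "real \<Rightarrow> real"
  assumes f: "continuous_on UNIV f" and l: "(f \<longlongrightarrow> 0) at_top" and B: "\<And>x. 0 \<le> x \<Longrightarrow> \<bar>f x\<bar> \<le> B" and t0: "0 < t0"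
  shows "((\<lambda>t. \<integral>\<omega>. f (T t \<omega>) \<partial>M) \<longlongrightarrow> (\<integral>\<omega>. f (T t0 \<omega>) \<partial>M)) (at t0)"
proof (rule tendstoI)
  fix e :: real assume e: "0 < e"
  then have e3: "0 < e / 3" by simp
  have f0: "continuous_on {0..} f" using f by (rule continuous_on_subset) simp
  have fm: "f \<in> borel_measurable borel" using f by (rule borel_measurable_continuous_onI)
  obtain n :: nat and a where a: "\<And>x. 0 \<le> x \<Longrightarrow> \<bar>f x - (\<Sum>k\<le>n. a k * exp (- (1 * real k) * x))\<bar> < e / 3"
    by (rule exponential_sum_approximation [OF f0 l zero_less_one e3]) blast
  have d: "\<bar>(\<integral>\<omega>. f (T t \<omega>) \<partial>M) - (\<Sum>k\<le>n. a k * (\<integral>\<omega>. exp (- (1 * real k) * T t \<omega>) \<partial>M))\<bar> \<le> e / 3"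
    if "0 < t" for t
    by (rule expectation_exp_sum [OF fm B zero_less_one a that])
  have "((\<lambda>t. \<Sum>k\<le>n. a k * (\<integral>\<omega>. exp (- (1 * real k) * T t \<omega>) \<partial>M)) \<longlongrightarrow>
      (\<Sum>k\<le>n. a k * (\<integral>\<omega>. exp (- (1 * real k) * T t0 \<omega>) \<partial>M))) (at t0)"
    by (intro tendsto_sum tendsto_mult_left expectation_exp(4) t0) simp
  note tendstoD [OF this e3]
  moreover have "\<forall>\<^sub>F t in at t0. t \<in> {0<..}" using t0 by (intro eventually_at_in_open') auto
  ultimately show "\<forall>\<^sub>F t in at t0. dist (\<integral>\<omega>. f (T t \<omega>) \<partial>M) (\<integral>\<omega>. f (T t0 \<omega>) \<partial>M) < e"
  proof eventually_elim
    case (elim t)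
    then have "0 < t" by simp
    from elim(1) d [OF this] d [OF t0] show ?case unfolding dist_real_def by linarith
  qed
qed

text \<open>Both sides change little under uniform approximation of \<open>f\<close>, so the formula
  for exponentials extends through exponential sums.\<close>

lemma laplace_expectation_decaying:
  fixes f :: "real \<Rightarrow> real"
  assumes f: "continuous_on UNIV f" and l: "(f \<longlongrightarrow> 0) at_top" and B: "\<And>x. 0 \<le> x \<Longrightarrow> \<bar>f x\<bar> \<le> B" and z: "0 < z"
  shows "laplace z (\<lambda>t. \<integral>\<omega>. f (T t \<omega>) \<partial>M) = z powr (\<alpha> - 1) * laplace (z powr \<alpha>) f"
proof -
  define a where "a = z powr \<alpha>"
  have a: "0 < a" using z by (simp add: a_def)
  have f0: "continuous_on {0..} f" using f by (rule continuous_on_subset) simp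
  have fm: "f \<in> borel_measurable borel" using f by (rule borel_measurable_continuous_onI)
  have "continuous_on {0<..} (\<lambda>t. \<integral>\<omega>. f (T t \<omega>) \<partial>M)"
  proof (intro continuous_at_imp_continuous_on ballI)
    fix t :: real assume "t \<in> {0<..}"
    then show "isCont (\<lambda>t. \<integral>\<omega>. f (T t \<omega>) \<partial>M) t"
      unfolding isCont_def by (intro expectation_continuous_decaying [OF f l B]) simp_all
  qed
  then have Em: "(\<lambda>t. indicator {0<..} t * (\<integral>\<omega>. f (T t \<omega>) \<partial>M)) \<in> borel_measurable borel"
    by (rule borel_measurable_indicator_continuous)
  have EB: "\<bar>\<integral>\<omega>. f (T t \<omega>) \<partial>M\<bar> \<le> B" if "0 < t" for t
    by (rule integrable_bounded_compose(2) [OF T_measurable fm T_nonneg B]) (use that in simp_all)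
  note Ei = laplace_integrable_bounded [OF z Em EB]
  have fi: "integrable lborel (\<lambda>t. indicator {0<..} t * exp (- a * t) * f t)"
    by (rule laplace_integrable_bounded [OF a _ B]) (use fm in simp_all)
  let ?L = "laplace z (\<lambda>t. \<integral>\<omega>. f (T t \<omega>) \<partial>M)" and ?R = "z powr (\<alpha> - 1) * laplace a f"
  have "\<bar>?L - ?R\<bar> \<le> 0"
  proof (rule field_le_epsilon)
    fix e :: real assume e: "0 < e"
    \<comment> \<open>Each side is approximated up to \<open>d / z\<close>; on the right this uses
      z^(\<alpha> - 1) / a = 1 / z.\<close>
    define d where "d = e * z / 2"
    have d: "0 < d" using e z by (simp add: d_def)
    \<comment> \<open>Exponents \<open>2 a k\<close> avoid \<open>a\<close>, for which \<open>laplace_expectation_exp\<close> says nothing.\<close>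
    have a2: "0 < 2 * a" using a by simp
    obtain n :: nat and c where c: "\<And>x. 0 \<le> x \<Longrightarrow> \<bar>f x - (\<Sum>k\<le>n. c k * exp (- (2 * a * real k) * x))\<bar> < d"
      by (rule exponential_sum_approximation [OF f0 l a2 d]) blast
    let ?E = "\<lambda>k t. \<integral>\<omega>. exp (- (2 * a * real k) * T t \<omega>) \<partial>M"
    have ak: "0 \<le> 2 * a * real k" for k using a by simp
    have i1: "integrable lborel (\<lambda>t. indicator {0<..} t * exp (- z * t) * ?E k t)" for k
      by (rule laplace_integrable_bounded [OF z expectation_exp(2,1) [OF ak]])
    have LE: "laplace z (?E k) = z powr (\<alpha> - 1) * (1 / (a + 2 * a * real k))" for k
    proof (cases "k = 0")
      \<comment> \<open>\<open>laplace_expectation_exp\<close> requires a positive exponent; for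
        exponent 0 the formula is that of the total mass.\<close>
      case True
      have "laplace z (?E k) = 1 / z" using True z by (simp add: prob_space laplace_const)
      also have "\<dots> = z powr (\<alpha> - 1) * (1 / (a + 2 * a * real k))"
        using True z by (simp add: a_def powr_diff)
      finally show ?thesis .
    next
      case False
      have "2 * a * real k \<noteq> a"
      proof
        assume "2 * a * real k = a"
        then have "2 * real k = 1" using a by simp
        then have "real (2 * k) = real 1" by simp
        then have "2 * k = 1" by (rule iffD1 [OF of_nat_eq_iff])
        then show False by presburger
      qed
      then show ?thesis using laplace_expectation_exp [OF z, of "2 * a * real k"] False a by (simp add: a_def)
    qed
    have LS: "laplace z (\<lambda>t. \<Sum>k\<le>n. c k * ?E k t) = z powr (\<alpha> - 1) * laplace a (\<lambda>x. \<Sum>k\<le>n. c k * exp (- (2 * a * real k) * x))"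
      by (simp only: laplace_sum_cmult(1) [OF i1] laplace_sum_cmult(1) [OF laplace_exp(2) [OF a ak]] LE
          laplace_exp(1) [OF a ak] sum_distrib_left mult.left_commute)
    have 1: "\<bar>?L - laplace z (\<lambda>t. \<Sum>k\<le>n. c k * ?E k t)\<bar> \<le> d / z"
    proof (rule laplace_diff_abs_le [OF z Ei])
      show "integrable lborel (\<lambda>t. indicator {0<..} t * exp (- z * t) * (\<Sum>k\<le>n. c k * ?E k t))"
        by (rule laplace_sum_cmult(2) [OF i1])
      show "\<bar>(\<integral>\<omega>. f (T t \<omega>) \<partial>M) - (\<Sum>k\<le>n. c k * ?E k t)\<bar> \<le> d" if "0 < t" for t
        by (rule expectation_exp_sum [OF fm B a2 c that])
    qed
    have "\<bar>laplace a f - laplace a (\<lambda>x. \<Sum>k\<le>n. c k * exp (- (2 * a * real k) * x))\<bar> \<le> d / a"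
      by (rule laplace_diff_abs_le [OF a fi laplace_sum_cmult(2) [OF laplace_exp(2) [OF a ak]]], rule less_imp_le, rule c) simp
    then have "z powr (\<alpha> - 1) * \<bar>laplace a f - laplace a (\<lambda>x. \<Sum>k\<le>n. c k * exp (- (2 * a * real k) * x))\<bar>
        \<le> z powr (\<alpha> - 1) * (d / a)"
      by (rule mult_left_mono) simp
    also have "z powr (\<alpha> - 1) * (d / a) = d / z" using z by (simp add: a_def powr_diff)
    finally have 2: "\<bar>?R - laplace z (\<lambda>t. \<Sum>k\<le>n. c k * ?E k t)\<bar> \<le> d / z"
      unfolding LS right_diff_distrib [symmetric] abs_mult by simp
    have "\<bar>?L - ?R\<bar> \<le> d / z + d / z" using 1 2 by linarith
    also have "\<dots> = 0 + e" using z by (simp add: d_def)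
    finally show "\<bar>?L - ?R\<bar> \<le> 0 + e" .
  qed
  then show ?thesis by (simp add: a_def)
qed

text \<open>The factor exp(- x / (k + 1)) gives a bounded function the decay at infinity that
  approximation by exponential sums requires; it tends to 1 as k grows.\<close>

lemma damping:
  fixes f :: "real \<Rightarrow> real"
  assumes f: "continuous_on UNIV f" and B: "\<And>x. 0 \<le> x \<Longrightarrow> \<bar>f x\<bar> \<le> B"
  defines "g \<equiv> \<lambda>k x. exp (- (1 / real (Suc k)) * x)"
  shows "continuous_on UNIV (\<lambda>x. g k x * f x)" "((\<lambda>x. g k x * f x) \<longlongrightarrow> 0) at_top"
    "0 \<le> x \<Longrightarrow> \<bar>g k x * f x\<bar> \<le> B" "(\<lambda>k. g k x * f x) \<longlonglongrightarrow> f x"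
proof -
  show "continuous_on UNIV (\<lambda>x. g k x * f x)" unfolding g_def by (intro continuous_intros f)
  show "\<bar>g k x * f x\<bar> \<le> B" if "0 \<le> x"
    using mult_mono [of "g k x" 1 "\<bar>f x\<bar>" B] B [OF that] that by (simp add: g_def abs_mult)
  have "((\<lambda>x. exp (- (1 / real (Suc k)) * x)) \<longlongrightarrow> 0) at_top" by real_asymp
  then have 0: "((\<lambda>x. B * g k x) \<longlongrightarrow> 0) at_top" unfolding g_def by (rule tendsto_mult_right_zero)
  show "((\<lambda>x. g k x * f x) \<longlongrightarrow> 0) at_top"
  proof (rule Lim_null_comparison [OF _ 0])
    show "\<forall>\<^sub>F x in at_top. norm (g k x * f x) \<le> B * g k x"
      using eventually_ge_at_top [of 0]
    proof eventually_elim
      case (elim x)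
      then show ?case using mult_left_mono [OF B [of x], of "g k x"] by (simp add: g_def abs_mult mult.commute)
    qed
  qed
  have "(\<lambda>k. exp (- (1 / real (Suc k)) * x) * f x) \<longlonglongrightarrow> exp (- 0 * x) * f x"
    by (intro tendsto_intros LIMSEQ_Suc [OF lim_1_over_n])
  then show "(\<lambda>k. g k x * f x) \<longlonglongrightarrow> f x" by (simp add: g_def)
qed

lemma expectation_damped_tendsto:
  fixes f :: "real \<Rightarrow> real"
  assumes f: "continuous_on UNIV f" and B: "\<And>x. 0 \<le> x \<Longrightarrow> \<bar>f x\<bar> \<le> B" and t: "0 < t"
  shows "(\<lambda>k. \<integral>\<omega>. exp (- (1 / real (Suc k)) * T t \<omega>) * f (T t \<omega>) \<partial>M) \<longlonglongrightarrow> (\<integral>\<omega>. f (T t \<omega>) \<partial>M)"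
proof (rule integral_dominated_convergence [where w = "\<lambda>_. B"])
  have [measurable]: "T t \<in> borel_measurable M" using T_measurable t by simp
  have [measurable]: "f \<in> borel_measurable borel" using f by (rule borel_measurable_continuous_onI)
  show "(\<lambda>\<omega>. f (T t \<omega>)) \<in> borel_measurable M" by measurable
  show "(\<lambda>\<omega>. exp (- (1 / real (Suc k)) * T t \<omega>) * f (T t \<omega>)) \<in> borel_measurable M" for k by measurable
  show "AE \<omega> in M. (\<lambda>k. exp (- (1 / real (Suc k)) * T t \<omega>) * f (T t \<omega>)) \<longlonglongrightarrow> f (T t \<omega>)"
    by (rule AE_I2) (rule damping(4) [OF f B])
  show "AE \<omega> in M. norm (exp (- (1 / real (Suc k)) * T t \<omega>) * f (T t \<omega>)) \<le> B" for k
    unfolding real_norm_def by (rule AE_I2, rule damping(3) [OF f B], assumption, rule T_nonneg) (use t in simp_all)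
qed simp

text \<open>Here the damping factors themselves serve as \<open>g\<close> in the tightness
  lemma.\<close>

lemma expectation_continuous:
  fixes f :: "real \<Rightarrow> real"
  assumes f: "continuous_on UNIV f" and B: "\<And>x. 0 \<le> x \<Longrightarrow> \<bar>f x\<bar> \<le> B"
  shows "continuous_on {0<..} (\<lambda>t. \<integral>\<omega>. f (T t \<omega>) \<partial>M)"
proof (intro continuous_at_imp_continuous_on ballI)
  fix t0 :: real assume "t0 \<in> {0<..}"
  then have t0: "0 < t0" by simp
  have fm: "f \<in> borel_measurable borel" using f by (rule borel_measurable_continuous_onI)
  define g where "g k x = exp (- (1 / real (Suc k)) * x)" for k x
  have one: "continuous_on UNIV (\<lambda>x :: real. 1 :: real)" by simp
  have "((\<lambda>t. \<integral>\<omega>. f (T t \<omega>) \<partial>M) \<longlongrightarrow> (\<integral>\<omega>. f (T t0 \<omega>) \<partial>M)) (at t0)"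
  proof (rule tendsto_expectation_cutoff [where X = T and g = g, OF T_measurable T_nonneg t0 fm B])
    show "g k \<in> borel_measurable borel" for k unfolding g_def by measurable
    show "((\<lambda>t. \<integral>\<omega>. g k (T t \<omega>) \<partial>M) \<longlongrightarrow> (\<integral>\<omega>. g k (T t0 \<omega>) \<partial>M)) (at t0)" for k
      unfolding g_def by (rule expectation_exp(4)) (use t0 in simp_all)
    show "((\<lambda>t. \<integral>\<omega>. g k (T t \<omega>) * f (T t \<omega>) \<partial>M) \<longlongrightarrow> (\<integral>\<omega>. g k (T t0 \<omega>) * f (T t0 \<omega>) \<partial>M)) (at t0)" for k
      unfolding g_def
      by (rule expectation_continuous_decaying [OF damping(1) [OF f B] damping(2) [OF f B] damping(3) [OF f B] t0])
    show "(\<lambda>k. \<integral>\<omega>. g k (T t0 \<omega>) \<partial>M) \<longlonglongrightarrow> 1"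
      using expectation_damped_tendsto [OF one _ t0, of 1] by (simp add: g_def prob_space del: of_nat_Suc)
  qed (simp_all add: g_def)
  then show "isCont (\<lambda>t. \<integral>\<omega>. f (T t \<omega>) \<partial>M) t0" by (simp add: isCont_def)
qed

lemma laplace_expectation:
  fixes f :: "real \<Rightarrow> real"
  assumes f: "continuous_on UNIV f" and B: "\<And>x. 0 \<le> x \<Longrightarrow> \<bar>f x\<bar> \<le> B" and z: "0 < z"
  shows "laplace z (\<lambda>t. \<integral>\<omega>. f (T t \<omega>) \<partial>M) = z powr (\<alpha> - 1) * laplace (z powr \<alpha>) f"
proof -
  have a: "0 < z powr \<alpha>" using z by simp
  have fm: "f \<in> borel_measurable borel" using f by (rule borel_measurable_continuous_onI)
  define g where "g k x = exp (- (1 / real (Suc k)) * x) * f x" for k x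
  note G = damping [OF f B, folded g_def]
  have Em: "(\<lambda>t. indicator {0<..} t * (\<integral>\<omega>. g k (T t \<omega>) \<partial>M)) \<in> borel_measurable borel" for k
    by (rule borel_measurable_indicator_continuous [OF expectation_continuous [OF G(1) G(3)]])
  have EB: "\<bar>\<integral>\<omega>. g k (T t \<omega>) \<partial>M\<bar> \<le> B" if "0 < t" for k t
    by (rule integrable_bounded_compose(2) [OF T_measurable borel_measurable_continuous_onI [OF G(1)] T_nonneg G(3)])
       (use that in simp_all)
  have eq: "laplace z (\<lambda>t. \<integral>\<omega>. g k (T t \<omega>) \<partial>M) = z powr (\<alpha> - 1) * laplace (z powr \<alpha>) (g k)" for k
    by (rule laplace_expectation_decaying [OF G(1) G(2) G(3) z])
  have "(\<lambda>k. laplace z (\<lambda>t. \<integral>\<omega>. g k (T t \<omega>) \<partial>M)) \<longlonglongrightarrow> laplace z (\<lambda>t. \<integral>\<omega>. f (T t \<omega>) \<partial>M)"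
    using expectation_damped_tendsto [OF f B] unfolding g_def [symmetric]
    by (intro laplace_tendsto [OF z Em EB])
  moreover have "(\<lambda>k. laplace (z powr \<alpha>) (g k)) \<longlonglongrightarrow> laplace (z powr \<alpha>) f"
  proof (rule laplace_tendsto [OF a _ G(3) G(4)])
    show "(\<lambda>t. indicator {0<..} t * g k t) \<in> borel_measurable borel" for k
      using borel_measurable_continuous_onI [OF G(1)] by measurable
  qed (auto intro: less_imp_le)
  then have "(\<lambda>k. laplace z (\<lambda>t. \<integral>\<omega>. g k (T t \<omega>) \<partial>M)) \<longlonglongrightarrow> z powr (\<alpha> - 1) * laplace (z powr \<alpha>) f"
    unfolding eq by (rule tendsto_mult_left)
  ultimately show ?thesis by (intro LIMSEQ_unique)
qed

end

lemma folded_process_expectation: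
  fixes f :: "real \<Rightarrow> real"
  assumes M: "prob_space M" and \<alpha>: "0 < \<alpha>" "\<alpha> \<le> 1" and T: "folded_process \<alpha> M T"
    and f: "continuous_on UNIV f" and B: "\<And>x. 0 \<le> x \<Longrightarrow> \<bar>f x\<bar> \<le> B"
  shows "continuous_on {0<..} (\<lambda>t. \<integral>\<omega>. f (T t \<omega>) \<partial>M)"
    and "0 < z \<Longrightarrow> laplace z (\<lambda>t. \<integral>\<omega>. f (T t \<omega>) \<partial>M) = z powr (\<alpha> - 1) * laplace (z powr \<alpha>) f"
proof -
  interpret prob_space M by (rule M)
  have Tm: "T t \<in> borel_measurable M" if "0 \<le> t" for t
    using T that by (simp add: folded_process_def random_process_def)
  have fm: "f \<in> borel_measurable borel" using f by (rule borel_measurable_continuous_onI)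
  show "continuous_on {0<..} (\<lambda>t. \<integral>\<omega>. f (T t \<omega>) \<partial>M)"
    and "0 < z \<Longrightarrow> laplace z (\<lambda>t. \<integral>\<omega>. f (T t \<omega>) \<partial>M) = z powr (\<alpha> - 1) * laplace (z powr \<alpha>) f"
  proof (atomize (full), cases "\<alpha> = 1")
    case True
    have E: "(\<integral>\<omega>. f (T t \<omega>) \<partial>M) = f t" if "0 < t" for t
    proof -
      have ae: "AE \<omega> in M. T t \<omega> = t" using T True that by (simp add: folded_process_def)
      have "(\<integral>\<omega>. f (T t \<omega>) \<partial>M) = (\<integral>\<omega>. f t \<partial>M)"
        by (rule integral_cong_AE) (use ae fm Tm [of t] that in \<open>auto intro: measurable_compose\<close>)
      then show ?thesis by (simp add: prob_space)
    qed
    have "continuous_on {0<..} (\<lambda>t. \<integral>\<omega>. f (T t \<omega>) \<partial>M)"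
      by (rule continuous_on_eq [OF continuous_on_subset [OF f]]) (simp_all add: E)
    moreover have "laplace z (\<lambda>t. \<integral>\<omega>. f (T t \<omega>) \<partial>M) = laplace z f" by (rule laplace_cong) (rule E)
    ultimately show "continuous_on {0<..} (\<lambda>t. \<integral>\<omega>. f (T t \<omega>) \<partial>M) \<and>
      (0 < z \<longrightarrow> laplace z (\<lambda>t. \<integral>\<omega>. f (T t \<omega>) \<partial>M) = z powr (\<alpha> - 1) * laplace (z powr \<alpha>) f)"
      using True by simp
  next
    case False
    with T obtain u where "solves_fractional_cauchy \<alpha> u" "\<And>t x. 0 < t \<Longrightarrow> 0 \<le> x \<Longrightarrow> 0 \<le> u x t"
      "\<And>t. 0 < t \<Longrightarrow> distributed M lborel (T t) (\<lambda>x. ennreal (if 0 \<le> x then 2 * u x t else 0))"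
      by (auto simp: folded_process_def)
    moreover have "\<And>t \<omega>. 0 \<le> t \<Longrightarrow> \<omega> \<in> space M \<Longrightarrow> 0 \<le> T t \<omega>" using T by (simp add: folded_process_def)
    ultimately interpret folded_law M \<alpha> T u
      by unfold_locales (use \<alpha> False Tm in simp_all)
    show "continuous_on {0<..} (\<lambda>t. \<integral>\<omega>. f (T t \<omega>) \<partial>M) \<and>
      (0 < z \<longrightarrow> laplace z (\<lambda>t. \<integral>\<omega>. f (T t \<omega>) \<partial>M) = z powr (\<alpha> - 1) * laplace (z powr \<alpha>) f)"
      using expectation_continuous [OF f B] laplace_expectation [OF f B] by simp
  qed
qed

section \<open>The integrated governing equation\<close>

lemma backward_shift_iterate: "(backward_shift ^^ k) f n = f (n - int k)"
  by (induction k arbitrary: n) (simp_all add: backward_shift_def algebra_simps)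

definition diff_coeff :: "real \<Rightarrow> nat \<Rightarrow> real" where
  "diff_coeff \<beta> k = (\<beta> gchoose k) * (-1) ^ k"

text \<open>Sequences that vanish at negative indices turn the series (I - B)^\<beta> into this
  finite sum, so derivatives in the rate and integrals pass through it term by term.\<close>

definition truncated_difference :: "real \<Rightarrow> (nat \<Rightarrow> real) \<Rightarrow> nat \<Rightarrow> real" where
  "truncated_difference \<beta> f n = (\<Sum>k\<le>n. diff_coeff \<beta> k * f (n - k))"

lemma fractional_difference_state_prob:
  "fractional_difference \<beta> (state_prob p l t) (int n) = truncated_difference \<beta> (pmf (p l t)) n"
proof -
  have "(\<Sum>k. (\<beta> gchoose k) * (-1) ^ k * (backward_shift ^^ k) (state_prob p l t) (int n))
      = (\<Sum>k\<le>n. (\<beta> gchoose k) * (-1) ^ k * (backward_shift ^^ k) (state_prob p l t) (int n))"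
    by (rule suminf_finite) (simp_all add: backward_shift_iterate state_prob_def)
  also have "\<dots> = truncated_difference \<beta> (pmf (p l t)) n"
    unfolding truncated_difference_def
  proof (rule sum.cong)
    fix k assume "k \<in> {..n}"
    then have "nat (int n - int k) = n - k" "\<not> int n - int k < 0" by auto
    then show "(\<beta> gchoose k) * (-1) ^ k * (backward_shift ^^ k) (state_prob p l t) (int n)
        = diff_coeff \<beta> k * pmf (p l t) (n - k)"
      by (simp only: backward_shift_iterate state_prob_def diff_coeff_def if_False)
  qed simp
  finally show ?thesis by (simp add: fractional_difference_def)
qed

section \<open>The solution family as a function of the rate\<close>

locale stfprf_family =
  fixes \<alpha>1 \<alpha>2 \<beta> :: real and p :: "real \<Rightarrow> real \<times> real \<Rightarrow> nat pmf"
  assumes \<alpha>1: "0 < \<alpha>1" "\<alpha>1 \<le> 1" and \<alpha>2: "0 < \<alpha>2" "\<alpha>2 \<le> 1" and \<beta>: "0 < \<beta>" "\<beta> \<le> 1"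
    and solves: "solves_STFPRF_equation \<alpha>1 \<alpha>2 \<beta> p"
begin

definition dp :: "nat \<Rightarrow> real \<Rightarrow> real \<times> real \<Rightarrow> real" where
  "dp n l t = deriv (\<lambda>m. pmf (p m t) n) l"

lemma state_prob_int: "state_prob p l t (int n) = pmf (p l t) n"
  by (simp add: state_prob_def)

lemma p_continuous: "continuous_on ({0<..} \<times> R2plus) (\<lambda>(l, t). pmf (p l t) n)"
  and dp_continuous: "continuous_on ({0<..} \<times> R2plus) (\<lambda>(l, t). dp n l t)"
  and p_deriv: "0 < l \<Longrightarrow> t \<in> R2plus \<Longrightarrow> ((\<lambda>m. pmf (p m t) n) has_real_derivative dp n l t) (at l)"
proof -
  have *: "continuous_on ({0<..} \<times> R2plus) (\<lambda>(l, t). state_prob p l t (int n))"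
    "\<forall>l>0. \<forall>t\<in>R2plus. (\<lambda>m. state_prob p m t (int n)) differentiable (at l)"
    "continuous_on ({0<..} \<times> R2plus) (\<lambda>(l, t). deriv (\<lambda>m. state_prob p m t (int n)) l)"
    using solves [unfolded solves_STFPRF_equation_def, THEN conjunct1, THEN spec [of _ "int n"]] by simp_all
  show "continuous_on ({0<..} \<times> R2plus) (\<lambda>(l, t). pmf (p l t) n)"
    "continuous_on ({0<..} \<times> R2plus) (\<lambda>(l, t). dp n l t)"
    using *(1,3) by (simp_all only: state_prob_int dp_def)
  show "((\<lambda>m. pmf (p m t) n) has_real_derivative dp n l t) (at l)" if "0 < l" "t \<in> R2plus"
    using *(2) that by (simp only: state_prob_int dp_def DERIV_deriv_iff_real_differentiable)
qed

text \<open>The boundary condition concerns state 0 only; since the probabilities sum to 1, it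
  forces all other states to have probability 0.\<close>

lemma p_axes:
  assumes "0 < l" "0 \<le> s"
  shows "pmf (p l (0, s)) n = (if n = 0 then 1 else 0)" "pmf (p l (s, 0)) n = (if n = 0 then 1 else 0)"
proof -
  have *: "pmf q n = (if n = 0 then 1 else 0)" if q: "pmf q 0 = 1" for q :: "nat pmf"
  proof (cases "n = 0")
    case False
    have "pmf q 0 + pmf q n = measure (measure_pmf q) {0, n}"
      using False by (simp add: measure_measure_pmf_finite)
    also have "\<dots> \<le> 1" by (rule measure_pmf.prob_le_1)
    finally show ?thesis using q pmf_nonneg [of q n] False by simp
  qed (use q in simp)
  have "state_prob p l (0, s) 0 = 1" "state_prob p l (s, 0) 0 = 1"
    using solves assms by (simp_all add: solves_STFPRF_equation_def)
  then have "pmf (p l (0, s)) 0 = 1" "pmf (p l (s, 0)) 0 = 1" by (simp_all add: state_prob_def)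
  note ones = this
  show "pmf (p l (0, s)) n = (if n = 0 then 1 else 0)" "pmf (p l (s, 0)) n = (if n = 0 then 1 else 0)"
    by (rule * [OF ones(1)], rule * [OF ones(2)])
qed

definition rhs :: "nat \<Rightarrow> real \<Rightarrow> real \<times> real \<Rightarrow> real" where
  "rhs n l t = - (l powr (\<beta> + 1) / \<beta> * truncated_difference \<beta> (\<lambda>k. dp k l t) n
      + l powr \<beta> * truncated_difference \<beta> (pmf (p l t)) n)"

text \<open>The derivative in \<open>l\<close> of \<open>l\<^sup>\<beta> (I - B)\<^sup>\<beta> p\<close>.\<close>
definition flux_deriv :: "nat \<Rightarrow> real \<Rightarrow> real \<times> real \<Rightarrow> real" where
  "flux_deriv n l t = l powr \<beta> * truncated_difference \<beta> (\<lambda>k. dp k l t) n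
      + \<beta> * l powr (\<beta> - 1) * truncated_difference \<beta> (pmf (p l t)) n"

lemma flux_deriv_rhs:
  assumes "0 < l"
  shows "flux_deriv n l t = - (\<beta> / l) * rhs n l t"
proof -
  have "P * A + \<beta> * (P / l) * C = - (\<beta> / l) * - (P * l / \<beta> * A + P * C)" for P A C
    using assms \<beta> by (simp add: field_simps)
  then show ?thesis using assms by (simp add: flux_deriv_def rhs_def powr_add powr_diff)
qed

lemma flux_has_derivative:
  assumes "0 < l" "t \<in> R2plus"
  shows "((\<lambda>m. m powr \<beta> * truncated_difference \<beta> (pmf (p m t)) n) has_real_derivative flux_deriv n l t) (at l)"
proof -
  have "((\<lambda>m. truncated_difference \<beta> (pmf (p m t)) n) has_real_derivative
      truncated_difference \<beta> (\<lambda>k. dp k l t) n) (at l)"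
    unfolding truncated_difference_def by (intro DERIV_sum DERIV_cmult p_deriv assms)
  from DERIV_mult [OF has_real_derivative_powr [OF assms(1), of \<beta>] this]
  show ?thesis by (rule DERIV_cong) (simp add: flux_deriv_def)
qed

lemma deriv_fractional_difference:
  assumes "0 < l" "t \<in> R2plus"
  shows "deriv (\<lambda>m. fractional_difference \<beta> (state_prob p m t) (int n)) l
     = truncated_difference \<beta> (\<lambda>k. dp k l t) n"
  unfolding fractional_difference_state_prob truncated_difference_def
  by (intro DERIV_imp_deriv DERIV_sum DERIV_cmult p_deriv assms)

lemma truncated_difference_continuous:
  assumes "\<And>k. continuous_on A (\<lambda>x. f x k)"
  shows "continuous_on A (\<lambda>x. truncated_difference \<beta> (f x) n)"
  unfolding truncated_difference_def by (intro continuous_intros assms)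

lemma flux_deriv_continuous: "continuous_on ({0<..} \<times> R2plus) (\<lambda>(l, t). flux_deriv n l t)"
  and rhs_continuous: "continuous_on ({0<..} \<times> R2plus) (\<lambda>(l, t). rhs n l t)"
proof -
  have 1: "continuous_on ({0<..} \<times> R2plus) (\<lambda>x. truncated_difference \<beta> (\<lambda>k. dp k (fst x) (snd x)) n)"
    by (rule truncated_difference_continuous) (use dp_continuous in \<open>simp add: split_beta\<close>)
  have 2: "continuous_on ({0<..} \<times> R2plus) (\<lambda>x. truncated_difference \<beta> (pmf (p (fst x) (snd x))) n)"
    by (rule truncated_difference_continuous) (use p_continuous in \<open>simp add: split_beta\<close>)
  have 3: "continuous_on ({0<..} \<times> R2plus) (\<lambda>x :: real \<times> real \<times> real. fst x powr c)" for c :: real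
    by (rule continuous_on_powr) (auto intro!: continuous_intros)
  show "continuous_on ({0<..} \<times> R2plus) (\<lambda>(l, t). flux_deriv n l t)"
    "continuous_on ({0<..} \<times> R2plus) (\<lambda>(l, t). rhs n l t)"
    unfolding flux_deriv_def rhs_def split_beta using \<beta> by (intro continuous_intros 1 2 3; simp)+
qed

lemma continuous_indicator_measurable:
  fixes f :: "real \<times> real \<times> real \<Rightarrow> real"
  assumes "continuous_on A f" "A \<in> sets borel"
  shows "(\<lambda>x. indicator A x * f x) \<in> borel_measurable borel"
  using borel_measurable_continuous_on_indicator [OF assms(2,1)] by simp

lemma rhs_bounded:
  assumes "0 < a"
  obtains B where "\<And>l s1 s2. l \<in> {a..b} \<Longrightarrow> s1 \<in> {0..T1} \<Longrightarrow> s2 \<in> {0..T2} \<Longrightarrow> \<bar>rhs n l (s1, s2)\<bar> \<le> B"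
proof -
  have "continuous_on ({a..b} \<times> {0..T1} \<times> {0..T2}) (\<lambda>(l, t). rhs n l t)"
    by (rule continuous_on_subset [OF rhs_continuous]) (use assms in auto)
  then have "bounded ((\<lambda>(l, t). rhs n l t) ` ({a..b} \<times> {0..T1} \<times> {0..T2}))"
    by (intro compact_imp_bounded compact_continuous_image compact_Times) auto
  then obtain B where B: "\<forall>x\<in>(\<lambda>(l, t). rhs n l t) ` ({a..b} \<times> {0..T1} \<times> {0..T2}). norm x \<le> B"
    unfolding bounded_iff by blast
  show thesis
  proof (rule that)
    fix l s1 s2 assume "l \<in> {a..b}" "s1 \<in> {0..T1}" "s2 \<in> {0..T2}"
    then have "(\<lambda>(l, t). rhs n l t) (l, s1, s2) \<in> (\<lambda>(l, t). rhs n l t) ` ({a..b} \<times> {0..T1} \<times> {0..T2})"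
      by (intro imageI) simp
    with B show "\<bar>rhs n l (s1, s2)\<bar> \<le> B" by (metis case_prod_conv real_norm_def)
  qed
qed

text \<open>Cut off to a box, since nothing bounds the right-hand side for large times or small rates.\<close>
definition boxed_rhs :: "nat \<Rightarrow> real \<Rightarrow> real \<Rightarrow> real \<Rightarrow> real \<Rightarrow> real \<Rightarrow> real \<Rightarrow> real \<Rightarrow> real" where
  "boxed_rhs n a b T1 T2 l s1 s2 = indicator ({a..b} \<times> {0..T1} \<times> {0..T2}) (l, s1, s2) * rhs n l (s1, s2)"

lemma boxed_rhs_measurable:
  assumes "0 < a"
  shows "(\<lambda>(l, s1, s2). boxed_rhs n a b T1 T2 l s1 s2) \<in> borel_measurable borel"
proof -
  have "continuous_on ({a..b} \<times> {0..T1} \<times> {0..T2}) (\<lambda>(l, t). rhs n l t)"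
    by (rule continuous_on_subset [OF rhs_continuous]) (use assms in auto)
  from continuous_indicator_measurable [OF this]
  have "(\<lambda>x. indicator ({a..b} \<times> {0..T1} \<times> {0..T2}) x * (\<lambda>(l, t). rhs n l t) x) \<in> borel_measurable borel"
    by (simp add: borel_closed closed_Times)
  moreover have "(\<lambda>x. indicator ({a..b} \<times> {0..T1} \<times> {0..T2}) x * (\<lambda>(l, t). rhs n l t) x)
      = (\<lambda>(l, s1, s2). boxed_rhs n a b T1 T2 l s1 s2)"
    by (auto simp: boxed_rhs_def)
  ultimately show ?thesis by (simp only:)
qed

lemma boxed_rhs_bounded:
  assumes "0 < a"
  obtains B where "\<And>l s1 s2. \<bar>boxed_rhs n a b T1 T2 l s1 s2\<bar> \<le> B"
proof -
  obtain B where B: "\<And>l s1 s2. l \<in> {a..b} \<Longrightarrow> s1 \<in> {0..T1} \<Longrightarrow> s2 \<in> {0..T2} \<Longrightarrow> \<bar>rhs n l (s1, s2)\<bar> \<le> B"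
    by (rule rhs_bounded [OF assms]) blast
  show thesis
  proof (rule that)
    fix l s1 s2 show "\<bar>boxed_rhs n a b T1 T2 l s1 s2\<bar> \<le> \<bar>B\<bar>"
      using B [of l s1 s2] by (auto simp: boxed_rhs_def indicator_def)
  qed
qed

text \<open>The outer derivative, in \<open>t2\<close>, is inverted first, starting from
  \<open>D s1 0 = 0\<close>; then the derivative in \<open>t1\<close>, starting from the prescribed
  value at \<open>t1 = 0\<close>. The boxed right-hand side supplies the measurability and the
  bounds that make the integrands integrable.\<close>

lemma pointwise_equation:
  assumes l: "0 < l" and t: "0 < t1" "0 < t2"
  shows "pmf (p l (t1, t2)) n - (if n = 0 then 1 else 0)
     = rl_integral \<alpha>1 (\<lambda>s1. rl_integral \<alpha>2 (\<lambda>s2. rhs n l (s1, s2)) t2) t1"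
proof -
  obtain D where D: "\<And>t2. 0 \<le> t2 \<Longrightarrow> has_caputo_deriv \<alpha>1 (\<lambda>t1. pmf (p l (t1, t2)) n) (\<lambda>t1. D t1 t2)"
    "\<And>t1. 0 < t1 \<Longrightarrow> has_caputo_deriv \<alpha>2 (\<lambda>t2. D t1 t2)
           (\<lambda>t2. - (l powr (\<beta> + 1) / \<beta> *
                      deriv (\<lambda>m. fractional_difference \<beta> (state_prob p m (t1, t2)) (int n)) l
                    + l powr \<beta> * fractional_difference \<beta> (state_prob p l (t1, t2)) (int n)))"
    using solves [unfolded solves_STFPRF_equation_def, THEN conjunct2, THEN conjunct1, rule_format, of "int n" l] l
    unfolding state_prob_int by auto
  \<comment> \<open>The rate interval of the box is the single point \<open>l\<close>; only the
    times need room here.\<close>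
  let ?X = "boxed_rhs n l l t1 t2 l"
  have X: "?X s1 s2 = rhs n l (s1, s2)" if "0 \<le> s1" "s1 \<le> t1" "0 \<le> s2" "s2 \<le> t2" for s1 s2
    using that by (simp add: boxed_rhs_def)
  obtain B where B: "\<And>l' s1 s2. \<bar>boxed_rhs n l l t1 t2 l' s1 s2\<bar> \<le> B"
    by (rule boxed_rhs_bounded [OF l]) blast
  have Xm: "(\<lambda>(a :: real, b, c). ?X b c) \<in> borel_measurable borel"
    unfolding split_beta
    by (rule borel_measurable_compose3 [OF boxed_rhs_measurable [OF l], where f = "\<lambda>_. l" and
          g = "\<lambda>x. fst (snd x)" and h = "\<lambda>x. snd (snd x)"]) (simp_all add: borel_prod [symmetric])
  have X1m: "?X s1 \<in> borel_measurable borel" for s1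
    by (rule borel_measurable_compose3 [OF boxed_rhs_measurable [OF l]]) simp_all
  have D0: "D s1 0 = 0" if "0 < s1" for s1
    by (rule has_caputo_deriv_const [OF \<alpha>1 D(1), where c = "if n = 0 then 1 else 0"])
       (use p_axes(2) [OF l] that in simp_all)
  have step2: "D s1 t2 = rl_integral \<alpha>2 (\<lambda>s2. rhs n l (s1, s2)) t2" if s1: "0 < s1" "s1 \<le> t1" for s1
  proof -
    define h where "h s2 = - (l powr (\<beta> + 1) / \<beta> *
                      deriv (\<lambda>m. fractional_difference \<beta> (state_prob p m (s1, s2)) (int n)) l
                    + l powr \<beta> * fractional_difference \<beta> (state_prob p l (s1, s2)) (int n))" for s2
    have h: "h s2 = rhs n l (s1, s2)" if "0 < s2" for s2
      unfolding h_def rhs_def fractional_difference_state_prob [of \<beta> p l]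
      using deriv_fractional_difference [OF l, of "(s1, s2)" n] s1 that by simp
    have "set_integrable lborel {0<..<t2} (?X s1)"
    proof (rule set_integrable_bounded [OF _ B])
      show "(\<lambda>t. indicator {0<..} t * ?X s1 t) \<in> borel_measurable borel" using X1m [of s1] by measurable
    qed
    moreover have "indicator {0<..<t2} s *\<^sub>R ?X s1 s = indicator {0<..<t2} s *\<^sub>R h s" for s
      using X [of s1 s] h [of s] s1 by (simp add: indicator_def)
    ultimately have "set_integrable lborel {0<..<t2} h" by (simp only: set_integrable_def)
    then have "D s1 t2 = D s1 0 + rl_integral \<alpha>2 h t2"
      using caputo_inversion [OF \<alpha>2 D(2) [OF s1(1)] t(2)] unfolding h_def by simp
    also have "rl_integral \<alpha>2 h t2 = rl_integral \<alpha>2 (\<lambda>s2. rhs n l (s1, s2)) t2"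
      by (rule rl_integral_cong) (rule h)
    finally show ?thesis using D0 [OF s1(1)] by simp
  qed
  have XD: "rl_integral \<alpha>2 (?X s1) t2 = D s1 t2" if "0 < s1" "s1 \<le> t1" for s1
    unfolding step2 [OF that] by (rule rl_integral_cong) (use X that in simp)
  have "(\<lambda>s1. rl_integral \<alpha>2 (?X s1) t2) \<in> borel_measurable borel"
    by (rule borel_measurable_compose2 [OF rl_integral_measurable [OF Xm], where f = "\<lambda>_. 0" and g = "\<lambda>x. x"]) simp_all
  then have m: "(\<lambda>s1. indicator {0<..} s1 * rl_integral \<alpha>2 (?X s1) t2) \<in> borel_measurable borel"
    by (intro borel_measurable_times borel_measurable_indicator) simp_all
  have "set_integrable lborel {0<..<t1} (\<lambda>s1. rl_integral \<alpha>2 (?X s1) t2)"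
    by (rule set_integrable_bounded [OF m rl_integrable_bounded(2) [OF \<alpha>2(1) t(2) X1m B]])
  moreover have "indicator {0<..<t1} s *\<^sub>R rl_integral \<alpha>2 (?X s) t2 = indicator {0<..<t1} s *\<^sub>R D s t2" for s
    using XD [of s] by (simp add: indicator_def)
  ultimately have "set_integrable lborel {0<..<t1} (\<lambda>s1. D s1 t2)" by (simp only: set_integrable_def)
  then have "pmf (p l (t1, t2)) n = pmf (p l (0, t2)) n + rl_integral \<alpha>1 (\<lambda>s1. D s1 t2) t1"
    using caputo_inversion [OF \<alpha>1 D(1) t(1)] t(2) by simp
  also have "rl_integral \<alpha>1 (\<lambda>s1. D s1 t2) t1 = rl_integral \<alpha>1 (\<lambda>s1. rl_integral \<alpha>2 (\<lambda>s2. rhs n l (s1, s2)) t2) t1"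
    by (rule rl_integral_cong) (use step2 in simp)
  finally show ?thesis using p_axes(1) [OF l, of t2 n] t(2) by simp
qed

lemma rate_integral_flux_deriv:
  assumes "0 < a" "a \<le> b" "t \<in> R2plus"
  shows "(\<integral>l. indicator {a..b} l * flux_deriv n l t \<partial>lborel)
    = b powr \<beta> * truncated_difference \<beta> (pmf (p b t)) n - a powr \<beta> * truncated_difference \<beta> (pmf (p a t)) n"
proof -
  have "continuous_on {a..b} (\<lambda>l. (\<lambda>(l, t). flux_deriv n l t) (l, t))"
    by (rule continuous_on_compose2 [OF flux_deriv_continuous]) (use assms in \<open>auto intro!: continuous_intros\<close>)
  then have "continuous_on {a..b} (\<lambda>l. flux_deriv n l t)" by simp
  moreover have "((\<lambda>m. m powr \<beta> * truncated_difference \<beta> (pmf (p m t)) n) has_vector_derivative flux_deriv n l t)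
      (at l within {a..b})" if "a \<le> l" "l \<le> b" for l
    using flux_has_derivative [of l t n] assms that
    by (simp add: has_real_derivative_iff_has_vector_derivative [symmetric] has_field_derivative_at_within)
  ultimately show ?thesis
    using integral_FTC_Icc [OF assms(2), of "\<lambda>m. m powr \<beta> * truncated_difference \<beta> (pmf (p m t)) n" "\<lambda>l. flux_deriv n l t"]
    by simp
qed

definition flux_increment :: "nat \<Rightarrow> real \<Rightarrow> real \<Rightarrow> real \<Rightarrow> real \<Rightarrow> real" where
  "flux_increment n a b s1 s2 = indicator R2plus (s1, s2) *
     (b powr \<beta> * truncated_difference \<beta> (pmf (p b (s1, s2))) n
      - a powr \<beta> * truncated_difference \<beta> (pmf (p a (s1, s2))) n)"

text \<open>Multiplication by \<open>- (\<beta> / l)\<close> makes the right-hand side an exact rate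
  derivative. Fubini moves the rate integral through both fractional integrals, and what remains
  contains only state probabilities at the rates \<open>a\<close> and \<open>b\<close>.\<close>

lemma integrated_equation:
  assumes ab: "0 < a" "a \<le> b" and t: "0 < t1" "0 < t2"
  shows "(\<integral>l. indicator {a..b} l * (- (\<beta> / l) * (pmf (p l (t1, t2)) n - (if n = 0 then 1 else 0))) \<partial>lborel)
     = rl_integral \<alpha>1 (\<lambda>s1. rl_integral \<alpha>2 (flux_increment n a b s1) t2) t1"
proof -
  let ?X = "boxed_rhs n a b t1 t2"
  obtain B where B: "\<And>l s1 s2. \<bar>?X l s1 s2\<bar> \<le> B"
    by (rule boxed_rhs_bounded [OF ab(1)]) blast
  note Xm = boxed_rhs_measurable [OF ab(1), of n b t1 t2]
  have X1m: "?X l s1 \<in> borel_measurable borel" for l s1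
    by (rule borel_measurable_compose3 [OF Xm]) simp_all
  have Xlm: "(\<lambda>(l, s2). ?X l s1 s2) \<in> borel_measurable borel" for s1
    unfolding split_beta
    by (rule borel_measurable_compose3 [OF Xm, where f = fst and g = "\<lambda>_. s1" and h = snd])
       (simp_all add: borel_prod [symmetric])
  define w where "w l = indicator {a..b} l * (- (\<beta> / l))" for l
  have w: "integrable lborel w"
  proof -
    have "set_integrable lborel {a..b} (\<lambda>l. - (\<beta> / l))"
      using ab by (intro borel_integrable_atLeastAtMost') (auto intro!: continuous_intros)
    then show ?thesis unfolding set_integrable_def w_def [abs_def] by simp
  qed
  have "indicator {a..b} l * (- (\<beta> / l) * (pmf (p l (t1, t2)) n - (if n = 0 then 1 else 0)))
      = w l * rl_integral \<alpha>1 (\<lambda>s1. rl_integral \<alpha>2 (?X l s1) t2) t1" for l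
  proof (cases "l \<in> {a..b}")
    case True
    then have "0 < l" using ab by auto
    have "rl_integral \<alpha>1 (\<lambda>s1. rl_integral \<alpha>2 (?X l s1) t2) t1
        = rl_integral \<alpha>1 (\<lambda>s1. rl_integral \<alpha>2 (\<lambda>s2. rhs n l (s1, s2)) t2) t1"
      by (intro rl_integral_cong) (use True in \<open>simp add: boxed_rhs_def\<close>)
    then show ?thesis using pointwise_equation [OF \<open>0 < l\<close> t, of n] by (simp add: w_def)
  qed (simp add: w_def)
  then have "(\<integral>l. indicator {a..b} l * (- (\<beta> / l) * (pmf (p l (t1, t2)) n - (if n = 0 then 1 else 0))) \<partial>lborel)
      = (\<integral>l. w l * rl_integral \<alpha>1 (\<lambda>s1. rl_integral \<alpha>2 (?X l s1) t2) t1 \<partial>lborel)"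
    by simp
  also have "\<dots> = rl_integral \<alpha>1 (\<lambda>s1. \<integral>l. w l * rl_integral \<alpha>2 (?X l s1) t2 \<partial>lborel) t1"
    by (rule rl_integral_swap [OF \<alpha>1(1) t(1) w rl_integral_measurable [OF Xm] rl_integrable_bounded(2) [OF \<alpha>2(1) t(2) X1m B]])
  also have "\<dots> = rl_integral \<alpha>1 (\<lambda>s1. rl_integral \<alpha>2 (\<lambda>s2. \<integral>l. w l * ?X l s1 s2 \<partial>lborel) t2) t1"
    by (simp only: rl_integral_swap [OF \<alpha>2(1) t(2) w Xlm B])
  also have "\<dots> = rl_integral \<alpha>1 (\<lambda>s1. rl_integral \<alpha>2 (flux_increment n a b s1) t2) t1"
  proof (intro rl_integral_cong)
    fix s1 s2 assume s: "0 < s1" "s1 < t1" "0 < s2" "s2 < t2"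
    have "w l * ?X l s1 s2 = indicator {a..b} l * flux_deriv n l (s1, s2)" for l
      using flux_deriv_rhs [of l n "(s1, s2)"] ab s by (auto simp: w_def boxed_rhs_def indicator_def)
    then show "(\<integral>l. w l * ?X l s1 s2 \<partial>lborel) = flux_increment n a b s1 s2"
      using rate_integral_flux_deriv [OF ab, of "(s1, s2)" n] s by (simp add: flux_increment_def)
  qed
  finally show ?thesis .
qed

end

section \<open>The ordinary differential equation in the rate\<close>

definition laplace2 :: "real \<Rightarrow> real \<Rightarrow> (real \<Rightarrow> real \<Rightarrow> real) \<Rightarrow> real" where
  "laplace2 z1 z2 f = laplace z2 (\<lambda>t2. laplace z1 (\<lambda>t1. f t1 t2))"

lemma laplace2_cong:
  "(\<And>t1 t2. 0 < t1 \<Longrightarrow> 0 < t2 \<Longrightarrow> f t1 t2 = g t1 t2) \<Longrightarrow> laplace2 z1 z2 f = laplace2 z1 z2 g"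
  unfolding laplace2_def by (intro laplace_cong)

lemma laplace2_abs_le:
  assumes "0 < z1" "0 < z2" "\<And>t1 t2. 0 < t1 \<Longrightarrow> 0 < t2 \<Longrightarrow> \<bar>f t1 t2\<bar> \<le> B"
  shows "\<bar>laplace2 z1 z2 f\<bar> \<le> B / (z1 * z2)"
  using laplace_abs_le [OF assms(2) laplace_abs_le [OF assms(1)], of "\<lambda>t2 t1. f t1 t2" B] assms(3)
  by (simp add: laplace2_def)

lemma laplace2_const: "0 < z1 \<Longrightarrow> 0 < z2 \<Longrightarrow> laplace2 z1 z2 (\<lambda>t1 t2. c) = c / (z1 * z2)"
  by (simp add: laplace2_def laplace_const)

lemma laplace2_cmult: "laplace2 z1 z2 (\<lambda>t1 t2. c * f t1 t2) = c * laplace2 z1 z2 f"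
  by (simp add: laplace2_def laplace_cmult)

context
  fixes z1 z2 :: real
  assumes z: "0 < z1" "0 < z2"
begin

lemma laplace2_integrable:
  assumes m: "(\<lambda>(t1, t2). f t1 t2) \<in> borel_measurable borel" and B: "\<And>t1 t2. \<bar>f t1 t2\<bar> \<le> B"
  shows "integrable lborel (\<lambda>t1. indicator {0<..} t1 * exp (- z1 * t1) * f t1 t2)"
    and "integrable lborel (\<lambda>t2. indicator {0<..} t2 * exp (- z2 * t2) * laplace z1 (\<lambda>t1. f t1 t2))"
proof -
  have "(\<lambda>t1. f t1 t2) \<in> borel_measurable borel" for t2
    by (rule borel_measurable_compose2 [OF m]) simp_all
  then have "(\<lambda>t1. indicator {0<..} t1 * f t1 t2) \<in> borel_measurable borel" for t2
    by (intro borel_measurable_times borel_measurable_indicator) simp_all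
  from laplace_integrable_bounded [OF z(1) this B]
  show "integrable lborel (\<lambda>t1. indicator {0<..} t1 * exp (- z1 * t1) * f t1 t2)" .
  have "(\<lambda>(t2, t1). f t1 t2) \<in> borel_measurable borel"
    unfolding split_beta by (rule borel_measurable_compose2 [OF m]) (simp_all add: borel_prod [symmetric])
  from laplace_measurable [OF this]
  have "(\<lambda>t2. indicator {0<..} t2 * laplace z1 (\<lambda>t1. f t1 t2)) \<in> borel_measurable borel"
    by (intro borel_measurable_times borel_measurable_indicator) simp_all
  from laplace_integrable_bounded [OF z(2) this laplace_abs_le [OF z(1) B]]
  show "integrable lborel (\<lambda>t2. indicator {0<..} t2 * exp (- z2 * t2) * laplace z1 (\<lambda>t1. f t1 t2))" .
qed

lemma laplace2_diff:
  assumes "(\<lambda>(t1, t2). f t1 t2) \<in> borel_measurable borel" "\<And>t1 t2. \<bar>f t1 t2\<bar> \<le> B"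
    and "(\<lambda>(t1, t2). g t1 t2) \<in> borel_measurable borel" "\<And>t1 t2. \<bar>g t1 t2\<bar> \<le> B'"
  shows "laplace2 z1 z2 (\<lambda>t1 t2. f t1 t2 - g t1 t2) = laplace2 z1 z2 f - laplace2 z1 z2 g"
proof -
  have "laplace z1 (\<lambda>t1. f t1 t2 - g t1 t2) = laplace z1 (\<lambda>t1. f t1 t2) - laplace z1 (\<lambda>t1. g t1 t2)" for t2
    using laplace2_integrable(1) [OF assms(1,2), of t2] laplace2_integrable(1) [OF assms(3,4), of t2]
    by (simp add: laplace_def right_diff_distrib)
  then show ?thesis
    using laplace2_integrable(2) [OF assms(1,2)] laplace2_integrable(2) [OF assms(3,4)]
    by (simp add: laplace2_def laplace_def [of z2] right_diff_distrib)
qed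

lemma laplace2_sum:
  fixes n :: nat
  assumes "\<And>k. (\<lambda>(t1, t2). f k t1 t2) \<in> borel_measurable borel" "\<And>k t1 t2. \<bar>f k t1 t2\<bar> \<le> B"
  shows "laplace2 z1 z2 (\<lambda>t1 t2. \<Sum>k\<le>n. a k * f k t1 t2) = (\<Sum>k\<le>n. a k * laplace2 z1 z2 (f k))"
  unfolding laplace2_def laplace_sum_cmult(1) [OF laplace2_integrable(1) [OF assms]]
  by (rule laplace_sum_cmult(1) [OF laplace2_integrable(2) [OF assms]])

lemma laplace2_tendsto:
  fixes f :: "nat \<Rightarrow> real \<Rightarrow> real \<Rightarrow> real"
  assumes m: "\<And>k. (\<lambda>(t1, t2). f k t1 t2) \<in> borel_measurable borel" and B: "\<And>k t1 t2. \<bar>f k t1 t2\<bar> \<le> B"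
    and l: "\<And>t1 t2. 0 < t1 \<Longrightarrow> 0 < t2 \<Longrightarrow> (\<lambda>k. f k t1 t2) \<longlonglongrightarrow> g t1 t2"
  shows "(\<lambda>k. laplace2 z1 z2 (f k)) \<longlonglongrightarrow> laplace2 z1 z2 g"
  unfolding laplace2_def
proof (rule laplace_tendsto [OF z(2)])
  have m1: "(\<lambda>t1. f k t1 t2) \<in> borel_measurable borel" for k t2
    by (rule borel_measurable_compose2 [OF m]) simp_all
  have m2: "(\<lambda>(t2, t1). f k t1 t2) \<in> borel_measurable borel" for k
    unfolding split_beta by (rule borel_measurable_compose2 [OF m]) (simp_all add: borel_prod [symmetric])
  show "(\<lambda>t2. indicator {0<..} t2 * laplace z1 (\<lambda>t1. f k t1 t2)) \<in> borel_measurable borel" for k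
    using laplace_measurable [OF m2, of z1 k] by (intro borel_measurable_times borel_measurable_indicator) simp_all
  show "\<bar>laplace z1 (\<lambda>t1. f k t1 t2)\<bar> \<le> B / z1" for k t2
    by (rule laplace_abs_le [OF z(1) B])
  show "(\<lambda>k. laplace z1 (\<lambda>t1. f k t1 t2)) \<longlonglongrightarrow> laplace z1 (\<lambda>t1. g t1 t2)" if "0 < t2" for t2
  proof (rule laplace_tendsto [OF z(1) _ B l])
    show "(\<lambda>t1. indicator {0<..} t1 * f k t1 t2) \<in> borel_measurable borel" for k
      using m1 by (intro borel_measurable_times borel_measurable_indicator) simp_all
  qed (use that in simp_all)
qed

lemma laplace2_integral_swap:
  fixes G :: "real \<Rightarrow> real \<Rightarrow> real \<Rightarrow> real"
  assumes w: "integrable lborel w"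
    and m: "(\<lambda>(l, t1, t2). G l t1 t2) \<in> borel_measurable borel" and B: "\<And>l t1 t2. \<bar>G l t1 t2\<bar> \<le> B"
  shows "laplace2 z1 z2 (\<lambda>t1 t2. \<integral>l. w l * G l t1 t2 \<partial>lborel) = (\<integral>l. w l * laplace2 z1 z2 (G l) \<partial>lborel)"
proof -
  have m1: "(\<lambda>(l, t1). G l t1 t2) \<in> borel_measurable borel" for t2
    unfolding split_beta by (rule borel_measurable_compose3 [OF m]) (simp_all add: borel_prod [symmetric])
  have [measurable]: "(\<lambda>y. G (fst (fst y)) (snd y) (snd (fst y)))
      \<in> borel_measurable ((borel \<Otimes>\<^sub>M borel) \<Otimes>\<^sub>M lborel)"
    by (rule borel_measurable_compose3 [OF m]) measurable
  have "(\<lambda>(x, s). indicator {0<..} s * exp (- z1 * s) * G (fst x) s (snd x))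
      \<in> borel_measurable ((borel \<Otimes>\<^sub>M borel) \<Otimes>\<^sub>M lborel)"
    unfolding split_beta by measurable
  from lborel.borel_measurable_lebesgue_integral [OF this]
  have m2: "(\<lambda>(l, t2). laplace z1 (\<lambda>t1. G l t1 t2)) \<in> borel_measurable borel"
    unfolding borel_prod laplace_def split_beta .
  have "laplace2 z1 z2 (\<lambda>t1 t2. \<integral>l. w l * G l t1 t2 \<partial>lborel)
      = laplace z2 (\<lambda>t2. \<integral>l. w l * laplace z1 (\<lambda>t1. G l t1 t2) \<partial>lborel)"
    unfolding laplace2_def by (simp only: laplace_integral_swap [OF z(1) w m1 B])
  also have "\<dots> = (\<integral>l. w l * laplace2 z1 z2 (G l) \<partial>lborel)"
    unfolding laplace2_def by (rule laplace_integral_swap [OF z(2) w m2 laplace_abs_le [OF z(1) B]])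
  finally show ?thesis .
qed

end

text \<open>
  \<open>d/dl (l\<^sup>\<beta> Y) = - \<kappa> (\<beta> / l) (Y - C)\<close> in integrated form. For the difference of two solutions,
  \<open>l\<^sup>\<beta> (X - Y) exp (- \<kappa> l\<^sup>-\<^sup>\<beta>)\<close> is constant, and boundedness makes it tend to 0 as \<open>l\<close> does.
\<close>
definition rate_equation :: "real \<Rightarrow> real \<Rightarrow> real \<Rightarrow> (real \<Rightarrow> real) \<Rightarrow> bool" where
  "rate_equation \<beta> \<kappa> C Y \<longleftrightarrow> (\<forall>a b. 0 < a \<longrightarrow> a \<le> b \<longrightarrow>
     ((\<lambda>l. - (\<beta> / l) * (Y l - C)) has_integral (b powr \<beta> * Y b - a powr \<beta> * Y a) / \<kappa>) {a..b})"

lemma rate_equation_unique: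
  assumes \<beta>: "0 < \<beta>" and \<kappa>: "0 < \<kappa>" and X: "rate_equation \<beta> \<kappa> C X" and Y: "rate_equation \<beta> \<kappa> C Y"
    and B: "\<And>l. 0 < l \<Longrightarrow> \<bar>X l\<bar> \<le> B" "\<And>l. 0 < l \<Longrightarrow> \<bar>Y l\<bar> \<le> B" and "0 < l"
  shows "X l = Y l"
proof -
  define f where "f l = l powr \<beta> * (X l - Y l)" for l
  define \<phi> where "\<phi> l = - (\<kappa> * \<beta>) * (l powr (- \<beta> - 1) * f l)" for l
  have I: "(\<phi> has_integral f b - f a) {a..b}" if "0 < a" "a \<le> b" for a b
  proof -
    have "((\<lambda>l. \<kappa> * ((- (\<beta> / l) * (X l - C)) - (- (\<beta> / l) * (Y l - C)))) has_integral
        \<kappa> * ((b powr \<beta> * X b - a powr \<beta> * X a) / \<kappa> - (b powr \<beta> * Y b - a powr \<beta> * Y a) / \<kappa>)) {a..b}"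
      using X Y that unfolding rate_equation_def by (intro has_integral_mult_right has_integral_diff) auto
    moreover have "\<kappa> * ((b powr \<beta> * X b - a powr \<beta> * X a) / \<kappa> - (b powr \<beta> * Y b - a powr \<beta> * Y a) / \<kappa>) = f b - f a"
      using \<kappa> by (simp add: f_def field_simps)
    moreover have "\<kappa> * ((- (\<beta> / l) * (X l - C)) - (- (\<beta> / l) * (Y l - C))) = \<phi> l" if "l \<in> {a..b}" for l
    proof -
      have "l powr (- \<beta> - 1) * l powr \<beta> = 1 / l"
        using that \<open>0 < a\<close> by (simp add: powr_minus_divide flip: powr_add)
      then have "\<phi> l = - (\<kappa> * \<beta>) * (1 / l * (X l - Y l))" by (simp add: \<phi>_def f_def flip: mult.assoc)
      then show ?thesis by (simp add: algebra_simps)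
    qed
    ultimately show ?thesis by (metis (no_types, lifting) has_integral_cong)
  qed
  \<comment> \<open>Regularity comes from the integral equation itself: as an indefinite integral
    \<open>f\<close> is continuous, which makes \<open>\<phi>\<close> continuous, and therefore
    \<open>f\<close> differentiable.\<close>
  have fc: "continuous_on {a..b} f" if "0 < a" "a \<le> b" for a b
  proof -
    have "continuous_on {a..b} (\<lambda>x. f a + integral {a..x} \<phi>)"
      using I [OF that] by (intro continuous_intros indefinite_integral_continuous_1) (auto simp: has_integral_integrable)
    then show ?thesis
      by (rule continuous_on_eq) (use integral_unique [OF I [OF that(1)]] in auto)
  qed
  have fd: "(f has_real_derivative \<phi> l) (at l)" if "0 < l" for l
  proof -
    let ?a = "l / 2" and ?b = "2 * l"
    have ab: "0 < ?a" "?a \<le> ?b" "?a < l" "l < ?b" using that by auto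
    have "continuous_on {?a..?b} \<phi>"
      unfolding \<phi>_def using ab by (intro continuous_intros fc) auto
    then have "((\<lambda>x. integral {?a..x} \<phi>) has_real_derivative \<phi> l) (at l within {?a..?b})"
      using ab by (intro integral_has_real_derivative) auto
    then have "((\<lambda>x. f ?a + integral {?a..x} \<phi>) has_real_derivative \<phi> l) (at l within {?a..?b})"
      by (auto intro!: derivative_eq_intros)
    then have "(f has_real_derivative \<phi> l) (at l within {?a..?b})"
      by (rule has_field_derivative_transform_within [OF _ zero_less_one])
         (use ab integral_unique [OF I [OF ab(1)]] in auto)
    then show ?thesis using ab by (simp add: at_within_Icc_at)
  qed
  define h where "h l = f l * exp (- \<kappa> * l powr (- \<beta>))" for l
  have hd: "(h has_real_derivative 0) (at l)" if "0 < l" for l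
  proof -
    have e: "((\<lambda>l. exp (- \<kappa> * l powr (- \<beta>))) has_real_derivative
        exp (- \<kappa> * l powr (- \<beta>)) * (- \<kappa> * (- \<beta> * l powr (- \<beta> - 1)))) (at l)"
      by (intro DERIV_fun_exp DERIV_cmult has_real_derivative_powr that)
    show ?thesis
      unfolding h_def by (rule DERIV_cong [OF DERIV_mult [OF fd [OF that] e]]) (simp add: \<phi>_def algebra_simps)
  qed
  have hc: "h x = h y" if "0 < x" "0 < y" for x y
  proof -
    have "h z = h x" if "x \<le> z" "z \<le> y" "0 < x" "x < y" for x y z
      using that by (intro DERIV_isconst2 [of x y h]) (auto intro!: hd DERIV_isCont continuous_at_imp_continuous_on)
    from this [of x y y] this [of y x x] that show ?thesis by (cases x y rule: linorder_cases) auto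
  qed
  have B0: "0 \<le> B" using B(1) [of 1] by linarith
  have hb: "\<bar>h l\<bar> \<le> 2 * B * l powr \<beta>" if "0 < l" for l
  proof -
    have "\<bar>f l\<bar> \<le> l powr \<beta> * (2 * B)"
      unfolding f_def abs_mult using B [OF that] by (simp add: mult_left_mono)
    moreover have "exp (- \<kappa> * l powr (- \<beta>)) \<le> 1" using \<kappa> by simp
    ultimately have "\<bar>f l\<bar> * exp (- \<kappa> * l powr (- \<beta>)) \<le> (l powr \<beta> * (2 * B)) * 1"
      using B0 by (intro mult_mono) auto
    then show ?thesis by (simp add: h_def abs_mult ac_simps)
  qed
  have "h l = 0"
  proof -
    have "((\<lambda>x. x powr \<beta>) \<longlongrightarrow> 0) (at_right 0)" using \<beta> by real_asymp
    then have "((\<lambda>x. 2 * B * x powr \<beta>) \<longlongrightarrow> 0) (at_right 0)" by (rule tendsto_mult_right_zero)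
    moreover have "\<forall>\<^sub>F x in at_right 0. norm (h l) \<le> 2 * B * x powr \<beta>"
      unfolding eventually_at_filter using hb hc [OF _ \<open>0 < l\<close>] by (intro always_eventually) fastforce
    ultimately have "((\<lambda>x :: real. h l) \<longlongrightarrow> 0) (at_right 0)" by (rule Lim_null_comparison [rotated])
    then show ?thesis using tendsto_const_iff [of "at_right (0 :: real)" "h l" 0] by simp
  qed
  then have "f l = 0" by (simp add: h_def)
  then show ?thesis using \<open>0 < l\<close> by (simp add: f_def)
qed

text \<open>Up to the factor 1 / (z1 z2) and with \<tau> = c / (z1 z2), this is the double transform
  of exp(- c t1 t2): the first transform gives 1 / (z1 + c t2), and rescaling the second leaves the
  integral of e^-v / (1 + \<tau> v).\<close>

definition stieltjes :: "real \<Rightarrow> real" where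
  "stieltjes \<tau> = laplace 1 (\<lambda>v. 1 / (1 + \<tau> * v))"

lemma stieltjes_bounds:
  assumes "0 \<le> \<tau>"
  shows "\<bar>stieltjes \<tau>\<bar> \<le> 1"
proof -
  have "\<bar>1 / (1 + \<tau> * v)\<bar> \<le> 1" if "0 < v" for v
  proof -
    have "0 \<le> \<tau> * v" using assms that by simp
    then show ?thesis by (simp add: divide_simps)
  qed
  from laplace_abs_le [OF zero_less_one this] show ?thesis by (simp add: stieltjes_def)
qed

lemma laplace_rational_integrable:
  fixes \<sigma> \<tau> v :: real
  assumes "0 \<le> \<sigma>" "0 \<le> \<tau>"
  shows "integrable lborel (\<lambda>v. indicator {0<..} v * exp (- 1 * v) * (1 / ((1 + \<sigma> * v) * (1 + \<tau> * v))))"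
    and "0 < v \<Longrightarrow> \<bar>1 / ((1 + \<sigma> * v) * (1 + \<tau> * v))\<bar> \<le> 1"
    and "(\<lambda>v. indicator {0<..} v * (1 / ((1 + \<sigma> * v) * (1 + \<tau> * v)))) \<in> borel_measurable borel"
proof -
  show b: "\<bar>1 / ((1 + \<sigma> * v) * (1 + \<tau> * v))\<bar> \<le> 1" if "0 < v" for v
  proof -
    have "0 \<le> \<sigma> * v" "0 \<le> \<tau> * v" using assms that by auto
    then have "1 \<le> 1 + \<sigma> * v" "1 \<le> 1 + \<tau> * v" by linarith+
    then have "1 * 1 \<le> (1 + \<sigma> * v) * (1 + \<tau> * v)" by (intro mult_mono) auto
    then show ?thesis by (simp add: divide_le_eq)
  qed
  show m: "(\<lambda>v. indicator {0<..} v * (1 / ((1 + \<sigma> * v) * (1 + \<tau> * v)))) \<in> borel_measurable borel"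
    by measurable
  show "integrable lborel (\<lambda>v. indicator {0<..} v * exp (- 1 * v) * (1 / ((1 + \<sigma> * v) * (1 + \<tau> * v))))"
    by (rule laplace_integrable_bounded [OF zero_less_one m b])
qed

text \<open>The difference quotient is exactly the transform of
  \<open>1 / ((1 + \<sigma> * v) * (1 + \<tau> * v))\<close>, a function bounded by 1, so its limit
  follows by dominated convergence without differentiating under the integral.\<close>

lemma stieltjes_derivative:
  assumes "0 < \<tau>"
  shows "((\<lambda>\<tau>. \<tau> * stieltjes \<tau>) has_real_derivative laplace 1 (\<lambda>v. 1 / ((1 + \<tau> * v) * (1 + \<tau> * v)))) (at \<tau>)"
  unfolding has_field_derivative_iff
proof (subst tendsto_at_iff_sequentially, intro allI impI)
  fix X :: "nat \<Rightarrow> real"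
  assume X: "\<forall>i. X i \<in> UNIV - {\<tau>}" "X \<longlonglongrightarrow> \<tau>"
  have quot: "(\<sigma> * stieltjes \<sigma> - \<tau> * stieltjes \<tau>) / (\<sigma> - \<tau>) = laplace 1 (\<lambda>v. 1 / ((1 + \<sigma> * v) * (1 + \<tau> * v)))"
    if \<sigma>: "0 < \<sigma>" "\<sigma> \<noteq> \<tau>" for \<sigma>
  proof -
    have i: "integrable lborel (\<lambda>v. indicator {0<..} v * exp (- 1 * v) * (r * (1 / (1 + r * v))))" if "0 < r" for r :: real
      using integrable_mult_right [OF laplace_rational_integrable(1) [of 0 r], of r] that by (simp add: ac_simps)
    have "\<sigma> * stieltjes \<sigma> - \<tau> * stieltjes \<tau> = laplace 1 (\<lambda>v. \<sigma> * (1 / (1 + \<sigma> * v)) - \<tau> * (1 / (1 + \<tau> * v)))"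
      unfolding stieltjes_def laplace_cmult [symmetric]
      using i [OF \<sigma>(1)] i [OF assms] by (simp add: laplace_def right_diff_distrib)
    also have "\<dots> = laplace 1 (\<lambda>v. (\<sigma> - \<tau>) * (1 / ((1 + \<sigma> * v) * (1 + \<tau> * v))))"
    proof (rule laplace_cong)
      fix v :: real assume "0 < v"
      then have "1 + \<sigma> * v \<noteq> 0" "1 + \<tau> * v \<noteq> 0"
        using \<sigma> assms mult_pos_pos [of \<sigma> v] mult_pos_pos [of \<tau> v] by linarith+
      then show "\<sigma> * (1 / (1 + \<sigma> * v)) - \<tau> * (1 / (1 + \<tau> * v)) = (\<sigma> - \<tau>) * (1 / ((1 + \<sigma> * v) * (1 + \<tau> * v)))"
        by (simp add: divide_simps) (simp add: algebra_simps)
    qed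
    also have "\<dots> = (\<sigma> - \<tau>) * laplace 1 (\<lambda>v. 1 / ((1 + \<sigma> * v) * (1 + \<tau> * v)))" by (rule laplace_cmult)
    finally show ?thesis using \<sigma>(2) by simp
  qed
  have pos: "\<forall>\<^sub>F i in sequentially. 0 < X i" using X(2) assms by (rule order_tendstoD)
  \<comment> \<open>Replaces the finitely many nonpositive terms, so that the bound by 1 holds along
    the whole sequence.\<close>
  define Z where "Z i = (if 0 < X i then X i else \<tau>)" for i
  have Z: "0 \<le> Z i" for i using assms by (simp add: Z_def)
  have "Z \<longlonglongrightarrow> \<tau>"
    by (rule Lim_transform_eventually [OF X(2)]) (use pos in \<open>eventually_elim, simp add: Z_def\<close>)
  then have "(\<lambda>i. laplace 1 (\<lambda>v. 1 / ((1 + Z i * v) * (1 + \<tau> * v)))) \<longlonglongrightarrow> laplace 1 (\<lambda>v. 1 / ((1 + \<tau> * v) * (1 + \<tau> * v)))"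
  proof (intro laplace_tendsto [OF zero_less_one laplace_rational_integrable(3,2)])
    fix v :: real assume "0 < v" "Z \<longlonglongrightarrow> \<tau>"
    then have "1 + \<tau> * v \<noteq> 0" using assms mult_pos_pos [of \<tau> v] by linarith
    then show "(\<lambda>i. 1 / ((1 + Z i * v) * (1 + \<tau> * v))) \<longlonglongrightarrow> 1 / ((1 + \<tau> * v) * (1 + \<tau> * v))"
      using \<open>Z \<longlonglongrightarrow> \<tau>\<close> by (intro tendsto_intros) auto
  qed (use Z assms in auto)
  then show "((\<lambda>y. (y * stieltjes y - \<tau> * stieltjes \<tau>) / (y - \<tau>)) \<circ> X) \<longlonglongrightarrow>
      laplace 1 (\<lambda>v. 1 / ((1 + \<tau> * v) * (1 + \<tau> * v)))"
  proof (rule Lim_transform_eventually)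
    show "\<forall>\<^sub>F i in sequentially. laplace 1 (\<lambda>v. 1 / ((1 + Z i * v) * (1 + \<tau> * v)))
        = ((\<lambda>y. (y * stieltjes y - \<tau> * stieltjes \<tau>) / (y - \<tau>)) \<circ> X) i"
      using pos by eventually_elim (use quot X(1) in \<open>simp add: Z_def\<close>)
  qed
qed

text \<open>The sum of the two integrands, with their weight e^-v, is the derivative of - e^-v / (1
  + \<tau> v), which increases from -1 to 0.\<close>

lemma stieltjes_by_parts:
  assumes "0 < \<tau>"
  shows "\<tau> * laplace 1 (\<lambda>v. 1 / ((1 + \<tau> * v) * (1 + \<tau> * v))) = 1 - stieltjes \<tau>"
proof -
  define D where "D v = exp (- v) * (1 / (1 + \<tau> * v)) + \<tau> * (exp (- v) * (1 / ((1 + \<tau> * v) * (1 + \<tau> * v))))" for v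
  have nz: "0 < 1 + \<tau> * v" if "0 \<le> v" for v using assms that by (simp add: add_pos_nonneg)
  have "(\<integral>\<^sup>+v. ennreal (D v) * indicator {0..} v \<partial>lborel) = ennreal (0 - (- exp (- 0) / (1 + \<tau> * 0)))"
  proof (rule nn_integral_FTC_atLeast)
    show "((\<lambda>v. - exp (- v) / (1 + \<tau> * v)) has_real_derivative D v) (at v)" if "0 \<le> v" for v
    proof -
      define y where "y = 1 + \<tau> * v"
      have y: "y \<noteq> 0" using nz [OF that] by (simp add: y_def)
      have "((\<lambda>v. - exp (- v) / (1 + \<tau> * v)) has_real_derivative (exp (- v) * y - - exp (- v) * \<tau>) / (y * y)) (at v)"
        using y unfolding y_def by (intro DERIV_divide) (auto intro!: derivative_eq_intros)
      moreover have "(exp (- v) * y - - exp (- v) * \<tau>) / (y * y) = D v"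
        using y unfolding D_def y_def [symmetric] by (simp add: field_simps)
      ultimately show ?thesis by simp
    qed
    show "0 \<le> D v" if "0 \<le> v" for v using nz [OF that] assms by (simp add: D_def)
    show "((\<lambda>v. - exp (- v) / (1 + \<tau> * v)) \<longlongrightarrow> 0) at_top" using assms by real_asymp
    show "D \<in> borel_measurable borel" unfolding D_def by measurable
  qed
  moreover have "ennreal (D v) * indicator {0..} v = ennreal (D v * indicator {0..} v)" for v
    by (simp add: indicator_def)
  ultimately have "has_bochner_integral lborel (\<lambda>v. D v * indicator {0..} v) 1"
    using nz assms by (intro has_bochner_integral_nn_integral)
      (auto simp: D_def [abs_def] indicator_def less_imp_le)
  then have "(\<integral>v. D v * indicator {0..} v \<partial>lborel) = 1" by (simp add: has_bochner_integral_iff)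
  moreover have "(\<integral>v. D v * indicator {0..} v \<partial>lborel) = laplace 1 (\<lambda>v. 1 / (1 + \<tau> * v) + \<tau> * (1 / ((1 + \<tau> * v) * (1 + \<tau> * v))))"
    unfolding laplace_def
  proof (rule integral_cong_AE)
    show "AE v in lborel. D v * indicator {0..} v = indicator {0<..} v * exp (- 1 * v) *
        (1 / (1 + \<tau> * v) + \<tau> * (1 / ((1 + \<tau> * v) * (1 + \<tau> * v))))"
      using AE_lborel_singleton [of "0 :: real"]
      by eventually_elim (auto simp: D_def indicator_def distrib_left)
  qed (unfold D_def, measurable)
  moreover have "laplace 1 (\<lambda>v. 1 / (1 + \<tau> * v) + \<tau> * (1 / ((1 + \<tau> * v) * (1 + \<tau> * v))))
      = stieltjes \<tau> + \<tau> * laplace 1 (\<lambda>v. 1 / ((1 + \<tau> * v) * (1 + \<tau> * v)))"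
    unfolding stieltjes_def laplace_cmult [symmetric]
  proof (rule laplace_add)
    show "integrable lborel (\<lambda>v. indicator {0<..} v * exp (- 1 * v) * (1 / (1 + \<tau> * v)))"
      using laplace_rational_integrable(1) [of 0 \<tau>] assms by simp
    show "integrable lborel (\<lambda>v. indicator {0<..} v * exp (- 1 * v) * (\<tau> * (1 / ((1 + \<tau> * v) * (1 + \<tau> * v)))))"
      using integrable_mult_right [OF laplace_rational_integrable(1) [of \<tau> \<tau>], of \<tau>] assms by (simp add: ac_simps)
  qed
  ultimately show ?thesis by simp
qed

text \<open>In the variable \<tau> = l^\<beta> / \<kappa>, and after division by \<open>C\<close>,
  the equation reads \<tau> (\<tau> S)' = 1 - S; this is what \<open>stieltjes_derivative\<close>
  and \<open>stieltjes_by_parts\<close> give together.\<close>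

lemma rate_equation_stieltjes:
  assumes \<beta>: "0 < \<beta>" and \<kappa>: "0 < \<kappa>"
  shows "rate_equation \<beta> \<kappa> C (\<lambda>l. C * stieltjes (l powr \<beta> / \<kappa>))"
  unfolding rate_equation_def
proof (intro allI impI)
  fix a b :: real assume ab: "0 < a" "a \<le> b"
  define f where "f l = C * (l powr \<beta> / \<kappa> * stieltjes (l powr \<beta> / \<kappa>))" for l
  have d: "(f has_real_derivative - (\<beta> / l) * (C * stieltjes (l powr \<beta> / \<kappa>) - C)) (at l)" if l: "0 < l" for l
  proof -
    let ?\<tau> = "l powr \<beta> / \<kappa>"
    have \<tau>: "0 < ?\<tau>" using l \<kappa> by simp
    have "((\<lambda>l. l powr \<beta> / \<kappa>) has_real_derivative \<beta> * l powr (\<beta> - 1) / \<kappa>) (at l)"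
      by (intro DERIV_cdivide has_real_derivative_powr l)
    from DERIV_cmult [OF DERIV_chain2 [OF stieltjes_derivative [OF \<tau>] this], of C]
    show ?thesis unfolding f_def
    proof (rule DERIV_cong)
      have "\<beta> * l powr (\<beta> - 1) / \<kappa> = ?\<tau> * (\<beta> / l)" using l by (simp add: powr_diff mult.commute)
      then have "C * (laplace 1 (\<lambda>v. 1 / ((1 + ?\<tau> * v) * (1 + ?\<tau> * v))) * (\<beta> * l powr (\<beta> - 1) / \<kappa>))
          = C * (\<beta> / l) * (?\<tau> * laplace 1 (\<lambda>v. 1 / ((1 + ?\<tau> * v) * (1 + ?\<tau> * v))))"
        by (simp only: ac_simps)
      also have "\<dots> = - (\<beta> / l) * (C * stieltjes ?\<tau> - C)"
        unfolding stieltjes_by_parts [OF \<tau>] by (simp add: algebra_simps)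
      finally show "C * (laplace 1 (\<lambda>v. 1 / ((1 + ?\<tau> * v) * (1 + ?\<tau> * v))) * (\<beta> * l powr (\<beta> - 1) / \<kappa>))
          = - (\<beta> / l) * (C * stieltjes ?\<tau> - C)" .
    qed
  qed
  have "((\<lambda>l. - (\<beta> / l) * (C * stieltjes (l powr \<beta> / \<kappa>) - C)) has_integral f b - f a) {a..b}"
    using ab d by (intro fundamental_theorem_of_calculus)
      (auto simp: has_real_derivative_iff_has_vector_derivative [symmetric] intro: has_field_derivative_at_within)
  moreover have "f b - f a = (b powr \<beta> * (C * stieltjes (b powr \<beta> / \<kappa>)) - a powr \<beta> * (C * stieltjes (a powr \<beta> / \<kappa>))) / \<kappa>"
    by (simp add: f_def diff_divide_distrib mult.left_commute)
  ultimately show "((\<lambda>l. - (\<beta> / l) * (C * stieltjes (l powr \<beta> / \<kappa>) - C)) has_integral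
      (b powr \<beta> * (C * stieltjes (b powr \<beta> / \<kappa>)) - a powr \<beta> * (C * stieltjes (a powr \<beta> / \<kappa>))) / \<kappa>) {a..b}"
    by simp
qed

section \<open>Generating functions of the state probabilities\<close>

lemma gen_binomial_minus:
  fixes u :: real
  assumes "0 \<le> u" "u < 1"
  shows "(\<lambda>k. diff_coeff \<beta> k * u ^ k) sums (1 - u) powr \<beta>"
    and "summable (\<lambda>k. norm (diff_coeff \<beta> k * u ^ k))"
proof -
  have eq: "diff_coeff \<beta> k * u ^ k = (\<beta> gchoose k) * (- u) ^ k" for k
    by (simp add: diff_coeff_def power_minus [of u])
  show "(\<lambda>k. diff_coeff \<beta> k * u ^ k) sums (1 - u) powr \<beta>"
    using gen_binomial_real [of "- u" \<beta>] assms by (simp add: eq)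
  \<comment> \<open>The point \<open>(1 + u) / 2\<close> lies strictly between \<open>u\<close> and
    1; convergence of the binomial series there makes it absolutely convergent at
    \<open>- u\<close>.\<close>
  have "summable (\<lambda>k. (\<beta> gchoose k) * ((1 + u) / 2) ^ k)"
    using gen_binomial_real [of "(1 + u) / 2" \<beta>] assms by (auto intro: sums_summable)
  then have "summable (\<lambda>k. norm ((\<beta> gchoose k) * (- u) ^ k))"
    by (rule powser_insidea) (use assms in auto)
  then show "summable (\<lambda>k. norm (diff_coeff \<beta> k * u ^ k))" by (simp add: eq)
qed

text \<open>Weighted with \<open>u ^ n\<close>, the truncated differences are the terms of the
  Cauchy product with the binomial series of (1 - u)^\<beta>.\<close>

lemma truncated_difference_sums:
  fixes u :: real
  assumes u: "0 \<le> u" "u < 1" and y: "summable (\<lambda>n. norm (u ^ n * y n))"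
  shows "(\<lambda>n. u ^ n * truncated_difference \<beta> y n) sums ((1 - u) powr \<beta> * (\<Sum>n. u ^ n * y n))"
proof -
  have "(\<lambda>n. \<Sum>k\<le>n. (diff_coeff \<beta> k * u ^ k) * (u ^ (n - k) * y (n - k)))
      sums ((\<Sum>k. diff_coeff \<beta> k * u ^ k) * (\<Sum>n. u ^ n * y n))"
    by (rule Cauchy_product_sums [OF gen_binomial_minus(2) [OF u] y])
  moreover have "(\<Sum>k\<le>n. (diff_coeff \<beta> k * u ^ k) * (u ^ (n - k) * y (n - k))) = u ^ n * truncated_difference \<beta> y n" for n
    unfolding truncated_difference_def sum_distrib_left
  proof (rule sum.cong)
    fix k assume "k \<in> {..n}"
    then have "u ^ k * u ^ (n - k) = u ^ n" by (simp flip: power_add)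
    then show "(diff_coeff \<beta> k * u ^ k) * (u ^ (n - k) * y (n - k)) = u ^ n * (diff_coeff \<beta> k * y (n - k))"
      by (metis mult.assoc mult.commute)
  qed simp
  ultimately show ?thesis by (simp only: sums_unique [OF gen_binomial_minus(1) [OF u], symmetric])
qed

definition gen_fun :: "real \<Rightarrow> nat pmf \<Rightarrow> real" where
  "gen_fun u q = (\<Sum>n. u ^ n * pmf q n)"

lemma gen_fun_partial_sums:
  assumes u: "0 \<le> u" "u < 1"
  shows "summable (\<lambda>n. norm (u ^ n * pmf q n))"
    and "0 \<le> (\<Sum>n\<le>N. u ^ n * pmf q n)" "(\<Sum>n\<le>N. u ^ n * pmf q n) \<le> 1"
    and "(\<lambda>N. \<Sum>n\<le>N. u ^ n * pmf q n) \<longlonglongrightarrow> gen_fun u q"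
    and "0 \<le> gen_fun u q" "gen_fun u q \<le> 1"
proof -
  have "norm (u ^ n * pmf q n) \<le> u ^ n" for n
    using u pmf_le_1 [of q n] by (simp add: abs_mult mult_left_le)
  then show s: "summable (\<lambda>n. norm (u ^ n * pmf q n))"
    by (intro summable_comparison_test' [OF summable_geometric [of u]]) (use u in auto)
  show 0: "0 \<le> (\<Sum>n\<le>N. u ^ n * pmf q n)" for N using u by (intro sum_nonneg) simp
  show 1: "(\<Sum>n\<le>N. u ^ n * pmf q n) \<le> 1" for N
  proof -
    have "(\<Sum>n\<le>N. u ^ n * pmf q n) \<le> (\<Sum>n\<le>N. pmf q n)"
      using u by (intro sum_mono mult_left_le_one_le) (auto intro: power_le_one)
    also have "\<dots> = measure (measure_pmf q) {..N}" by (simp add: measure_measure_pmf_finite)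
    also have "\<dots> \<le> 1" by (rule measure_pmf.prob_le_1)
    finally show ?thesis .
  qed
  show l: "(\<lambda>N. \<Sum>n\<le>N. u ^ n * pmf q n) \<longlonglongrightarrow> gen_fun u q"
    unfolding gen_fun_def using summable_norm_cancel [OF s] by (rule summable_LIMSEQ')
  show "0 \<le> gen_fun u q" by (rule LIMSEQ_le_const [OF l]) (use 0 in blast)
  show "gen_fun u q \<le> 1" by (rule LIMSEQ_le_const2 [OF l]) (use 1 in blast)
qed

section \<open>Transforms of the state probabilities\<close>

context stfprf_family
begin

text \<open>Extended by 0 outside the domain, so that it is measurable and bounded on the whole
  space, as the interchange lemmas demand.\<close>

definition state :: "nat \<Rightarrow> real \<Rightarrow> real \<Rightarrow> real \<Rightarrow> real" where
  "state n l t1 t2 = indicator ({0<..} \<times> R2plus) (l, t1, t2) * pmf (p l (t1, t2)) n"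

lemma state_eq: "0 < l \<Longrightarrow> 0 \<le> t1 \<Longrightarrow> 0 \<le> t2 \<Longrightarrow> state n l t1 t2 = pmf (p l (t1, t2)) n"
  by (simp add: state_def)

lemma state_bounds: "0 \<le> state n l t1 t2" "state n l t1 t2 \<le> 1" "\<bar>state n l t1 t2\<bar> \<le> 1"
  by (simp_all add: state_def indicator_def pmf_le_1)

lemma state_measurable: "(\<lambda>(l, t1, t2). state n l t1 t2) \<in> borel_measurable borel"
proof -
  have "{0<..} \<times> R2plus \<in> sets (borel :: (real \<times> real \<times> real) measure)"
    by (intro borel_Times borel_open borel_closed closed_Times) auto
  from continuous_indicator_measurable [OF p_continuous this]
  have "(\<lambda>x. indicator ({0<..} \<times> R2plus) x * (\<lambda>(l, t). pmf (p l t) n) x) \<in> borel_measurable borel" .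
  moreover have "(\<lambda>x. indicator ({0<..} \<times> R2plus) x * (\<lambda>(l, t). pmf (p l t) n) x) = (\<lambda>(l, t1, t2). state n l t1 t2)"
    by (auto simp: state_def)
  ultimately show ?thesis by (simp only:)
qed

lemma state_slice_measurable: "(\<lambda>(t1, t2). state n l t1 t2) \<in> borel_measurable borel"
  unfolding split_beta by (rule borel_measurable_compose3 [OF state_measurable]) (simp_all add: borel_prod [symmetric])

lemma flux_increment_state:
  assumes "0 < a" "0 < b"
  shows "flux_increment n a b s1 s2 = b powr \<beta> * truncated_difference \<beta> (\<lambda>k. state k b s1 s2) n
     - a powr \<beta> * truncated_difference \<beta> (\<lambda>k. state k a s1 s2) n"
  using assms by (simp add: flux_increment_def state_def truncated_difference_def indicator_def)

lemma truncated_difference_bounded: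
  assumes "\<And>k. \<bar>f k\<bar> \<le> 1"
  shows "\<bar>truncated_difference \<beta> f n\<bar> \<le> (\<Sum>k\<le>n. \<bar>diff_coeff \<beta> k\<bar>)"
proof -
  have "\<bar>truncated_difference \<beta> f n\<bar> \<le> (\<Sum>k\<le>n. \<bar>diff_coeff \<beta> k * f (n - k)\<bar>)"
    unfolding truncated_difference_def by (rule sum_abs)
  also have "\<dots> \<le> (\<Sum>k\<le>n. \<bar>diff_coeff \<beta> k\<bar>)"
    using assms by (intro sum_mono) (simp add: abs_mult mult_left_le)
  finally show ?thesis .
qed

context
  fixes z1 z2 :: real
  assumes z: "0 < z1" "0 < z2"
begin

definition transform :: "nat \<Rightarrow> real \<Rightarrow> real" where
  "transform n l = laplace2 z1 z2 (state n l)"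

lemma transform_abs_le: "\<bar>transform n l\<bar> \<le> 1 / (z1 * z2)"
  unfolding transform_def by (rule laplace2_abs_le [OF z]) (rule state_bounds)

lemma laplace2_truncated_difference:
  shows "laplace2 z1 z2 (\<lambda>t1 t2. truncated_difference \<beta> (\<lambda>k. state k l t1 t2) n)
     = truncated_difference \<beta> (\<lambda>k. transform k l) n"
    and "(\<lambda>(t1, t2). truncated_difference \<beta> (\<lambda>k. state k l t1 t2) n) \<in> borel_measurable borel"
proof -
  show "laplace2 z1 z2 (\<lambda>t1 t2. truncated_difference \<beta> (\<lambda>k. state k l t1 t2) n)
     = truncated_difference \<beta> (\<lambda>k. transform k l) n"
    unfolding truncated_difference_def transform_def
    by (rule laplace2_sum [OF z, where f = "\<lambda>k. state (n - k) l"]) (rule state_slice_measurable, rule state_bounds)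
  show "(\<lambda>(t1, t2). truncated_difference \<beta> (\<lambda>k. state k l t1 t2) n) \<in> borel_measurable borel"
    unfolding truncated_difference_def split_beta
    by (intro borel_measurable_sum borel_measurable_times borel_measurable_const
        state_slice_measurable [unfolded split_beta])
qed

text \<open>The interval [a, b] stays away from rate 0, so the weight \<open>w\<close> is
  integrable, and for fixed \<open>n\<close> the state probabilities and the flux increment are
  bounded in both times. This licenses all exchanges of integrals.\<close>

lemma transform_equation:
  assumes ab: "0 < a" "a \<le> b"
  shows "(\<integral>l. indicator {a..b} l * (- (\<beta> / l)) * (transform n l - (if n = 0 then 1 else 0) / (z1 * z2)) \<partial>lborel)
    = z1 powr (- \<alpha>1) * z2 powr (- \<alpha>2) * (b powr \<beta> * truncated_difference \<beta> (\<lambda>k. transform k b) n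
        - a powr \<beta> * truncated_difference \<beta> (\<lambda>k. transform k a) n)"
proof -
  have b: "0 < b" using ab by simp
  let ?\<delta> = "if n = 0 then 1 else 0 :: real"
  define w where "w l = indicator {a..b} l * (- (\<beta> / l))" for l
  have w: "integrable lborel w"
  proof -
    have "set_integrable lborel {a..b} (\<lambda>l. - (\<beta> / l))"
      using ab by (intro borel_integrable_atLeastAtMost') (auto intro!: continuous_intros)
    then show ?thesis unfolding set_integrable_def w_def [abs_def] by simp
  qed
  let ?G = "\<lambda>l t1 t2. state n l t1 t2 - ?\<delta>"
  have Gm: "(\<lambda>(l, t1, t2). ?G l t1 t2) \<in> borel_measurable borel"
    using state_measurable [of n] unfolding split_beta by (intro borel_measurable_diff borel_measurable_const)
  have GB: "\<bar>?G l t1 t2\<bar> \<le> 1" for l t1 t2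
    using state_bounds(1,2) [of n l t1 t2] by (cases "n = 0") (simp_all add: abs_le_iff)
  have LG: "laplace2 z1 z2 (?G l) = transform n l - ?\<delta> / (z1 * z2)" for l
    unfolding transform_def laplace2_const [OF z, symmetric]
    by (rule laplace2_diff [OF z state_slice_measurable state_bounds(3), where B' = 1]) simp_all
  let ?K = "flux_increment n a b"
  have K: "?K s1 s2 = b powr \<beta> * truncated_difference \<beta> (\<lambda>k. state k b s1 s2) n
     - a powr \<beta> * truncated_difference \<beta> (\<lambda>k. state k a s1 s2) n" for s1 s2
    by (rule flux_increment_state [OF ab(1) b])
  let ?S = "\<Sum>k\<le>n. \<bar>diff_coeff \<beta> k\<bar>"
  have TB: "\<bar>c powr \<beta> * truncated_difference \<beta> (\<lambda>k. state k l s1 s2) n\<bar> \<le> c powr \<beta> * ?S" for c l s1 s2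
  proof -
    have "\<bar>truncated_difference \<beta> (\<lambda>k. state k l s1 s2) n\<bar> \<le> ?S"
      by (rule truncated_difference_bounded) (rule state_bounds)
    then show ?thesis by (simp add: abs_mult mult_left_mono)
  qed
  have Tm: "(\<lambda>(s1, s2). c powr \<beta> * truncated_difference \<beta> (\<lambda>k. state k l s1 s2) n) \<in> borel_measurable borel" for c l
    using laplace2_truncated_difference(2) [of l n] unfolding split_beta
    by (intro borel_measurable_times borel_measurable_const)
  have Km: "(\<lambda>(s1, s2). ?K s1 s2) \<in> borel_measurable borel"
    unfolding K split_beta by (intro borel_measurable_diff Tm [unfolded split_beta])
  have KB: "\<bar>?K s1 s2\<bar> \<le> b powr \<beta> * ?S + a powr \<beta> * ?S" for s1 s2
    unfolding K using TB [of b b s1 s2] TB [of a a s1 s2] by linarith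
  have LK: "laplace2 z1 z2 ?K = b powr \<beta> * truncated_difference \<beta> (\<lambda>k. transform k b) n
        - a powr \<beta> * truncated_difference \<beta> (\<lambda>k. transform k a) n"
    unfolding K laplace2_diff [OF z Tm TB Tm TB] laplace2_cmult laplace2_truncated_difference(1) ..
  have "(\<integral>l. indicator {a..b} l * (- (\<beta> / l)) * (transform n l - ?\<delta> / (z1 * z2)) \<partial>lborel)
      = laplace2 z1 z2 (\<lambda>t1 t2. \<integral>l. w l * ?G l t1 t2 \<partial>lborel)"
    unfolding laplace2_integral_swap [OF z w Gm GB] LG unfolding w_def ..
  also have "\<dots> = laplace2 z1 z2 (\<lambda>t1 t2. rl_integral \<alpha>1 (\<lambda>s1. rl_integral \<alpha>2 (?K s1) t2) t1)"
  proof (rule laplace2_cong)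
    fix t1 t2 :: real assume t: "0 < t1" "0 < t2"
    have "(\<integral>l. w l * ?G l t1 t2 \<partial>lborel)
        = (\<integral>l. indicator {a..b} l * (- (\<beta> / l) * (pmf (p l (t1, t2)) n - ?\<delta>)) \<partial>lborel)"
      by (rule Bochner_Integration.integral_cong) (use t ab in \<open>auto simp: w_def state_eq indicator_def\<close>)
    then show "(\<integral>l. w l * ?G l t1 t2 \<partial>lborel) = rl_integral \<alpha>1 (\<lambda>s1. rl_integral \<alpha>2 (?K s1) t2) t1"
      using integrated_equation [OF ab t, of n] by simp
  qed
  also have "\<dots> = z1 powr (- \<alpha>1) * z2 powr (- \<alpha>2) * laplace2 z1 z2 ?K"
    unfolding laplace2_def by (rule laplace2_rl_integral [OF \<alpha>1(1) \<alpha>2(1) z Km KB])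
  finally show ?thesis unfolding LK .
qed

text \<open>The equations for single \<open>n\<close> are weighted with \<open>u ^ n\<close> and
  summed up to \<open>N\<close>; all partial sums of transforms are bounded by \<open>C\<close>, so
  dominated convergence applies as \<open>N\<close> grows. The limit satisfies a
  \<open>rate_equation\<close>, whose bounded solution is unique and known.\<close>

lemma gen_fun_transform:
  assumes u: "0 \<le> u" "u < 1" and "0 < l"
  shows "laplace2 z1 z2 (\<lambda>t1 t2. gen_fun u (p l (t1, t2)))
     = 1 / (z1 * z2) * stieltjes (l powr \<beta> / (z1 powr \<alpha>1 * z2 powr \<alpha>2 / (1 - u) powr \<beta>))"
proof -
  define C where "C = 1 / (z1 * z2)"
  \<comment> \<open>The powers of \<open>z1\<close> and \<open>z2\<close> come from the two
    fractional integrals, the factor \<open>(1 - u) powr \<beta>\<close> from the generating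
    function of the fractional difference.\<close>
  define \<kappa> where "\<kappa> = z1 powr \<alpha>1 * z2 powr \<alpha>2 / (1 - u) powr \<beta>"
  have \<kappa>: "0 < \<kappa>" using z u by (simp add: \<kappa>_def)
  have C: "0 < C" using z by (simp add: C_def)
  define Y where "Y l = laplace2 z1 z2 (\<lambda>t1 t2. gen_fun u (p l (t1, t2)))" for l
  define S where "S N l = (\<Sum>n\<le>N. u ^ n * transform n l)" for N l
  have Ss: "S N l = laplace2 z1 z2 (\<lambda>t1 t2. \<Sum>n\<le>N. u ^ n * state n l t1 t2)" for N l
    unfolding S_def transform_def by (rule laplace2_sum [OF z state_slice_measurable state_bounds(3), symmetric])
  have sB: "\<bar>\<Sum>n\<le>N. u ^ n * state n l t1 t2\<bar> \<le> 1" for N l t1 t2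
  proof (cases "(l, t1, t2) \<in> {0<..} \<times> R2plus")
    case True
    then show ?thesis using gen_fun_partial_sums(2,3) [OF u, where q = "p l (t1, t2)"] by (simp add: state_eq)
  qed (simp add: state_def)
  have SB: "\<bar>S N l\<bar> \<le> C" for N l
    unfolding Ss C_def by (rule laplace2_abs_le [OF z sB])
  have SY: "(\<lambda>N. S N l) \<longlonglongrightarrow> Y l" if "0 < l" for l
    unfolding Ss Y_def
  proof (rule laplace2_tendsto [OF z _ sB])
    show "(\<lambda>(t1, t2). \<Sum>n\<le>N. u ^ n * state n l t1 t2) \<in> borel_measurable borel" for N
      unfolding split_beta
      by (intro borel_measurable_sum borel_measurable_times borel_measurable_const state_slice_measurable [unfolded split_beta])
    show "(\<lambda>N. \<Sum>n\<le>N. u ^ n * state n l t1 t2) \<longlonglongrightarrow> gen_fun u (p l (t1, t2))" if "0 < t1" "0 < t2" for t1 t2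
      using gen_fun_partial_sums(4) [OF u] \<open>0 < l\<close> that by (simp add: state_eq)
  qed
  have YB: "\<bar>Y l\<bar> \<le> C" if "0 < l" for l
    using tendsto_rabs [OF SY [OF that]] by (rule LIMSEQ_le_const2) (use SB in blast)
  have tm: "transform n \<in> borel_measurable borel" for n
  proof -
    have [measurable]: "(\<lambda>y. state n (fst (fst y)) (snd y) (snd (fst y)))
        \<in> borel_measurable ((borel \<Otimes>\<^sub>M borel) \<Otimes>\<^sub>M lborel)"
      by (rule borel_measurable_compose3 [OF state_measurable]) measurable
    have "(\<lambda>(x, s). indicator {0<..} s * exp (- z1 * s) * state n (fst x) s (snd x))
        \<in> borel_measurable ((borel \<Otimes>\<^sub>M borel) \<Otimes>\<^sub>M lborel)"
      unfolding split_beta by measurable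
    from lborel.borel_measurable_lebesgue_integral [OF this]
    have "(\<lambda>(l, t2). laplace z1 (\<lambda>t1. state n l t1 t2)) \<in> borel_measurable borel"
      unfolding borel_prod laplace_def split_beta .
    from laplace_measurable [OF this, of z2] show ?thesis
      by (simp add: transform_def [abs_def] laplace2_def)
  qed
  have Sm: "S N \<in> borel_measurable borel" for N
    unfolding S_def [abs_def] by (intro borel_measurable_sum borel_measurable_times borel_measurable_const tm)
  have tsum: "summable (\<lambda>n. norm (u ^ n * transform n l))" for l
  proof (rule summable_comparison_test')
    show "summable (\<lambda>n. C * u ^ n)" using u by (intro summable_mult summable_geometric) simp
    show "norm (norm (u ^ n * transform n l)) \<le> C * u ^ n" for n
      using transform_abs_le [of n l] u mult_left_mono [of "\<bar>transform n l\<bar>" C "u ^ n"]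
      by (simp add: abs_mult C_def mult.commute)
  qed
  have Yeq: "(\<Sum>n. u ^ n * transform n l) = Y l" if "0 < l" for l
    using summable_LIMSEQ' [OF summable_norm_cancel [OF tsum]] SY [OF that] unfolding S_def
    by (rule LIMSEQ_unique)
  have TD: "(\<lambda>N. \<Sum>n\<le>N. u ^ n * truncated_difference \<beta> (\<lambda>k. transform k l) n) \<longlonglongrightarrow> (1 - u) powr \<beta> * Y l" if "0 < l" for l
    using truncated_difference_sums [OF u tsum, of \<beta> l] unfolding sums_def_le Yeq [OF that] .
  have "rate_equation \<beta> \<kappa> C Y"
    unfolding rate_equation_def
  proof (intro allI impI)
    fix a b :: real assume ab: "0 < a" "a \<le> b"
    then have b: "0 < b" by simp
    define w where "w l = indicator {a..b} l * (- (\<beta> / l))" for l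
    have w: "integrable lborel w"
    proof -
      have "set_integrable lborel {a..b} (\<lambda>l. - (\<beta> / l))"
        using ab by (intro borel_integrable_atLeastAtMost') (auto intro!: continuous_intros)
      then show ?thesis unfolding set_integrable_def w_def [abs_def] by simp
    qed
    let ?c = "z1 powr (- \<alpha>1) * z2 powr (- \<alpha>2)"
    let ?R = "\<lambda>N. ?c * (b powr \<beta> * (\<Sum>n\<le>N. u ^ n * truncated_difference \<beta> (\<lambda>k. transform k b) n)
        - a powr \<beta> * (\<Sum>n\<le>N. u ^ n * truncated_difference \<beta> (\<lambda>k. transform k a) n))"
    have wt: "integrable lborel (\<lambda>l. w l * (transform n l - c))" for n c
    proof (rule Bochner_Integration.integrable_bound [OF integrable_mult_right [OF w, of "C + \<bar>c\<bar>"]])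
      show "(\<lambda>l. w l * (transform n l - c)) \<in> borel_measurable lborel"
        using borel_measurable_integrable [OF w] tm [of n]
        by (intro borel_measurable_times borel_measurable_diff) auto
      show "AE l in lborel. norm (w l * (transform n l - c)) \<le> norm ((C + \<bar>c\<bar>) * w l)"
      proof (rule AE_I2)
        fix l
        have "\<bar>transform n l - c\<bar> \<le> C + \<bar>c\<bar>"
          using transform_abs_le [of n l] unfolding C_def [symmetric] by linarith
        then have "\<bar>w l\<bar> * \<bar>transform n l - c\<bar> \<le> \<bar>w l\<bar> * (C + \<bar>c\<bar>)" by (rule mult_left_mono) simp
        then show "norm (w l * (transform n l - c)) \<le> norm ((C + \<bar>c\<bar>) * w l)"
          using C by (simp add: abs_mult mult.commute)
      qed
    qed
    have fin: "(\<integral>l. w l * (S N l - C) \<partial>lborel) = ?R N" for N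
    proof -
      have "S N l - C = (\<Sum>n\<le>N. u ^ n * (transform n l - (if n = 0 then 1 else 0) / (z1 * z2)))" for l
      proof -
        have "(\<Sum>n\<le>N. u ^ n * ((if n = 0 then 1 else 0) / (z1 * z2))) = (\<Sum>n\<le>N. if n = 0 then C else 0)"
          by (rule sum.cong) (auto simp: C_def)
        also have "\<dots> = C" by simp
        finally show ?thesis by (simp only: S_def right_diff_distrib sum_subtractf)
      qed
      then have "(\<integral>l. w l * (S N l - C) \<partial>lborel)
          = (\<integral>l. (\<Sum>n\<le>N. u ^ n * (w l * (transform n l - (if n = 0 then 1 else 0) / (z1 * z2)))) \<partial>lborel)"
        by (simp only: sum_distrib_left mult.left_commute)
      also have "\<dots> = (\<Sum>n\<le>N. u ^ n * (\<integral>l. w l * (transform n l - (if n = 0 then 1 else 0) / (z1 * z2)) \<partial>lborel))"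
        by (subst Bochner_Integration.integral_sum) (simp_all only: integrable_mult_right wt integral_mult_right_zero)
      also have "\<dots> = (\<Sum>n\<le>N. u ^ n * (?c * (b powr \<beta> * truncated_difference \<beta> (\<lambda>k. transform k b) n
        - a powr \<beta> * truncated_difference \<beta> (\<lambda>k. transform k a) n)))"
        by (simp only: w_def transform_equation [OF ab])
      also have "\<dots> = ?R N"
        by (simp only: sum_distrib_left right_diff_distrib sum_subtractf mult.left_commute)
      finally show ?thesis .
    qed
    have l': "(\<lambda>N. w l * (S N l - C)) \<longlonglongrightarrow> w l * (Y l - C)" for l
    proof (cases "l \<in> {a..b}")
      case True
      then have "0 < l" using ab by simp
      then show ?thesis by (intro tendsto_intros SY)
    qed (simp add: w_def)
    have m': "(\<lambda>l. w l * (S N l - C)) \<in> borel_measurable lborel" for N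
      using borel_measurable_integrable [OF w] Sm [of N]
      by (intro borel_measurable_times borel_measurable_diff) auto
    have mY: "(\<lambda>l. w l * (Y l - C)) \<in> borel_measurable lborel" by (rule borel_measurable_LIMSEQ_real [OF l' m'])
    have bd: "norm (w l * (S N l - C)) \<le> 2 * C * \<bar>w l\<bar>" for N l
    proof -
      have "\<bar>S N l - C\<bar> \<le> 2 * C" using SB [of N l] C by linarith
      then have "\<bar>w l\<bar> * \<bar>S N l - C\<bar> \<le> \<bar>w l\<bar> * (2 * C)" by (rule mult_left_mono) simp
      then show ?thesis by (simp add: abs_mult mult.commute)
    qed
    have "(\<lambda>N. \<integral>l. w l * (S N l - C) \<partial>lborel) \<longlonglongrightarrow> (\<integral>l. w l * (Y l - C) \<partial>lborel)"
      by (rule integral_dominated_convergence [where w = "\<lambda>l. 2 * C * \<bar>w l\<bar>", OF mY m'])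
         (use w l' bd in auto)
    moreover have "?R \<longlonglongrightarrow> ?c * (b powr \<beta> * ((1 - u) powr \<beta> * Y b) - a powr \<beta> * ((1 - u) powr \<beta> * Y a))"
      by (intro tendsto_mult_left tendsto_diff TD ab(1) b)
    ultimately have "(\<integral>l. w l * (Y l - C) \<partial>lborel) = ?c * (b powr \<beta> * ((1 - u) powr \<beta> * Y b) - a powr \<beta> * ((1 - u) powr \<beta> * Y a))"
      unfolding fin by (rule LIMSEQ_unique)
    also have "\<dots> = (b powr \<beta> * Y b - a powr \<beta> * Y a) / \<kappa>"
      using z u by (simp add: \<kappa>_def powr_minus_divide diff_divide_distrib right_diff_distrib ac_simps)
    finally have val: "(\<integral>l. w l * (Y l - C) \<partial>lborel) = (b powr \<beta> * Y b - a powr \<beta> * Y a) / \<kappa>" .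
    have "integrable lborel (\<lambda>l. w l * (Y l - C))"
    proof (rule Bochner_Integration.integrable_bound [OF integrable_mult_right [OF integrable_abs [OF w], of "2 * C"] mY])
      show "AE l in lborel. norm (w l * (Y l - C)) \<le> norm (2 * C * \<bar>w l\<bar>)"
      proof (rule AE_I2)
        fix l
        have "norm (w l * (Y l - C)) \<le> 2 * C * \<bar>w l\<bar>"
          using tendsto_norm [OF l'] by (rule LIMSEQ_le_const2) (use bd in blast)
        then show "norm (w l * (Y l - C)) \<le> norm (2 * C * \<bar>w l\<bar>)" by simp
      qed
    qed
    then have si: "set_integrable lborel {a..b} (\<lambda>l. - (\<beta> / l) * (Y l - C))"
      by (simp add: set_integrable_def w_def [abs_def] mult.assoc)
    have "(LINT l:{a..b}|lborel. - (\<beta> / l) * (Y l - C)) = (b powr \<beta> * Y b - a powr \<beta> * Y a) / \<kappa>"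
      using val by (simp add: set_lebesgue_integral_def w_def mult.assoc)
    then show "((\<lambda>l. - (\<beta> / l) * (Y l - C)) has_integral (b powr \<beta> * Y b - a powr \<beta> * Y a) / \<kappa>) {a..b}"
      using set_borel_integral_eq_integral [OF si] by (metis integrable_integral)
  qed
  moreover have "\<bar>C * stieltjes (l powr \<beta> / \<kappa>)\<bar> \<le> C" if "0 < l" for l
    using stieltjes_bounds [of "l powr \<beta> / \<kappa>"] C \<kappa> by (simp add: abs_mult mult_left_le)
  ultimately have "Y l = C * stieltjes (l powr \<beta> / \<kappa>)"
    by (intro rate_equation_unique [where X = Y and Y = "\<lambda>l. C * stieltjes (l powr \<beta> / \<kappa>)" and B = C,
          OF \<beta>(1) \<kappa> _ rate_equation_stieltjes [OF \<beta>(1) \<kappa>]] YB \<open>0 < l\<close>)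
  then show ?thesis by (simp add: Y_def C_def \<kappa>_def)
qed

end

end

text \<open>One-dimensional uniqueness is used in \<open>t2\<close> with \<open>z1\<close> fixed,
  then in \<open>t1\<close> with \<open>t2\<close> fixed. For the first use, \<open>inner\<close>
  shows by dominated convergence that the transform in \<open>t1\<close> alone is continuous in
  \<open>t2\<close>.\<close>

lemma laplace2_unique:
  fixes f g :: "real \<Rightarrow> real \<Rightarrow> real"
  assumes cf: "\<And>t2. 0 < t2 \<Longrightarrow> continuous_on {0<..} (\<lambda>t1. f t1 t2)" "\<And>t1. 0 < t1 \<Longrightarrow> continuous_on {0<..} (f t1)"
    and cg: "\<And>t2. 0 < t2 \<Longrightarrow> continuous_on {0<..} (\<lambda>t1. g t1 t2)" "\<And>t1. 0 < t1 \<Longrightarrow> continuous_on {0<..} (g t1)"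
    and B: "\<And>t1 t2. 0 < t1 \<Longrightarrow> 0 < t2 \<Longrightarrow> \<bar>f t1 t2\<bar> \<le> B" "\<And>t1 t2. 0 < t1 \<Longrightarrow> 0 < t2 \<Longrightarrow> \<bar>g t1 t2\<bar> \<le> B"
    and L: "\<And>z1 z2. 0 < z1 \<Longrightarrow> 0 < z2 \<Longrightarrow> laplace2 z1 z2 f = laplace2 z1 z2 g"
    and t: "0 < t1" "0 < t2"
  shows "f t1 t2 = g t1 t2"
proof -
  have inner: "continuous_on {0<..} (\<lambda>t2. laplace z1 (\<lambda>t1. h t1 t2))"
    if z1: "0 < z1" and c: "\<And>t2. 0 < t2 \<Longrightarrow> continuous_on {0<..} (\<lambda>t1. h t1 t2)" "\<And>t1. 0 < t1 \<Longrightarrow> continuous_on {0<..} (h t1)"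
      and hB: "\<And>t1 t2. 0 < t1 \<Longrightarrow> 0 < t2 \<Longrightarrow> \<bar>h t1 t2\<bar> \<le> B" for h :: "real \<Rightarrow> real \<Rightarrow> real" and z1
    unfolding continuous_on_sequentially
  proof (intro allI ballI impI)
    fix x :: "nat \<Rightarrow> real" and a :: real assume a: "a \<in> {0<..}" and x: "(\<forall>n. x n \<in> {0<..}) \<and> x \<longlonglongrightarrow> a"
    have "(\<lambda>n. laplace z1 (\<lambda>t1. h t1 (x n))) \<longlonglongrightarrow> laplace z1 (\<lambda>t1. h t1 a)"
    proof (rule laplace_tendsto [OF z1])
      show "(\<lambda>t. indicator {0<..} t * h t (x k)) \<in> borel_measurable borel" for k
        using x c(1) [of "x k"] by (intro borel_measurable_indicator_continuous) simp
      show "\<bar>h t (x k)\<bar> \<le> B" if "0 < t" for k t using hB that x by simp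
      show "(\<lambda>k. h t (x k)) \<longlonglongrightarrow> h t a" if "0 < t" for t
        using c(2) [OF that] x a unfolding continuous_on_sequentially by (auto simp: comp_def)
    qed
    then show "((\<lambda>t2. laplace z1 (\<lambda>t1. h t1 t2)) \<circ> x) \<longlonglongrightarrow> laplace z1 (\<lambda>t1. h t1 a)" by (simp add: comp_def)
  qed
  have lz: "laplace z1 (\<lambda>t1. f t1 t2) - laplace z1 (\<lambda>t1. g t1 t2) = 0" if "0 < z1" "0 < t2" for z1 t2
  proof (rule laplace_unique_zero [where f = "\<lambda>t2. laplace z1 (\<lambda>t1. f t1 t2) - laplace z1 (\<lambda>t1. g t1 t2)"])
    note if' = inner [OF that(1) cf B(1)] and ig' = inner [OF that(1) cg B(2)]
    show "continuous_on {0<..} (\<lambda>t2. laplace z1 (\<lambda>t1. f t1 t2) - laplace z1 (\<lambda>t1. g t1 t2))"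
      by (intro continuous_on_diff if' ig')
    have bf: "\<bar>laplace z1 (\<lambda>t1. f t1 t)\<bar> \<le> B / z1" if "0 < t" for t
      by (intro laplace_abs_le \<open>0 < z1\<close> B that)
    have bg: "\<bar>laplace z1 (\<lambda>t1. g t1 t)\<bar> \<le> B / z1" if "0 < t" for t
      by (intro laplace_abs_le \<open>0 < z1\<close> B that)
    show "\<bar>laplace z1 (\<lambda>t1. f t1 t) - laplace z1 (\<lambda>t1. g t1 t)\<bar> \<le> 2 * (B / z1)" if "0 < t" for t
      using bf [OF that] bg [OF that] by linarith
    show "laplace z (\<lambda>t2. laplace z1 (\<lambda>t1. f t1 t2) - laplace z1 (\<lambda>t1. g t1 t2)) = 0" if z: "0 < z" for z
    proof -
      note i1 = laplace_integrable_bounded [OF z borel_measurable_indicator_continuous [OF if'] bf]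
        and i2 = laplace_integrable_bounded [OF z borel_measurable_indicator_continuous [OF ig'] bg]
      have "laplace z (\<lambda>t2. laplace z1 (\<lambda>t1. f t1 t2) - laplace z1 (\<lambda>t1. g t1 t2))
          = laplace2 z1 z f - laplace2 z1 z g"
        using i1 i2 by (simp add: laplace2_def laplace_def [of z] right_diff_distrib)
      then show ?thesis using L [OF \<open>0 < z1\<close> z] by simp
    qed
  qed (rule that(2))
  have "f t1 t2 - g t1 t2 = 0"
  proof (rule laplace_unique_zero [where f = "\<lambda>t1. f t1 t2 - g t1 t2"])
    show "continuous_on {0<..} (\<lambda>t1. f t1 t2 - g t1 t2)"
      by (intro continuous_on_diff cf cg t)
    show "\<bar>f t t2 - g t t2\<bar> \<le> 2 * B" if "0 < t" for t
      using B(1) [OF that t(2)] B(2) [OF that t(2)] by linarith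
    show "laplace z (\<lambda>t1. f t1 t2 - g t1 t2) = 0" if z: "0 < z" for z
    proof -
      note i1 = laplace_integrable_bounded [OF z borel_measurable_indicator_continuous [OF cf(1) [OF t(2)]] B(1) [OF _ t(2)]]
        and i2 = laplace_integrable_bounded [OF z borel_measurable_indicator_continuous [OF cg(1) [OF t(2)]] B(2) [OF _ t(2)]]
      have "laplace z (\<lambda>t1. f t1 t2 - g t1 t2) = laplace z (\<lambda>t1. f t1 t2) - laplace z (\<lambda>t1. g t1 t2)"
        using i1 i2 by (simp add: laplace_def right_diff_distrib)
      then show ?thesis using lz [OF z t(2)] by simp
    qed
  qed (rule t(1))
  then show ?thesis by simp
qed

section \<open>Transforms of exponentials of a product of two times\<close>

lemma laplace_scale:
  assumes "0 < s"
  shows "laplace s f = laplace 1 (\<lambda>v. f (v / s)) / s"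
proof -
  have "laplace 1 (\<lambda>v. f (v / s)) = s * (\<integral>x. indicator {0<..} (0 + s * x) * exp (- 1 * (0 + s * x)) * f ((0 + s * x) / s) \<partial>lborel)"
    unfolding laplace_def
    using lborel_integral_real_affine [of s "\<lambda>v. indicator {0<..} v * exp (- 1 * v) * f (v / s)" 0] assms by simp
  also have "(\<lambda>x. indicator {0<..} (0 + s * x) * exp (- 1 * (0 + s * x)) * f ((0 + s * x) / s))
      = (\<lambda>x. indicator {0<..} x * exp (- s * x) * f x)"
    using assms by (auto simp: indicator_def zero_less_mult_iff)
  finally show ?thesis using assms by (simp add: laplace_def)
qed

lemma laplace_hyperbola:
  assumes "0 < s1" "0 < s2"
  shows "laplace s2 (\<lambda>y. 1 / (s1 + c * y)) = 1 / (s1 * s2) * stieltjes (c / (s1 * s2))"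
proof -
  have "1 / (s1 + c * (v / s2)) = (1 / s1) * (1 / (1 + c / (s1 * s2) * v))" for v
  proof -
    have "s1 + c * (v / s2) = s1 * (1 + c / (s1 * s2) * v)" using assms by (simp add: field_simps)
    then show ?thesis by simp
  qed
  then have "laplace s2 (\<lambda>y. 1 / (s1 + c * y)) = laplace 1 (\<lambda>v. (1 / s1) * (1 / (1 + c / (s1 * s2) * v))) / s2"
    using laplace_scale [OF assms(2)] by simp
  then show ?thesis by (simp only: laplace_cmult stieltjes_def) simp
qed

lemma (in prob_space) laplace_expectation_swap:
  fixes F :: "real \<Rightarrow> 'a \<Rightarrow> real"
  assumes z: "0 < z" and [measurable]: "case_prod F \<in> borel_measurable (lborel \<Otimes>\<^sub>M M)"
    and B: "\<And>x \<omega>. \<omega> \<in> space M \<Longrightarrow> \<bar>F x \<omega>\<bar> \<le> B"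
  shows "laplace z (\<lambda>x. \<integral>\<omega>. F x \<omega> \<partial>M) = (\<integral>\<omega>. laplace z (\<lambda>x. F x \<omega>) \<partial>M)"
proof -
  interpret P: pair_sigma_finite lborel M by unfold_locales
  let ?e = "\<lambda>t. indicator {0<..} t * exp (- z * t)"
  have e: "integrable lborel ?e" using exp_indicator_integrable [OF z] by (auto simp: has_bochner_integral_iff)
  have bnd: "\<bar>?e x * F x \<omega>\<bar> \<le> B * ?e x" if "\<omega> \<in> space M" for x \<omega>
    using B [OF that, of x] by (simp add: abs_mult indicator_def mult.commute)
  have I: "integrable (lborel \<Otimes>\<^sub>M M) (\<lambda>(x, \<omega>). ?e x * F x \<omega>)"
  proof (rule Bochner_Integration.integrable_bound)
    have "integrable (lborel \<Otimes>\<^sub>M M) (\<lambda>(x, \<omega>). B * ?e x)"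
    proof (rule P.Fubini_integrable)
      show "integrable lborel (\<lambda>x. \<integral>\<omega>. norm (case (x, \<omega>) of (x, \<omega>) \<Rightarrow> B * ?e x) \<partial>M)"
        using integrable_abs [OF integrable_mult_right [OF e, of B]] by (simp add: prob_space)
    qed simp_all
    then show "integrable (lborel \<Otimes>\<^sub>M M) (\<lambda>(x, \<omega>). B * ?e x)" .
    show "AE p in lborel \<Otimes>\<^sub>M M. norm (case p of (x, \<omega>) \<Rightarrow> ?e x * F x \<omega>) \<le> norm (case p of (x, \<omega>) \<Rightarrow> B * ?e x)"
    proof (rule AE_I2)
      fix p :: "real \<times> 'a" assume "p \<in> space (lborel \<Otimes>\<^sub>M M)"
      then obtain x \<omega> where p: "p = (x, \<omega>)" "\<omega> \<in> space M" by (cases p) (auto simp: space_pair_measure)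
      show "norm (case p of (x, \<omega>) \<Rightarrow> ?e x * F x \<omega>) \<le> norm (case p of (x, \<omega>) \<Rightarrow> B * ?e x)"
        using order_trans [OF bnd [OF p(2)] abs_ge_self] by (simp add: p)
    qed
  qed measurable
  have "laplace z (\<lambda>x. \<integral>\<omega>. F x \<omega> \<partial>M) = (\<integral>x. (\<integral>\<omega>. ?e x * F x \<omega> \<partial>M) \<partial>lborel)"
    by (simp only: laplace_def integral_mult_right_zero)
  also have "\<dots> = (\<integral>\<omega>. laplace z (\<lambda>x. F x \<omega>) \<partial>M)"
    unfolding laplace_def by (rule P.Fubini_integral [OF I, symmetric])
  finally show ?thesis .
qed

text \<open>\<open>max 0 x\<close> extends the function continuously from the half-line to the whole
  line, the form in which \<open>folded_process_expectation\<close> takes its argument.\<close>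

lemma (in prob_space) expectation_exp_mult:
  fixes X :: "'a \<Rightarrow> real" and c :: real
  assumes X [measurable]: "X \<in> borel_measurable M" and nn: "\<And>\<omega>. \<omega> \<in> space M \<Longrightarrow> 0 \<le> X \<omega>" and c: "0 \<le> c"
  defines "f \<equiv> \<lambda>x :: real. \<integral>\<omega>. exp (- c * X \<omega> * max 0 x) \<partial>M"
  shows "continuous_on UNIV f" "\<bar>f x\<bar> \<le> 1" "0 < s \<Longrightarrow> laplace s f = (\<integral>\<omega>. 1 / (s + c * X \<omega>) \<partial>M)"
proof -
  have b: "\<bar>exp (- c * X \<omega> * max 0 x)\<bar> \<le> 1" if "\<omega> \<in> space M" for \<omega> x
    using nn [OF that] c by (simp add: mult_nonneg_nonneg)
  show "continuous_on UNIV f"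
    unfolding continuous_on_sequentially
  proof (intro allI ballI impI)
    fix x :: "nat \<Rightarrow> real" and a :: real assume "(\<forall>n. x n \<in> UNIV) \<and> x \<longlonglongrightarrow> a"
    then have x: "x \<longlonglongrightarrow> a" by simp
    have "(\<lambda>n. f (x n)) \<longlonglongrightarrow> f a"
      unfolding f_def
    proof (rule integral_dominated_convergence [where w = "\<lambda>_. 1"])
      show "AE \<omega> in M. (\<lambda>n. exp (- c * X \<omega> * max 0 (x n))) \<longlonglongrightarrow> exp (- c * X \<omega> * max 0 a)"
        using x by (intro AE_I2 tendsto_intros)
      show "AE \<omega> in M. norm (exp (- c * X \<omega> * max 0 (x n))) \<le> 1" for n
        using b by (intro AE_I2) simp
    qed simp_all
    then show "(f \<circ> x) \<longlonglongrightarrow> f a" by (simp add: comp_def)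
  qed
  have i: "integrable M (\<lambda>\<omega>. exp (- c * X \<omega> * max 0 x))" for x
    by (rule integrable_const_bound [of _ 1]) (use b in auto)
  have "\<bar>f x\<bar> \<le> (\<integral>\<omega>. \<bar>exp (- c * X \<omega> * max 0 x)\<bar> \<partial>M)" unfolding f_def by (rule integral_abs_bound)
  also have "\<dots> \<le> 1" by (rule integral_le_const) (use i b in auto)
  finally show "\<bar>f x\<bar> \<le> 1" .
  show "laplace s f = (\<integral>\<omega>. 1 / (s + c * X \<omega>) \<partial>M)" if s: "0 < s"
  proof -
    have "laplace s f = (\<integral>\<omega>. laplace s (\<lambda>x. exp (- c * X \<omega> * max 0 x)) \<partial>M)"
      unfolding f_def by (rule laplace_expectation_swap [OF s _ b]) measurable
    also have "\<dots> = (\<integral>\<omega>. 1 / (s + c * X \<omega>) \<partial>M)"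
    proof (rule Bochner_Integration.integral_cong [OF refl])
      fix \<omega> assume "\<omega> \<in> space M"
      then have cX: "0 \<le> c * X \<omega>" using nn c by simp
      have "laplace s (\<lambda>x. exp (- c * X \<omega> * max 0 x)) = laplace s (\<lambda>x. exp (- (c * X \<omega>) * x))"
        by (rule laplace_cong) simp
      then show "laplace s (\<lambda>x. exp (- c * X \<omega> * max 0 x)) = 1 / (s + c * X \<omega>)"
        using laplace_exp(1) [OF s cX] by simp
    qed
    finally show ?thesis .
  qed
qed

text \<open>The expectation of exp(- c T1 T2) for independent times. As an iterated integral it is a
  function of either time alone, with the other one averaged out.\<close>

definition mixed_exp :: "'a measure \<Rightarrow> (real \<Rightarrow> 'a \<Rightarrow> real) \<Rightarrow> (real \<Rightarrow> 'a \<Rightarrow> real) \<Rightarrow> real \<Rightarrow> real \<Rightarrow> real \<Rightarrow> real" where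
  "mixed_exp M T1 T2 c t1 t2 = (\<integral>\<omega>1. (\<integral>\<omega>2. exp (- c * T1 t1 \<omega>1 * T2 t2 \<omega>2) \<partial>M) \<partial>M)"

text \<open>Averaging over one time first, in either order, gives continuity in the other. For the
  transform \<open>folded_process_expectation\<close> is used twice: the first use leaves the
  expectation of h(T2) with h(y) = 1 / (s1 + c y), again bounded and continuous on the half-line.
  Finally z^(\<alpha> - 1) / z^\<alpha> = 1 / z for each time.\<close>

lemma mixed_exp_properties:
  fixes T1 T2 :: "real \<Rightarrow> 'a \<Rightarrow> real"
  assumes M: "prob_space M" and \<alpha>1: "0 < \<alpha>1" "\<alpha>1 \<le> 1" and \<alpha>2: "0 < \<alpha>2" "\<alpha>2 \<le> 1"
    and T1: "folded_process \<alpha>1 M T1" and T2: "folded_process \<alpha>2 M T2" and c: "0 \<le> c"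
  shows "0 < t2 \<Longrightarrow> continuous_on {0<..} (\<lambda>t1. mixed_exp M T1 T2 c t1 t2)"
    and "0 < t1 \<Longrightarrow> continuous_on {0<..} (mixed_exp M T1 T2 c t1)"
    and "0 < t1 \<Longrightarrow> 0 < t2 \<Longrightarrow> \<bar>mixed_exp M T1 T2 c t1 t2\<bar> \<le> 1"
    and "0 < z1 \<Longrightarrow> 0 < z2 \<Longrightarrow> laplace2 z1 z2 (mixed_exp M T1 T2 c)
      = 1 / (z1 * z2) * stieltjes (c / (z1 powr \<alpha>1 * z2 powr \<alpha>2))"
proof -
  interpret prob_space M by (rule M)
  interpret P: pair_sigma_finite M M by unfold_locales
  have T1m: "T1 t \<in> borel_measurable M" and T1n: "\<omega> \<in> space M \<Longrightarrow> 0 \<le> T1 t \<omega>" if "0 \<le> t" for t \<omega>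
    using T1 that by (simp_all add: folded_process_def random_process_def)
  have T2m: "T2 t \<in> borel_measurable M" and T2n: "\<omega> \<in> space M \<Longrightarrow> 0 \<le> T2 t \<omega>" if "0 \<le> t" for t \<omega>
    using T2 that by (simp_all add: folded_process_def random_process_def)
  define f2 where "f2 t2 x = (\<integral>\<omega>. exp (- c * T2 t2 \<omega> * max 0 x) \<partial>M)" for t2 x
  define f1 where "f1 t1 x = (\<integral>\<omega>. exp (- c * T1 t1 \<omega> * max 0 x) \<partial>M)" for t1 x
  have F1: "continuous_on UNIV (f1 t)" if "0 \<le> t" for t
    unfolding f1_def by (rule expectation_exp_mult(1) [OF T1m [OF that] T1n [OF that] c])
  have FB1: "\<bar>f1 t x\<bar> \<le> 1" if "0 \<le> t" for t x
    unfolding f1_def by (rule expectation_exp_mult(2) [OF T1m [OF that] T1n [OF that] c])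
  have F2: "continuous_on UNIV (f2 t)" if "0 \<le> t" for t
    unfolding f2_def by (rule expectation_exp_mult(1) [OF T2m [OF that] T2n [OF that] c])
  have FB2: "\<bar>f2 t x\<bar> \<le> 1" if "0 \<le> t" for t x
    unfolding f2_def by (rule expectation_exp_mult(2) [OF T2m [OF that] T2n [OF that] c])
  have r2: "mixed_exp M T1 T2 c t1 t2 = (\<integral>\<omega>. f2 t2 (T1 t1 \<omega>) \<partial>M)" if "0 \<le> t1" for t1 t2
    unfolding mixed_exp_def f2_def
    by (rule Bochner_Integration.integral_cong [OF refl]) (use T1n [OF that] in \<open>simp add: ac_simps\<close>)
  have r1: "mixed_exp M T1 T2 c t1 t2 = (\<integral>\<omega>. f1 t1 (T2 t2 \<omega>) \<partial>M)" if t: "0 \<le> t1" "0 \<le> t2" for t1 t2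
  proof -
    have [measurable]: "T1 t1 \<in> borel_measurable M" "T2 t2 \<in> borel_measurable M" using T1m T2m t by auto
    have I: "integrable (M \<Otimes>\<^sub>M M) (\<lambda>(\<omega>1, \<omega>2). exp (- c * T1 t1 \<omega>1 * T2 t2 \<omega>2))"
    proof -
      interpret Q: pair_prob_space M M ..
      show ?thesis
      proof (rule Q.P.integrable_const_bound [of _ 1])
        show "AE x in M \<Otimes>\<^sub>M M. norm (case x of (\<omega>1, \<omega>2) \<Rightarrow> exp (- c * T1 t1 \<omega>1 * T2 t2 \<omega>2)) \<le> 1"
          using T1n [OF t(1)] T2n [OF t(2)] c by (intro AE_I2) (auto simp: space_pair_measure)
      qed measurable
    qed
    have "mixed_exp M T1 T2 c t1 t2 = (\<integral>\<omega>2. (\<integral>\<omega>1. exp (- c * T1 t1 \<omega>1 * T2 t2 \<omega>2) \<partial>M) \<partial>M)"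
      unfolding mixed_exp_def by (rule P.Fubini_integral [OF I, symmetric])
    also have "\<dots> = (\<integral>\<omega>. f1 t1 (T2 t2 \<omega>) \<partial>M)"
      unfolding f1_def by (rule Bochner_Integration.integral_cong [OF refl]) (use T2n [OF t(2)] in simp)
    finally show ?thesis .
  qed
  show "continuous_on {0<..} (\<lambda>t1. mixed_exp M T1 T2 c t1 t2)" if "0 < t2"
  proof (rule continuous_on_eq)
    show "continuous_on {0<..} (\<lambda>t1. \<integral>\<omega>. f2 t2 (T1 t1 \<omega>) \<partial>M)"
      by (rule folded_process_expectation(1) [OF M \<alpha>1 T1 F2 FB2]) (use that in simp_all)
  qed (simp add: r2)
  show "continuous_on {0<..} (mixed_exp M T1 T2 c t1)" if "0 < t1"
  proof (rule continuous_on_eq)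
    show "continuous_on {0<..} (\<lambda>t2. \<integral>\<omega>. f1 t1 (T2 t2 \<omega>) \<partial>M)"
      by (rule folded_process_expectation(1) [OF M \<alpha>2 T2 F1 FB1]) (use that in simp_all)
  qed (use that in \<open>simp add: r1\<close>)
  show "\<bar>mixed_exp M T1 T2 c t1 t2\<bar> \<le> 1" if "0 < t1" "0 < t2"
  proof -
    have "\<bar>\<integral>\<omega>. f2 t2 (T1 t1 \<omega>) \<partial>M\<bar> \<le> 1"
      by (rule integrable_bounded_compose(2) [OF T1m borel_measurable_continuous_onI [OF F2] T1n FB2])
         (use that in simp_all)
    then show ?thesis using r2 that by simp
  qed
  show "laplace2 z1 z2 (mixed_exp M T1 T2 c) = 1 / (z1 * z2) * stieltjes (c / (z1 powr \<alpha>1 * z2 powr \<alpha>2))"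
    if z: "0 < z1" "0 < z2"
  proof -
    define s1 s2 where "s1 = z1 powr \<alpha>1" and "s2 = z2 powr \<alpha>2"
    have s: "0 < s1" "0 < s2" using z by (simp_all add: s1_def s2_def)
    define h where "h y = 1 / (s1 + c * max 0 y)" for y
    have pos: "0 < s1 + c * max 0 y" for y :: real using s c by (simp add: add_pos_nonneg)
    have h: "continuous_on UNIV h" unfolding h_def using pos by (intro continuous_intros) (metis less_irrefl)
    have hB: "\<bar>h y\<bar> \<le> 1 / s1" for y
      using s c pos [of y] by (simp add: h_def frac_le)
    have inner: "laplace z1 (\<lambda>t1. mixed_exp M T1 T2 c t1 t2) = z1 powr (\<alpha>1 - 1) * (\<integral>\<omega>. h (T2 t2 \<omega>) \<partial>M)"
      if t2: "0 < t2" for t2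
    proof -
      have "laplace z1 (\<lambda>t1. mixed_exp M T1 T2 c t1 t2) = laplace z1 (\<lambda>t1. \<integral>\<omega>. f2 t2 (T1 t1 \<omega>) \<partial>M)"
        by (rule laplace_cong) (simp add: r2)
      also have "\<dots> = z1 powr (\<alpha>1 - 1) * laplace s1 (f2 t2)"
        unfolding s1_def by (rule folded_process_expectation(2) [OF M \<alpha>1 T1 F2 FB2 z(1)]) (use t2 in simp_all)
      also have "laplace s1 (f2 t2) = (\<integral>\<omega>. 1 / (s1 + c * T2 t2 \<omega>) \<partial>M)"
        unfolding f2_def by (rule expectation_exp_mult(3) [OF T2m T2n c s(1)]) (use t2 in simp_all)
      also have "\<dots> = (\<integral>\<omega>. h (T2 t2 \<omega>) \<partial>M)"
        by (rule Bochner_Integration.integral_cong [OF refl]) (use T2n [of t2] t2 in \<open>simp add: h_def\<close>)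
      finally show ?thesis .
    qed
    have "laplace2 z1 z2 (mixed_exp M T1 T2 c) = laplace z2 (\<lambda>t2. z1 powr (\<alpha>1 - 1) * (\<integral>\<omega>. h (T2 t2 \<omega>) \<partial>M))"
      unfolding laplace2_def by (rule laplace_cong) (rule inner)
    also have "\<dots> = z1 powr (\<alpha>1 - 1) * (z2 powr (\<alpha>2 - 1) * laplace s2 h)"
      unfolding laplace_cmult s2_def by (subst folded_process_expectation(2) [OF M \<alpha>2 T2 h hB z(2)]) simp_all
    also have "laplace s2 h = laplace s2 (\<lambda>y. 1 / (s1 + c * y))"
      by (rule laplace_cong) (simp add: h_def)
    also have "\<dots> = 1 / (s1 * s2) * stieltjes (c / (s1 * s2))" by (rule laplace_hyperbola [OF s])
    also have "z1 powr (\<alpha>1 - 1) * (z2 powr (\<alpha>2 - 1) * (1 / (s1 * s2) * stieltjes (c / (s1 * s2))))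
        = 1 / (z1 * z2) * stieltjes (c / (s1 * s2))"
      using z by (simp add: s1_def s2_def powr_diff)
    finally show ?thesis by (simp add: s1_def s2_def)
  qed
qed

lemma exp_product_transform:
  assumes "0 \<le> c" "0 < z1" "0 < z2"
  shows "laplace2 z1 z2 (\<lambda>t1 t2. exp (- c * t1 * t2)) = 1 / (z1 * z2) * stieltjes (c / (z1 * z2))"
proof -
  have "laplace2 z1 z2 (\<lambda>t1 t2. exp (- c * t1 * t2)) = laplace z2 (\<lambda>t2. 1 / (z1 + c * t2))"
    unfolding laplace2_def
  proof (rule laplace_cong)
    fix t2 :: real assume "0 < t2"
    then have "0 \<le> c * t2" using assms by simp
    moreover have "(\<lambda>t1. exp (- c * t1 * t2)) = (\<lambda>t1. exp (- (c * t2) * t1))" by (simp add: ac_simps)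
    ultimately show "laplace z1 (\<lambda>t1. exp (- c * t1 * t2)) = 1 / (z1 + c * t2)"
      using laplace_exp(1) [OF assms(2)] by simp
  qed
  also have "\<dots> = 1 / (z1 * z2) * stieltjes (c / (z1 * z2))" by (rule laplace_hyperbola [OF assms(2,3)])
  finally show ?thesis .
qed

context stfprf_family
begin

lemma gen_fun_continuous:
  assumes "0 < l" "0 \<le> u" "u < 1"
  shows "continuous_on R2plus (\<lambda>t. gen_fun u (p l t))"
proof -
  have "uniform_limit R2plus (\<lambda>n t. \<Sum>i<n. u ^ i * pmf (p l t) i) (\<lambda>t. gen_fun u (p l t)) sequentially"
    unfolding gen_fun_def
  proof (rule Weierstrass_m_test)
    show "norm (u ^ n * pmf (p l t) n) \<le> u ^ n" for n t
      using assms pmf_le_1 [of "p l t" n] by (simp add: abs_mult mult_left_le)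
  qed (use assms in \<open>simp add: summable_geometric\<close>)
  moreover have "continuous_on R2plus (\<lambda>t. \<Sum>i<n. u ^ i * pmf (p l t) i)" for n
  proof (intro continuous_on_sum continuous_on_mult_left)
    fix i
    have "continuous_on R2plus (\<lambda>t. (\<lambda>(l, t). pmf (p l t) i) (l, t))"
      by (rule continuous_on_compose2 [OF p_continuous]) (use assms in \<open>auto intro!: continuous_intros\<close>)
    then show "continuous_on R2plus (\<lambda>t. pmf (p l t) i)" by simp
  qed
  ultimately show ?thesis
    by (intro uniform_limit_theorem  [where F = sequentially]) (auto intro: always_eventually)
qed

text \<open>Serves two purposes: at orders 1, 1 with exp(- c t1 t2), and at general orders with
  \<open>mixed_exp\<close>.\<close>

lemma gen_fun_identify:
  assumes l: "0 < l" and u: "0 \<le> u" "u < 1"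
    and c: "\<And>t2. 0 < t2 \<Longrightarrow> continuous_on {0<..} (\<lambda>t1. r t1 t2)" "\<And>t1. 0 < t1 \<Longrightarrow> continuous_on {0<..} (r t1)"
    and B: "\<And>t1 t2. 0 < t1 \<Longrightarrow> 0 < t2 \<Longrightarrow> \<bar>r t1 t2\<bar> \<le> 1"
    and L: "\<And>z1 z2. 0 < z1 \<Longrightarrow> 0 < z2 \<Longrightarrow> laplace2 z1 z2 r
      = 1 / (z1 * z2) * stieltjes (l powr \<beta> * (1 - u) powr \<beta> / (z1 powr \<alpha>1 * z2 powr \<alpha>2))"
    and t: "0 < t1" "0 < t2"
  shows "gen_fun u (p l (t1, t2)) = r t1 t2"
proof (rule laplace2_unique [where f = "\<lambda>t1 t2. gen_fun u (p l (t1, t2))" and B = 1, OF _ _ c _ B _ t])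
  note gc = gen_fun_continuous [OF l u]
  show "continuous_on {0<..} (\<lambda>t1. gen_fun u (p l (t1, t2)))" if "0 < t2" for t2
    by (rule continuous_on_compose2 [OF gc]) (use that in \<open>auto intro!: continuous_intros\<close>)
  show "continuous_on {0<..} (\<lambda>t2. gen_fun u (p l (t1, t2)))" if "0 < t1" for t1
    by (rule continuous_on_compose2 [OF gc]) (use that in \<open>auto intro!: continuous_intros\<close>)
  show "\<bar>gen_fun u (p l (t1, t2))\<bar> \<le> 1" for t1 t2
    using gen_fun_partial_sums(5,6) [OF u] by simp
  show "laplace2 z1 z2 (\<lambda>t1 t2. gen_fun u (p l (t1, t2))) = laplace2 z1 z2 r" if "0 < z1" "0 < z2" for z1 z2
    using gen_fun_transform [OF that u l] L [OF that] by simp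
qed

lemma gen_fun_axes:
  assumes "0 < l" "0 \<le> s"
  shows "gen_fun u (p l (0, s)) = 1" "gen_fun u (p l (s, 0)) = 1"
proof -
  \<comment> \<open>Only the term \<open>n = 0\<close> survives; the factor \<open>0 ^ n\<close>
    presents the sum as a power series evaluated at 0.\<close>
  have "(\<Sum>n. u ^ n * (if n = 0 then 1 else 0)) = (\<Sum>n. (if n = 0 then 1 else 0) * 0 ^ n)"
    by (rule suminf_cong) simp
  then show "gen_fun u (p l (0, s)) = 1" "gen_fun u (p l (s, 0)) = 1"
    by (simp_all add: gen_fun_def p_axes [OF assms])
qed

end

section \<open>Composition of independent processes\<close>

lemma gen_fun_integral:
  assumes u: "0 \<le> u" "u < 1"
  shows "(\<integral>n. u ^ n \<partial>measure_pmf q) = gen_fun u q"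
proof -
  have "integrable (count_space UNIV) (\<lambda>n. pmf q n * u ^ n)"
    using gen_fun_partial_sums(1) [OF u, of q] by (simp add: integrable_count_space_nat_iff mult.commute)
  then have "(\<integral>n. pmf q n * u ^ n \<partial>count_space UNIV) = (\<Sum>n. pmf q n * u ^ n)"
    by (rule integral_count_space_nat)
  moreover have "(\<integral>n. u ^ n \<partial>measure_pmf q) = (\<integral>n. pmf q n * u ^ n \<partial>count_space UNIV)"
    unfolding measure_pmf_eq_density by (subst integral_density) auto
  ultimately show ?thesis by (simp add: gen_fun_def mult.commute)
qed

text \<open>Strong induction on the index: once the earlier coefficients vanish, division by
  \<open>u ^ N\<close> leaves \<open>a N\<close> plus a remainder of size at most u / (1 - u), which
  can be made arbitrarily small.\<close>

lemma power_series_unique_zero: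
  fixes a :: "nat \<Rightarrow> real"
  assumes b: "\<And>n. \<bar>a n\<bar> \<le> 1" and z: "\<And>u. 0 < u \<Longrightarrow> u < 1 \<Longrightarrow> (\<Sum>n. u ^ n * a n) = 0"
  shows "a n = 0"
proof (induction n rule: less_induct)
  case (less N)
  have sm: "summable (\<lambda>n. u ^ n * a (n + k))" if "0 < u" "u < 1" for u k
    by (rule summable_comparison_test' [OF summable_geometric [of u]])
       (use that b in \<open>auto simp: abs_mult mult_left_le\<close>)
  have le: "\<bar>a N\<bar> \<le> u / (1 - u)" if u: "0 < u" "u < 1" for u
  proof -
    have s0: "summable (\<lambda>n. u ^ n * a n)" using sm [OF u, of 0] by simp
    have "0 = (\<Sum>n. u ^ (n + N) * a (n + N)) + (\<Sum>n<N. u ^ n * a n)"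
      using z [OF u] suminf_split_initial_segment [OF s0, of N] by simp
    also have "(\<Sum>n<N. u ^ n * a n) = 0" using less by (intro sum.neutral) auto
    also have "(\<Sum>n. u ^ (n + N) * a (n + N)) = u ^ N * (\<Sum>n. u ^ n * a (n + N))"
      using suminf_mult [OF sm [OF u, of N], of "u ^ N"] by (simp add: power_add ac_simps)
    finally have "(\<Sum>n. u ^ n * a (n + N)) = 0" using u by simp
    moreover have "(\<Sum>n. u ^ n * a (n + N)) = (\<Sum>n. u ^ (n + 1) * a (n + 1 + N)) + a N"
      using suminf_split_initial_segment [OF sm [OF u, of N], of 1] by simp
    moreover have "\<bar>\<Sum>n. u ^ (n + 1) * a (n + 1 + N)\<bar> \<le> (\<Sum>n. u * u ^ n)"
    proof -
      have le: "norm (u ^ (n + 1) * a (n + 1 + N)) \<le> u * u ^ n" for n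
        using u b [of "n + 1 + N"] by (simp add: abs_mult mult_left_le)
      have g: "summable (\<lambda>n. u * u ^ n)" using u by (intro summable_mult summable_geometric) simp
      show ?thesis using norm_suminf_le [OF le g] by simp
    qed
    moreover have "(\<Sum>n. u * u ^ n) = u / (1 - u)"
      using u by (simp add: suminf_mult summable_geometric suminf_geometric)
    ultimately show ?thesis by linarith
  qed
  show ?case
  proof (rule ccontr)
    assume nz: "a N \<noteq> 0"
    define e where "e = \<bar>a N\<bar>"
    have e: "0 < e" using nz by (simp add: e_def)
    \<comment> \<open>For u = e / (2 + e) the bound u / (1 - u) equals e / 2.\<close>
    have "e \<le> (e / (2 + e)) / (1 - e / (2 + e))" unfolding e_def by (rule le) (use e in \<open>auto simp: e_def\<close>)
    also have "\<dots> = e / 2" using e by (simp add: field_simps)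
    finally show False using e by simp
  qed
qed

lemma gen_fun_unique:
  assumes "\<And>u. 0 \<le> u \<Longrightarrow> u < 1 \<Longrightarrow> gen_fun u q = gen_fun u q'"
  shows "q = q'"
proof (rule pmf_eqI)
  fix n
  have "pmf q n - pmf q' n = 0"
  proof (rule power_series_unique_zero [where a = "\<lambda>n. pmf q n - pmf q' n"])
    fix n show "\<bar>pmf q n - pmf q' n\<bar> \<le> 1"
      using pmf_le_1 [of q n] pmf_le_1 [of q' n] pmf_nonneg [of q n] pmf_nonneg [of q' n]
      unfolding abs_le_iff by (intro conjI) linarith+
  next
    fix u :: real assume u: "0 < u" "u < 1"
    have s: "summable (\<lambda>n. u ^ n * pmf r n)" for r
      by (rule summable_norm_cancel, rule gen_fun_partial_sums(1)) (use u in simp_all)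
    have "(\<Sum>n. u ^ n * (pmf q n - pmf q' n)) = gen_fun u q - gen_fun u q'"
      unfolding gen_fun_def right_diff_distrib by (rule suminf_diff [OF s s, symmetric])
    then show "(\<Sum>n. u ^ n * (pmf q n - pmf q' n)) = 0" using assms [of u] u by simp
  qed
  then show "pmf q n = pmf q' n" by simp
qed

lemma distr_nat_eqI:
  fixes X :: "'a \<Rightarrow> nat" and Y :: "'b \<Rightarrow> nat"
  assumes M: "prob_space M" "prob_space M'" and X: "X \<in> measurable M (count_space UNIV)"
    and Y: "Y \<in> measurable M' (count_space UNIV)"
    and E: "\<And>u::real. 0 \<le> u \<Longrightarrow> u < 1 \<Longrightarrow> (\<integral>\<omega>. u ^ X \<omega> \<partial>M) = (\<integral>\<omega>. u ^ Y \<omega> \<partial>M')"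
  shows "distr M (count_space UNIV) X = distr M' (count_space UNIV) Y"
proof -
  have ex: "\<exists>q. measure_pmf q = distr K (count_space UNIV) Z"
    if K: "prob_space K" and Z: "Z \<in> measurable K (count_space UNIV)" for K :: "'c measure" and Z :: "'c \<Rightarrow> nat"
  proof -
    interpret K: prob_space K by (rule K)
    interpret D: prob_space "distr K (count_space UNIV) Z" by (rule K.prob_space_distr [OF Z])
    \<comment> \<open>A law on a countable set gives positive mass to almost every point, the
      condition under which it is the measure of a \<open>pmf\<close>.\<close>
    have "AE x in distr K (count_space UNIV) Z. measure (distr K (count_space UNIV) Z) {x} \<noteq> 0"
    proof (rule iffD2 [OF D.AE_support_countable])
      show "\<exists>S. countable S \<and> (AE x in distr K (count_space UNIV) Z. x \<in> S)"
        by (rule exI [of _ UNIV]) simp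
    qed simp
    then show ?thesis
      using D.prob_space_axioms
      by (intro exI [of _ "Abs_pmf (distr K (count_space UNIV) Z)"], intro Abs_pmf_inverse) simp
  qed
  obtain q where q: "measure_pmf q = distr M (count_space UNIV) X" using ex [OF M(1) X] by blast
  obtain q' where q': "measure_pmf q' = distr M' (count_space UNIV) Y" using ex [OF M(2) Y] by blast
  have "q = q'"
  proof (rule gen_fun_unique)
    fix u :: real assume u: "0 \<le> u" "u < 1"
    have "gen_fun u q = (\<integral>\<omega>. u ^ X \<omega> \<partial>M)"
      unfolding gen_fun_integral [OF u, symmetric] q by (rule integral_distr [OF X]) simp
    also have "\<dots> = (\<integral>\<omega>. u ^ Y \<omega> \<partial>M')" by (rule E [OF u])
    also have "\<dots> = gen_fun u q'"
      unfolding gen_fun_integral [OF u, symmetric] q' by (rule integral_distr [OF Y, symmetric]) simp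
    finally show "gen_fun u q = gen_fun u q'" .
  qed
  then show ?thesis using q q' by simp
qed

lemma gen_fun_poisson:
  assumes "0 < m"
  shows "gen_fun u (poisson_pmf m) = exp (- (m * (1 - u)))"
proof -
  have "(\<lambda>n. exp (- m) * ((m * u) ^ n /\<^sub>R fact n)) sums (exp (- m) * exp (m * u))"
    by (intro sums_mult exp_converges)
  moreover have "exp (- m) * ((m * u) ^ n /\<^sub>R fact n) = u ^ n * pmf (poisson_pmf m) n" for n
    using pmf_poisson [OF assms, of n] by (simp add: power_mult_distrib divide_inverse)
  ultimately have "gen_fun u (poisson_pmf m) = exp (- m) * exp (m * u)"
    by (simp add: gen_fun_def sums_unique [symmetric])
  then show ?thesis by (simp add: exp_add [symmetric] algebra_simps)
qed

text \<open>Independence of the two algebras is read as independence of the identity maps from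
  \<open>M\<close> to \<open>B\<close> and to \<open>A\<close>. The law of the pair (\<omega>,
  \<omega>) on the product algebra is therefore a product measure, and the integral over the
  diagonal becomes one over two separate copies of the space.\<close>

lemma (in prob_space) indep_set_Fubini:
  fixes g :: "'a \<Rightarrow> 'a \<Rightarrow> real"
  assumes A: "space A = space M" "sets A \<subseteq> sets M" and B: "space B = space M" "sets B \<subseteq> sets M"
    and ind: "indep_set (sets A) (sets B)"
    and g: "case_prod g \<in> borel_measurable (B \<Otimes>\<^sub>M A)"
    and K: "\<And>\<omega>' \<omega>. \<omega>' \<in> space M \<Longrightarrow> \<omega> \<in> space M \<Longrightarrow> \<bar>g \<omega>' \<omega>\<bar> \<le> K"
  shows "(\<integral>\<omega>. g \<omega> \<omega> \<partial>M) = (\<integral>\<omega>'. (\<integral>\<omega>. g \<omega>' \<omega> \<partial>M) \<partial>M)"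
proof -
  have idA: "(\<lambda>\<omega>. \<omega>) \<in> measurable M A" using A by (auto intro!: measurableI dest: sets.sets_into_space)
  have idB: "(\<lambda>\<omega>. \<omega>) \<in> measurable M B" using B by (auto intro!: measurableI dest: sets.sets_into_space)
  have gen: "sigma_sets (space M) {(\<lambda>\<omega>. \<omega>) -` S \<inter> space M |S. S \<in> sets C} = sets C"
    if C: "space C = space M" for C
  proof -
    have "{(\<lambda>\<omega>. \<omega>) -` S \<inter> space M |S. S \<in> sets C} = sets C"
    proof (intro equalityI subsetI)
      fix T assume "T \<in> sets C"
      moreover from this have "T = (\<lambda>\<omega>. \<omega>) -` T \<inter> space M" using sets.sets_into_space [of T C] C by auto
      ultimately show "T \<in> {(\<lambda>\<omega>. \<omega>) -` S \<inter> space M |S. S \<in> sets C}" by blast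
    next
      fix T assume "T \<in> {(\<lambda>\<omega>. \<omega>) -` S \<inter> space M |S. S \<in> sets C}"
      then obtain S where "S \<in> sets C" "T = S \<inter> space M" by auto
      then show "T \<in> sets C" using sets.sets_into_space [of S C] C by (simp add: Int_absorb2)
    qed
    then show ?thesis using sets.sigma_sets_eq [of C] C by simp
  qed
  have "indep_set (sets B) (sets A)"
    using ind unfolding indep_sets2_eq by (metis Int_commute mult.commute)
  then have "indep_var B (\<lambda>\<omega>. \<omega>) A (\<lambda>\<omega>. \<omega>)"
    unfolding indep_var_eq using idA idB gen A(1) B(1) by simp
  then have D: "distr M B (\<lambda>\<omega>. \<omega>) \<Otimes>\<^sub>M distr M A (\<lambda>\<omega>. \<omega>) = distr M (B \<Otimes>\<^sub>M A) (\<lambda>\<omega>. (\<omega>, \<omega>))"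
    unfolding indep_var_distribution_eq by blast
  interpret DA: prob_space "distr M A (\<lambda>\<omega>. \<omega>)" by (rule prob_space_distr [OF idA])
  interpret DB: prob_space "distr M B (\<lambda>\<omega>. \<omega>)" by (rule prob_space_distr [OF idB])
  interpret P: pair_prob_space "distr M B (\<lambda>\<omega>. \<omega>)" "distr M A (\<lambda>\<omega>. \<omega>)" ..
  have g': "case_prod g \<in> borel_measurable (distr M B (\<lambda>\<omega>. \<omega>) \<Otimes>\<^sub>M distr M A (\<lambda>\<omega>. \<omega>))"
    using g unfolding measurable_cong_sets [OF sets_pair_measure_cong [OF sets_distr sets_distr] refl] .
  have I: "integrable (distr M B (\<lambda>\<omega>. \<omega>) \<Otimes>\<^sub>M distr M A (\<lambda>\<omega>. \<omega>)) (case_prod g)"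
    by (rule P.P.integrable_const_bound [of _ K, OF _ g'])
       (use K A(1) B(1) in \<open>auto simp: space_pair_measure intro!: AE_I2\<close>)
  have "(\<integral>\<omega>. g \<omega> \<omega> \<partial>M) = (\<integral>x. case_prod g x \<partial>distr M (B \<Otimes>\<^sub>M A) (\<lambda>\<omega>. (\<omega>, \<omega>)))"
    by (subst integral_distr [OF measurable_Pair [OF idB idA] g]) simp
  also have "\<dots> = (\<integral>\<omega>'. (\<integral>\<omega>. g \<omega>' \<omega> \<partial>distr M A (\<lambda>\<omega>. \<omega>)) \<partial>distr M B (\<lambda>\<omega>. \<omega>))"
    unfolding D [symmetric] by (rule P.integral_fst [OF I, symmetric])
  also have "\<dots> = (\<integral>\<omega>'. (\<integral>\<omega>. g \<omega>' \<omega> \<partial>distr M A (\<lambda>\<omega>. \<omega>)) \<partial>M)"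
  proof (rule integral_distr [OF idB])
    show "(\<lambda>\<omega>'. \<integral>\<omega>. g \<omega>' \<omega> \<partial>distr M A (\<lambda>\<omega>. \<omega>)) \<in> borel_measurable B"
    proof (rule DA.borel_measurable_lebesgue_integral)
      show "case_prod g \<in> borel_measurable (B \<Otimes>\<^sub>M distr M A (\<lambda>\<omega>. \<omega>))"
        using g unfolding measurable_cong_sets [OF sets_pair_measure_cong [OF refl sets_distr] refl] .
    qed
  qed
  also have "\<dots> = (\<integral>\<omega>'. (\<integral>\<omega>. g \<omega>' \<omega> \<partial>M) \<partial>M)"
  proof (rule Bochner_Integration.integral_cong [OF refl])
    fix \<omega>' assume w: "\<omega>' \<in> space M"
    have "(\<lambda>\<omega>. g \<omega>' \<omega>) \<in> borel_measurable A"
      using measurable_compose [OF measurable_Pair1' [of \<omega>' B A] g] w B(1) by simp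
    then show "(\<integral>\<omega>. g \<omega>' \<omega> \<partial>distr M A (\<lambda>\<omega>. \<omega>)) = (\<integral>\<omega>. g \<omega>' \<omega> \<partial>M)"
      by (rule integral_distr [OF idA])
  qed
  finally show ?thesis .
qed

section \<open>Algebras generated by processes, and evaluation at random times\<close>

lemma process_algebra_properties:
  assumes "random_process M I S X"
  shows "space (process_algebra M I S X) = space M" "sets (process_algebra M I S X) \<subseteq> sets M"
    and "i \<in> I \<Longrightarrow> X i \<in> measurable (process_algebra M I S X) S"
proof -
  have sub: "{X i -` A \<inter> space M | i A. i \<in> I \<and> A \<in> sets S} \<subseteq> Pow (space M)" by auto
  show sp: "space (process_algebra M I S X) = space M"
    unfolding process_algebra_def by (rule space_measure_of [OF sub])
  show "sets (process_algebra M I S X) \<subseteq> sets M"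
    unfolding process_algebra_def sets_measure_of [OF sub]
  proof (rule sets.sigma_sets_subset, rule subsetI)
    fix T assume "T \<in> {X i -` A \<inter> space M | i A. i \<in> I \<and> A \<in> sets S}"
    then obtain i A where "T = X i -` A \<inter> space M" "i \<in> I" "A \<in> sets S" by blast
    then show "T \<in> sets M" using assms measurable_sets [of "X i" M S A] by (simp add: random_process_def)
  qed
  show "X i \<in> measurable (process_algebra M I S X) S" if "i \<in> I"
  proof (rule measurableI)
    fix x assume "x \<in> space (process_algebra M I S X)"
    then show "X i x \<in> space S"
      using assms that sp measurable_space [of "X i" M S x] by (simp add: random_process_def)
  next
    fix A assume "A \<in> sets S"
    then show "X i -` A \<inter> space (process_algebra M I S X) \<in> sets (process_algebra M I S X)"
      unfolding sp using that unfolding process_algebra_def sets_measure_of [OF sub] by (intro sigma_sets.Basic) blast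
  qed
qed

lemma (in prob_space) independent_algebras_indep_set:
  assumes ind: "independent_algebras M As" and K: "K1 \<subseteq> {..<length As}" "K2 \<subseteq> {..<length As}" "K1 \<inter> K2 = {}"
  shows "indep_set (sigma_sets (space M) (\<Union>i\<in>K1. sets (As ! i))) (sigma_sets (space M) (\<Union>i\<in>K2. sets (As ! i)))"
proof -
  define I where "I = case_bool K1 K2"
  have "indep_sets (\<lambda>k. sets (As ! k)) (\<Union>j\<in>UNIV. I j)"
    by (rule indep_sets_mono_index [OF _ ind [unfolded independent_algebras_def]])
       (use K in \<open>auto simp: I_def split: bool.splits\<close>)
  then have "indep_sets (\<lambda>j. sigma_sets (space M) (\<Union>i\<in>I j. sets (As ! i))) UNIV"
    by (rule indep_sets_collect_sigma)
       (use K in \<open>auto simp: I_def disjoint_family_on_def sets.Int_stable split: bool.splits\<close>)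
  moreover have "(\<lambda>j. sigma_sets (space M) (\<Union>i\<in>I j. sets (As ! i)))
      = case_bool (sigma_sets (space M) (\<Union>i\<in>K1. sets (As ! i))) (sigma_sets (space M) (\<Union>i\<in>K2. sets (As ! i)))"
    by (rule ext) (simp add: I_def split: bool.split)
  ultimately show ?thesis by (simp add: indep_set_def)
qed

lemma measurable_process_substitution:
  assumes X: "random_process M I S X" "measurable_process M I S X"
    and C: "space C = space M" "sets (process_algebra M I S X) \<subseteq> sets C"
    and Y: "Y \<in> measurable C (restrict_space borel I)"
  shows "(\<lambda>\<omega>. X (Y \<omega>) \<omega>) \<in> measurable C S"
proof -
  note P = process_algebra_properties [OF X(1)]
  have "(\<lambda>\<omega>. \<omega>) \<in> measurable C (process_algebra M I S X)"
    using C P by (auto intro!: measurableI dest: sets.sets_into_space)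
  from measurable_compose [OF measurable_Pair [OF Y this] X(2) [unfolded measurable_process_def]]
  show ?thesis by simp
qed

text \<open>Conditioning on \<open>Y\<close>. Joint measurability of the process makes
  \<open>f (X (Y \<omega>') \<omega>)\<close> measurable for the product of the two independent
  algebras, so the outcome that enters through \<open>Y\<close> can be decoupled from the outcome of
  the process.\<close>

lemma (in prob_space) expectation_substitution:
  fixes f :: "'c \<Rightarrow> real"
  assumes X: "random_process M I S X" "measurable_process M I S X"
    and B: "space B = space M" "sets B \<subseteq> sets M" and ind: "indep_set (sets (process_algebra M I S X)) (sets B)"
    and Y: "Y \<in> measurable B (restrict_space borel I)"
    and f: "f \<in> borel_measurable S" "\<And>x. x \<in> space S \<Longrightarrow> \<bar>f x\<bar> \<le> K"
  shows "(\<integral>\<omega>. f (X (Y \<omega>) \<omega>) \<partial>M) = (\<integral>\<omega>'. (\<integral>\<omega>. f (X (Y \<omega>') \<omega>) \<partial>M) \<partial>M)"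
proof -
  note P = process_algebra_properties [OF X(1)]
  show ?thesis
  proof (rule indep_set_Fubini [OF P(1,2) B ind])
    have "(\<lambda>x. (Y (fst x), snd x)) \<in> measurable (B \<Otimes>\<^sub>M process_algebra M I S X) (restrict_space borel I \<Otimes>\<^sub>M process_algebra M I S X)"
      using Y by measurable
    from measurable_compose [OF measurable_compose [OF this X(2) [unfolded measurable_process_def]] f(1)]
    show "(\<lambda>(\<omega>', \<omega>). f (X (Y \<omega>') \<omega>)) \<in> borel_measurable (B \<Otimes>\<^sub>M process_algebra M I S X)"
      by (simp add: split_beta)
    fix \<omega>' \<omega> assume w: "\<omega>' \<in> space M" "\<omega> \<in> space M"
    have "Y \<omega>' \<in> I" using measurable_space [OF Y, of \<omega>'] w B by (simp add: space_restrict_space)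
    then have "X (Y \<omega>') \<omega> \<in> space S" using measurable_space [OF P(3), of "Y \<omega>'" \<omega>] w P(1) by simp
    then show "\<bar>f (X (Y \<omega>') \<omega>)\<bar> \<le> K" by (rule f(2))
  qed
qed

definition joint_algebra :: "'a measure \<Rightarrow> nat set \<Rightarrow> 'a measure list \<Rightarrow> 'a measure" where
  "joint_algebra M K As = sigma (space M) (\<Union>i\<in>K. sets (As ! i))"

lemma joint_algebra_properties:
  assumes As: "\<And>i. i \<in> K \<Longrightarrow> space (As ! i) = space M" "\<And>i. i \<in> K \<Longrightarrow> sets (As ! i) \<subseteq> sets M"
  shows "space (joint_algebra M K As) = space M"
    and "sets (joint_algebra M K As) = sigma_sets (space M) (\<Union>i\<in>K. sets (As ! i))"
    and "sets (joint_algebra M K As) \<subseteq> sets M"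
    and "i \<in> K \<Longrightarrow> sets (As ! i) \<subseteq> sets (joint_algebra M K As)"
proof -
  have sub: "(\<Union>i\<in>K. sets (As ! i)) \<subseteq> Pow (space M)"
    using As(2) sets.sets_into_space [of _ M] by blast
  show "space (joint_algebra M K As) = space M"
    unfolding joint_algebra_def by (rule space_measure_of [OF sub])
  show eq: "sets (joint_algebra M K As) = sigma_sets (space M) (\<Union>i\<in>K. sets (As ! i))"
    unfolding joint_algebra_def by (rule sets_measure_of [OF sub])
  show "sets (joint_algebra M K As) \<subseteq> sets M"
    unfolding eq by (rule sets.sigma_sets_subset) (use As(2) in blast)
  show "i \<in> K \<Longrightarrow> sets (As ! i) \<subseteq> sets (joint_algebra M K As)"
    unfolding eq by (auto intro: sigma_sets.Basic)
qed

lemma measurable_finer_algebra: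
  assumes "X \<in> measurable A S" "space A = space C" "sets A \<subseteq> sets C"
  shows "X \<in> measurable C S"
  using assms by (auto simp: measurable_def)

section \<open>Generating functions and Laplace transforms of the component processes\<close>

lemma expectation_power_distr:
  fixes X :: "'a \<Rightarrow> nat"
  assumes "X \<in> measurable M (count_space UNIV)" "distr M (count_space UNIV) X = measure_pmf q"
    and u: "0 \<le> u" "u < 1"
  shows "(\<integral>\<omega>. u ^ X \<omega> \<partial>M) = gen_fun u q"
proof -
  have "(\<integral>\<omega>. u ^ X \<omega> \<partial>M) = (\<integral>n. u ^ n \<partial>distr M (count_space UNIV) X)"
    by (rule integral_distr [OF assms(1), symmetric]) simp
  then show ?thesis unfolding assms(2) gen_fun_integral [OF u] .
qed

lemma poisson_process_gen_fun:
  assumes "prob_space M" and N: "poisson_process rate M N" and rate: "0 < rate" and h: "0 \<le> h"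
    and u: "0 \<le> u" "u < 1"
  shows "(\<integral>\<omega>. u ^ N h \<omega> \<partial>M) = exp (- (rate * (1 - u) * h))"
proof -
  interpret prob_space M by (rule assms(1))
  have Nm: "N t \<in> measurable M (count_space UNIV)" if "0 \<le> t" for t
    using N that by (simp add: poisson_process_def random_process_def)
  have N0: "AE \<omega> in M. N 0 \<omega> = 0" using N by (simp add: poisson_process_def)
  show ?thesis
  proof (cases "h = 0")
    \<comment> \<open>The law of the increments is prescribed for \<open>s < t\<close> only, so time
      0 is settled by \<open>N 0 = 0\<close> almost surely.\<close>
    case True
    have "(\<integral>\<omega>. u ^ N 0 \<omega> \<partial>M) = (\<integral>\<omega>. 1 \<partial>M)"
    proof (rule integral_cong_AE)
      show "AE \<omega> in M. u ^ N 0 \<omega> = 1" using N0 by eventually_elim simp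
    qed (use Nm [of 0] in \<open>auto intro: measurable_compose\<close>)
    then show ?thesis using True by (simp add: prob_space)
  next
    case False
    with h have h: "0 < h" by simp
    have dm: "(\<lambda>\<omega>. N h \<omega> - N 0 \<omega>) \<in> measurable M (count_space UNIV)"
      using Nm [OF less_imp_le [OF h]] Nm [OF order_refl] by measurable
    have "distr M (count_space UNIV) (\<lambda>\<omega>. N h \<omega> - N 0 \<omega>) = measure_pmf (poisson_pmf (rate * (h - 0)))"
      using N h unfolding poisson_process_def by blast
    from expectation_power_distr [OF dm this u]
    have "(\<integral>\<omega>. u ^ (N h \<omega> - N 0 \<omega>) \<partial>M) = exp (- (rate * h * (1 - u)))"
      using gen_fun_poisson [of "rate * (h - 0)" u] rate h by simp
    moreover have "(\<integral>\<omega>. u ^ N h \<omega> \<partial>M) = (\<integral>\<omega>. u ^ (N h \<omega> - N 0 \<omega>) \<partial>M)"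
    proof (rule integral_cong_AE)
      show "AE \<omega> in M. u ^ N h \<omega> = u ^ (N h \<omega> - N 0 \<omega>)" using N0 by eventually_elim simp
      show "(\<lambda>\<omega>. u ^ N h \<omega>) \<in> borel_measurable M"
        by (rule measurable_compose [OF Nm [OF less_imp_le [OF h]]]) simp
      show "(\<lambda>\<omega>. u ^ (N h \<omega> - N 0 \<omega>)) \<in> borel_measurable M"
        by (rule measurable_compose [OF dm]) simp
    qed
    ultimately show ?thesis by (simp add: ac_simps)
  qed
qed

lemma stable_subordinator2_laplace:
  assumes "prob_space M" and H: "stable_subordinator2 \<beta> M H" and t: "t \<in> R2plus" and v: "0 < v"
  shows "(\<integral>\<omega>. exp (- (v * H t \<omega>)) \<partial>M) = exp (- (v powr \<beta> * fst t * snd t))"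
proof (cases "\<beta> = 1")
  case True
  interpret prob_space M by (rule assms(1))
  have Hm: "H t \<in> borel_measurable M" using H t unfolding stable_subordinator2_def random_process_def by blast
  have ae: "AE \<omega> in M. H t \<omega> = fst t * snd t" using H t True unfolding stable_subordinator2_def by auto
  have "(\<integral>\<omega>. exp (- (v * H t \<omega>)) \<partial>M) = (\<integral>\<omega>. exp (- (v * (fst t * snd t))) \<partial>M)"
  proof (rule integral_cong_AE)
    show "AE \<omega> in M. exp (- (v * H t \<omega>)) = exp (- (v * (fst t * snd t)))" using ae by eventually_elim simp
    show "(\<lambda>\<omega>. exp (- (v * H t \<omega>))) \<in> borel_measurable M" using Hm by measurable
  qed simp
  then show ?thesis using True v by (simp add: prob_space mult.assoc)
next
  case False
  then have "(LINT \<omega>|M. exp (- v * H t \<omega>)) = exp (- fst t * snd t * v powr \<beta>)"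
    using H t v unfolding stable_subordinator2_def by auto
  then show ?thesis by (simp add: ac_simps)
qed

theorem theorem5p2:
  fixes rate \<alpha>1 \<alpha>2 \<beta> :: real
    and M0 :: "'a measure" and M :: "'b measure"
    and NST :: "real \<times> real \<Rightarrow> 'a \<Rightarrow> nat"
    and NS :: "real \<times> real \<Rightarrow> 'b \<Rightarrow> nat"
    and H :: "real \<times> real \<Rightarrow> 'b \<Rightarrow> real"
    and N :: "real \<Rightarrow> 'b \<Rightarrow> nat"
    and T1 T2 :: "real \<Rightarrow> 'b \<Rightarrow> real"
  assumes "rate > 0"
    and "0 < \<alpha>1" "\<alpha>1 \<le> 1" "0 < \<alpha>2" "\<alpha>2 \<le> 1" "0 < \<beta>" "\<beta> \<le> 1"
    and "prob_space M0" "prob_space M"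
    and "STFPRF \<alpha>1 \<alpha>2 \<beta> rate M0 NST"
    and "folded_process \<alpha>1 M T1" "folded_process \<alpha>2 M T2"
    and "stable_subordinator2 \<beta> M H" "measurable_process M R2plus borel H"
    and "poisson_process rate M N" "measurable_process M {0..} (count_space UNIV) N"
    and "SFPRF \<beta> rate M NS" "measurable_process M R2plus (count_space UNIV) NS"
    and "independent_algebras M
           [process_algebra M R2plus (count_space UNIV) NS,
            process_algebra M {0..} borel T1, process_algebra M {0..} borel T2]"
    and "independent_algebras M
           [process_algebra M {0..} (count_space UNIV) N, process_algebra M R2plus borel H,
            process_algebra M {0..} borel T1, process_algebra M {0..} borel T2]"
  shows "\<forall>t1\<ge>0. \<forall>t2\<ge>0.
      eq_in_distribution (count_space UNIV)
        M0 (NST (t1, t2))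
        M (\<lambda>\<omega>. NS (T1 t1 \<omega>, T2 t2 \<omega>) \<omega>) \<and>
      eq_in_distribution (count_space UNIV)
        M (\<lambda>\<omega>. NS (T1 t1 \<omega>, T2 t2 \<omega>) \<omega>)
        M (\<lambda>\<omega>. N (H (T1 t1 \<omega>, T2 t2 \<omega>) \<omega>) \<omega>)"
proof (intro allI impI)
  fix t1 t2 :: real assume t: "0 \<le> t1" "0 \<le> t2"
  note rate = assms(1) and \<alpha>1 = assms(2,3) and \<alpha>2 = assms(4,5) and \<beta> = assms(6,7)
    and M0 = assms(8) and M = assms(9) and NST = assms(10) and T1 = assms(11) and T2 = assms(12)
    and H = assms(13,14) and N = assms(15,16) and NS = assms(17,18) and ind3 = assms(19) and ind4 = assms(20)
  interpret M0: prob_space M0 by (rule M0)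
  interpret M: prob_space M by (rule M)
  from NST obtain pST where pST: "solves_STFPRF_equation \<alpha>1 \<alpha>2 \<beta> pST"
    "\<forall>t\<in>R2plus. distr M0 (count_space UNIV) (NST t) = measure_pmf (pST rate t)"
    and NSTm: "random_process M0 R2plus (count_space UNIV) NST" unfolding STFPRF_def by blast
  from NS(1) obtain pS where pS: "solves_STFPRF_equation 1 1 \<beta> pS"
    "\<forall>t\<in>R2plus. distr M (count_space UNIV) (NS t) = measure_pmf (pS rate t)"
    and NSr: "random_process M R2plus (count_space UNIV) NS" unfolding SFPRF_def STFPRF_def by blast
  interpret ST: stfprf_family \<alpha>1 \<alpha>2 \<beta> pST by unfold_locales (use \<alpha>1 \<alpha>2 \<beta> pST in simp_all)
  interpret S: stfprf_family 1 1 \<beta> pS by unfold_locales (use \<beta> pS in simp_all)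
  have T1r: "random_process M {0..} borel T1" and T2r: "random_process M {0..} borel T2"
    and T1n: "\<And>t \<omega>. 0 \<le> t \<Longrightarrow> \<omega> \<in> space M \<Longrightarrow> 0 \<le> T1 t \<omega>"
    and T2n: "\<And>t \<omega>. 0 \<le> t \<Longrightarrow> \<omega> \<in> space M \<Longrightarrow> 0 \<le> T2 t \<omega>"
    using T1 T2 by (simp_all add: folded_process_def)
  have Hr: "random_process M R2plus borel H" and Hn: "\<And>t \<omega>. t \<in> R2plus \<Longrightarrow> \<omega> \<in> space M \<Longrightarrow> 0 \<le> H t \<omega>"
    using H(1) unfolding stable_subordinator2_def by auto
  have Nr: "random_process M {0..} (count_space UNIV) N" using N(1) by (simp add: poisson_process_def)
  let ?S = "process_algebra M R2plus (count_space UNIV) NS" and ?A1 = "process_algebra M {0..} borel T1"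
    and ?A2 = "process_algebra M {0..} borel T2" and ?N = "process_algebra M {0..} (count_space UNIV) N"
    and ?H = "process_algebra M R2plus borel H"
  note PS = process_algebra_properties [OF NSr] and P1 = process_algebra_properties [OF T1r]
    and P2 = process_algebra_properties [OF T2r] and PN = process_algebra_properties [OF Nr]
    and PH = process_algebra_properties [OF Hr]
  define As where "As = [?S, ?A1, ?A2]"
  define Bs where "Bs = [?N, ?H, ?A1, ?A2]"
  \<comment> \<open>\<open>BT\<close> and \<open>BT'\<close> are generated by the same two random
    times, taken as blocks in the first and the second independence hypothesis; \<open>BH\<close>
    adds the subordinator to the latter.\<close>
  define BT where "BT = joint_algebra M {1, 2} As"
  define BT' where "BT' = joint_algebra M {2, 3} Bs"
  define BH where "BH = joint_algebra M {1, 2, 3} Bs"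
  have nth: "As ! 0 = ?S" "As ! 1 = ?A1" "As ! 2 = ?A2" "Bs ! 0 = ?N" "Bs ! 1 = ?H" "Bs ! 2 = ?A1" "Bs ! 3 = ?A2"
    by (simp_all add: As_def Bs_def numeral_2_eq_2 numeral_3_eq_3)
  have AJT: "space (As ! i) = space M" "sets (As ! i) \<subseteq> sets M" if "i \<in> {1, 2}" for i
    using that P1(1,2) P2(1,2) PH(1,2) by (auto simp only: insert_iff empty_iff nth)
  note QJT = joint_algebra_properties [of "{1, 2}" As M, folded BT_def, OF AJT]
  have JT1: "space BT = space M" by (rule QJT(1))
  have JT2: "sets BT = sigma_sets (space M) (\<Union>i\<in>{1, 2}. sets (As ! i))" by (rule QJT(2))
  have JT3: "sets BT \<subseteq> sets M" by (rule QJT(3))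
  have JT_sub: "sets ?A1 \<subseteq> sets BT" "sets ?A2 \<subseteq> sets BT"
    using QJT(4) [of 1] QJT(4) [of 2] unfolding nth by simp_all
  have AJTh: "space (Bs ! i) = space M" "sets (Bs ! i) \<subseteq> sets M" if "i \<in> {2, 3}" for i
    using that P1(1,2) P2(1,2) PH(1,2) by (auto simp only: insert_iff empty_iff nth)
  note QJTh = joint_algebra_properties [of "{2, 3}" Bs M, folded BT'_def, OF AJTh]
  have JTh1: "space BT' = space M" by (rule QJTh(1))
  have JTh2: "sets BT' = sigma_sets (space M) (\<Union>i\<in>{2, 3}. sets (Bs ! i))" by (rule QJTh(2))
  have JTh3: "sets BT' \<subseteq> sets M" by (rule QJTh(3))
  have JTh_sub: "sets ?A1 \<subseteq> sets BT'" "sets ?A2 \<subseteq> sets BT'"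
    using QJTh(4) [of 2] QJTh(4) [of 3] unfolding nth by simp_all
  have AJH: "space (Bs ! i) = space M" "sets (Bs ! i) \<subseteq> sets M" if "i \<in> {1, 2, 3}" for i
    using that P1(1,2) P2(1,2) PH(1,2) by (auto simp only: insert_iff empty_iff nth)
  note QJH = joint_algebra_properties [of "{1, 2, 3}" Bs M, folded BH_def, OF AJH]
  have JH1: "space BH = space M" by (rule QJH(1))
  have JH2: "sets BH = sigma_sets (space M) (\<Union>i\<in>{1, 2, 3}. sets (Bs ! i))" by (rule QJH(2))
  have JH3: "sets BH \<subseteq> sets M" by (rule QJH(3))
  have JH_sub: "sets ?A1 \<subseteq> sets BH" "sets ?A2 \<subseteq> sets BH" "sets ?H \<subseteq> sets BH"
    using QJH(4) [of 2] QJH(4) [of 3] QJH(4) [of 1] unfolding nth by simp_all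
  have single: "sigma_sets (space M) (\<Union>i\<in>{k}. sets (Ls ! i)) = sets (Ls ! k)" if "space (Ls ! k) = space M" for k Ls
    using sets.sigma_sets_eq [of "Ls ! k"] that by simp
  have iS: "M.indep_set (sets ?S) (sets BT)"
    using M.independent_algebras_indep_set [of As "{0}" "{1, 2}"] ind3 single [of As 0] PS(1)
    unfolding JT2 nth by (simp add: As_def)
  have i12: "M.indep_set (sets ?A2) (sets ?A1)"
    using M.independent_algebras_indep_set [of As "{2}" "{1}"] ind3 single [of As 2] single [of As 1] P1(1) P2(1)
    unfolding nth by (simp add: As_def)
  have iN: "M.indep_set (sets ?N) (sets BH)"
    using M.independent_algebras_indep_set [of Bs "{0}" "{1, 2, 3}"] ind4 single [of Bs 0] PN(1)
    unfolding JH2 nth by (simp add: Bs_def)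
  have iH: "M.indep_set (sets ?H) (sets BT')"
    using M.independent_algebras_indep_set [of Bs "{1}" "{2, 3}"] ind4 single [of Bs 1] PH(1)
    unfolding JTh2 nth by (simp add: Bs_def)
  define Y where "Y \<omega> = (T1 t1 \<omega>, T2 t2 \<omega>)" for \<omega>
  \<comment> \<open>Stated for an arbitrary algebra \<open>C\<close> because it is applied to
    \<open>M\<close> and to the joint algebras above.\<close>
  have Ym: "Y \<in> measurable C (restrict_space borel R2plus)"
    if C: "space C = space M" "sets ?A1 \<subseteq> sets C" "sets ?A2 \<subseteq> sets C" for C
  proof (rule measurable_restrict_space2)
    have "T1 t1 \<in> borel_measurable C" "T2 t2 \<in> borel_measurable C"
      using measurable_finer_algebra [OF P1(3) [of t1]] measurable_finer_algebra [OF P2(3) [of t2]] t C P1(1) P2(1)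
      by simp_all
    then show "Y \<in> borel_measurable C" unfolding Y_def borel_prod [symmetric] by measurable
    show "Y \<in> space C \<rightarrow> R2plus" using T1n T2n t C by (auto simp: Y_def)
  qed
  have YR: "Y \<omega> \<in> R2plus" if "\<omega> \<in> space M" for \<omega> using T1n T2n t that by (simp add: Y_def)
  have NSm: "(\<lambda>\<omega>. NS (Y \<omega>) \<omega>) \<in> measurable M (count_space UNIV)"
    by (rule measurable_process_substitution [OF NSr NS(2) refl PS(2) Ym [OF refl P1(2) P2(2)]])
  have HYm: "(\<lambda>\<omega>. H (Y \<omega>) \<omega>) \<in> measurable C (restrict_space borel {0..})"
    if C: "space C = space M" "sets ?A1 \<subseteq> sets C" "sets ?A2 \<subseteq> sets C" "sets ?H \<subseteq> sets C" for C
    by (rule measurable_restrict_space2 [OF _ measurable_process_substitution [OF Hr H(2) C(1,4) Ym [OF C(1-3)]]])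
       (use Hn YR C in auto)
  have NHm: "(\<lambda>\<omega>. N (H (Y \<omega>) \<omega>) \<omega>) \<in> measurable M (count_space UNIV)"
    by (rule measurable_process_substitution [OF Nr N(2) refl PN(2) HYm [OF refl P1(2) P2(2) PH(2)]])
  have NSTm': "NST (t1, t2) \<in> measurable M0 (count_space UNIV)"
    using NSTm t by (simp add: random_process_def)
  have power_le: "\<bar>u ^ n\<bar> \<le> 1" if "0 \<le> u" "u < 1" for u :: real and n :: nat
    using that by (simp add: power_le_one)
  have gf: "(\<integral>\<omega>. u ^ NST (t1, t2) \<omega> \<partial>M0) = (\<integral>\<omega>. u ^ NS (Y \<omega>) \<omega> \<partial>M)"
    "(\<integral>\<omega>. u ^ NS (Y \<omega>) \<omega> \<partial>M) = (\<integral>\<omega>. u ^ N (H (Y \<omega>) \<omega>) \<omega> \<partial>M)"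
    if u: "0 \<le> u" "u < 1" for u :: real
  proof -
    define c where "c = rate powr \<beta> * (1 - u) powr \<beta>"
    have c0: "0 \<le> c" by (simp add: c_def)
    have cv: "(rate * (1 - u)) powr \<beta> = c" using rate u by (simp add: c_def powr_mult)
    define V where "V = (\<integral>\<omega>. exp (- c * T1 t1 \<omega> * T2 t2 \<omega>) \<partial>M)"
    \<comment> \<open>Off the axes exp(- c x y) has the double transform that
      \<open>gen_fun_identify\<close> asks for at orders 1, 1; on the axes both sides are 1.\<close>
    have gS: "gen_fun u (pS rate (x, y)) = exp (- c * x * y)" if xy: "0 \<le> x" "0 \<le> y" for x y
    proof (cases "x = 0 \<or> y = 0")
      case True
      then show ?thesis using S.gen_fun_axes [OF rate] xy by auto
    next
      case False
      then have "0 < x" "0 < y" using xy by auto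
      then show ?thesis
      proof (rule S.gen_fun_identify [OF rate u, where r = "\<lambda>x y. exp (- c * x * y)", rotated -2])
        show "\<bar>exp (- c * t1 * t2)\<bar> \<le> 1" if "0 < t1" "0 < t2" for t1 t2 using c0 that by simp
        show "laplace2 z1 z2 (\<lambda>x y. exp (- c * x * y))
          = 1 / (z1 * z2) * stieltjes (rate powr \<beta> * (1 - u) powr \<beta> / (z1 powr 1 * z2 powr 1))"
          if "0 < z1" "0 < z2" for z1 z2
          using exp_product_transform [OF c0 that] that by (simp add: c_def)
      qed (intro continuous_intros)+
    qed
    have VS: "(\<integral>\<omega>. u ^ NS (Y \<omega>) \<omega> \<partial>M) = V"
    proof -
      \<comment> \<open>Both random times are frozen, so that the inner integral is the generating
        function of the field at deterministic times.\<close>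
      have "(\<integral>\<omega>. u ^ NS (Y \<omega>) \<omega> \<partial>M) = (\<integral>\<omega>'. (\<integral>\<omega>. u ^ NS (Y \<omega>') \<omega> \<partial>M) \<partial>M)"
        by (rule M.expectation_substitution [OF NSr NS(2) JT1 JT3 iS Ym [OF JT1 JT_sub], where f = "\<lambda>n. u ^ n" and K = 1])
           (use power_le [OF u] in simp_all)
      also have "\<dots> = V"
        unfolding V_def
      proof (rule Bochner_Integration.integral_cong [OF refl])
        fix \<omega>' assume w: "\<omega>' \<in> space M"
        have "(\<integral>\<omega>. u ^ NS (Y \<omega>') \<omega> \<partial>M) = gen_fun u (pS rate (Y \<omega>'))"
          by (rule expectation_power_distr [OF _ _ u]) (use NSr pS(2) YR [OF w] in \<open>simp_all only: random_process_def\<close>)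
        then show "(\<integral>\<omega>. u ^ NS (Y \<omega>') \<omega> \<partial>M) = exp (- c * T1 t1 \<omega>' * T2 t2 \<omega>')"
          using gS T1n [OF t(1) w] T2n [OF t(2) w] by (simp add: Y_def)
      qed
      finally show ?thesis .
    qed
    have VN: "(\<integral>\<omega>. u ^ N (H (Y \<omega>) \<omega>) \<omega> \<partial>M) = V"
    proof -
      define v where "v = rate * (1 - u)"
      have v: "0 < v" using rate u by (simp add: v_def)
      \<comment> \<open>Conditioning in two stages: here the Poisson process is separated from
        \<open>H\<close>, \<open>T1\<close> and \<open>T2\<close>; further down the subordinator is
        separated from \<open>T1\<close> and \<open>T2\<close>.\<close>
      have "(\<integral>\<omega>. u ^ N (H (Y \<omega>) \<omega>) \<omega> \<partial>M) = (\<integral>\<omega>'. (\<integral>\<omega>. u ^ N (H (Y \<omega>') \<omega>') \<omega> \<partial>M) \<partial>M)"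
        by (rule M.expectation_substitution [OF Nr N(2) JH1 JH3 iN HYm [OF JH1 JH_sub], where f = "\<lambda>n. u ^ n" and K = 1])
           (use power_le [OF u] in simp_all)
      \<comment> \<open>\<open>max 0\<close> keeps the exponential bounded by 1 on all real
        arguments, as \<open>expectation_substitution\<close> demands; the values of
        \<open>H\<close> that occur are nonnegative, so nothing changes.\<close>
      also have "\<dots> = (\<integral>\<omega>. exp (- (v * max 0 (H (Y \<omega>) \<omega>))) \<partial>M)"
      proof (rule Bochner_Integration.integral_cong [OF refl])
        fix \<omega> assume w: "\<omega> \<in> space M"
        then show "(\<integral>\<omega>'. u ^ N (H (Y \<omega>) \<omega>) \<omega>' \<partial>M) = exp (- (v * max 0 (H (Y \<omega>) \<omega>)))"
          using poisson_process_gen_fun [OF M N(1) rate Hn [OF YR [OF w] w] u] Hn [OF YR [OF w] w] by (simp add: v_def)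
      qed
      also have "\<dots> = (\<integral>\<omega>'. (\<integral>\<omega>. exp (- (v * max 0 (H (Y \<omega>') \<omega>))) \<partial>M) \<partial>M)"
        by (rule M.expectation_substitution [OF Hr H(2) JTh1 JTh3 iH Ym [OF JTh1 JTh_sub],
              where f = "\<lambda>h. exp (- (v * max 0 h))" and K = 1])
           (use v in \<open>simp_all add: mult_nonneg_nonneg\<close>)
      also have "\<dots> = V"
        unfolding V_def
      proof (rule Bochner_Integration.integral_cong [OF refl])
        fix \<omega>' assume w: "\<omega>' \<in> space M"
        have "(\<integral>\<omega>. exp (- (v * max 0 (H (Y \<omega>') \<omega>))) \<partial>M) = (\<integral>\<omega>. exp (- (v * H (Y \<omega>') \<omega>)) \<partial>M)"
          by (rule Bochner_Integration.integral_cong [OF refl]) (use Hn [OF YR [OF w]] in simp)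
        also have "\<dots> = exp (- (v powr \<beta> * fst (Y \<omega>') * snd (Y \<omega>')))"
          by (rule stable_subordinator2_laplace [OF M H(1) YR [OF w] v])
        finally show "(\<integral>\<omega>. exp (- (v * max 0 (H (Y \<omega>') \<omega>))) \<partial>M) = exp (- c * T1 t1 \<omega>' * T2 t2 \<omega>')"
          using cv by (simp add: Y_def v_def)
      qed
      finally show ?thesis .
    qed
    \<comment> \<open>The point where independence of the two random times from each other
      enters.\<close>
    have Vm: "V = mixed_exp M T1 T2 c t1 t2"
      unfolding V_def mixed_exp_def
    proof (rule M.indep_set_Fubini [OF P2(1,2) P1(1,2) i12, where K = 1])
      have m: "T1 t1 \<in> borel_measurable ?A1" "T2 t2 \<in> borel_measurable ?A2" using P1(3) P2(3) t by auto
      show "(\<lambda>(\<omega>', \<omega>). exp (- c * T1 t1 \<omega>' * T2 t2 \<omega>)) \<in> borel_measurable (?A1 \<Otimes>\<^sub>M ?A2)"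
        using m by measurable
      show "\<bar>exp (- c * T1 t1 \<omega>' * T2 t2 \<omega>)\<bar> \<le> 1" if "\<omega>' \<in> space M" "\<omega> \<in> space M" for \<omega>' \<omega>
        using T1n [OF t(1) that(1)] T2n [OF t(2) that(2)] c0 by simp
    qed
    have VT: "(\<integral>\<omega>. u ^ NST (t1, t2) \<omega> \<partial>M0) = V"
    proof -
      have "(\<integral>\<omega>. u ^ NST (t1, t2) \<omega> \<partial>M0) = gen_fun u (pST rate (t1, t2))"
        by (rule expectation_power_distr [OF NSTm' _ u]) (use pST(2) t in simp)
      also have "\<dots> = V"
      proof (cases "t1 = 0 \<or> t2 = 0")
        \<comment> \<open>Equality of transforms identifies functions at positive times only; on the
          axes the boundary condition and the vanishing of \<open>T1 0\<close> and
          \<open>T2 0\<close> make both sides 1.\<close>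
        case True
        have z1: "AE \<omega> in M. T1 0 \<omega> = 0"
          using T1 unfolding folded_process_def by (cases "\<alpha>1 = 1") simp_all
        have z2: "AE \<omega> in M. T2 0 \<omega> = 0"
          using T2 unfolding folded_process_def by (cases "\<alpha>2 = 1") simp_all
        have "AE \<omega> in M. T1 t1 \<omega> * T2 t2 \<omega> = 0"
          using True
        proof
          assume "t1 = 0"
          from z1 show ?thesis by eventually_elim (simp add: \<open>t1 = 0\<close>)
        next
          assume "t2 = 0"
          from z2 show ?thesis by eventually_elim (simp add: \<open>t2 = 0\<close>)
        qed
        then have ae: "AE \<omega> in M. exp (- c * T1 t1 \<omega> * T2 t2 \<omega>) = 1"
          by eventually_elim (simp add: mult.assoc)
        have m: "T1 t1 \<in> borel_measurable M" "T2 t2 \<in> borel_measurable M"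
          using T1r T2r t by (simp_all add: random_process_def)
        have "V = (\<integral>\<omega>. 1 \<partial>M)"
          unfolding V_def by (rule integral_cong_AE) (use ae m in simp_all)
        then have "V = 1" by (simp add: M.prob_space)
        moreover have "gen_fun u (pST rate (t1, t2)) = 1"
          using True ST.gen_fun_axes [OF rate t(2), of u] ST.gen_fun_axes [OF rate t(1), of u] by (elim disjE) simp_all
        ultimately show ?thesis by simp
      next
        case False
        then have pos: "0 < t1" "0 < t2" using t by auto
        note X = mixed_exp_properties [OF M \<alpha>1 \<alpha>2 T1 T2 c0]
        show ?thesis
          unfolding Vm
          by (rule ST.gen_fun_identify [OF rate u X(1) X(2) X(3) _ pos])
             (simp_all add: X(4) c_def [symmetric])
      qed
      finally show ?thesis .
    qed
    show "(\<integral>\<omega>. u ^ NST (t1, t2) \<omega> \<partial>M0) = (\<integral>\<omega>. u ^ NS (Y \<omega>) \<omega> \<partial>M)"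
      "(\<integral>\<omega>. u ^ NS (Y \<omega>) \<omega> \<partial>M) = (\<integral>\<omega>. u ^ N (H (Y \<omega>) \<omega>) \<omega> \<partial>M)"
      using VS VN VT by simp_all
  qed
  show "eq_in_distribution (count_space UNIV)
        M0 (NST (t1, t2))
        M (\<lambda>\<omega>. NS (T1 t1 \<omega>, T2 t2 \<omega>) \<omega>) \<and>
      eq_in_distribution (count_space UNIV)
        M (\<lambda>\<omega>. NS (T1 t1 \<omega>, T2 t2 \<omega>) \<omega>)
        M (\<lambda>\<omega>. N (H (T1 t1 \<omega>, T2 t2 \<omega>) \<omega>) \<omega>)"
    unfolding Y_def [symmetric] eq_in_distribution_def
    using NSTm' NSm NHm distr_nat_eqI [OF M0 M NSTm' NSm gf(1)] distr_nat_eqI [OF M M NSm NHm gf(2)]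
    by simp
qed

end
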